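(* Let $m\in(1,2]$ and let $U\in C^3(\mathbb{R}^d)$ with $\int e^{-U}<\infty$ satisfy: (A) there exists $A_1\ge0$ with $\|D^kU(q)\|\le A_1(\|q\|+1)^{m-k}$ for all $q$ and $k=2,3$; (B) there exist $A_2>0$, $R\ge0$ with $D^2U(q)\{\nabla U(q)\otimes\nabla U(q)\}\ge A_2\|q\|^{3m-4}$ for all $\|q\|\ge R$; (C) there exist $A_3>0$, $A_4\in\mathbb{R}$ with $\langle\nabla U(q),q\rangle\ge A_3\|q\|^m-A_4$ for all $q$. (a) If $m\in(1,2)$, then for all $T\in\mathbb{N}^*$ and $h>0$, the HMC kernel $P_{h,T}$ is geometrically ergodic. (b) If $m=2$, then for all $T\in\mathbb{N}^*$ there exists $h_H>0$ such that for all $h\in(0,h_H]$, $P_{h,T}$ is geometrically ergodic.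
   Context: $\pi$ is the probability density proportional to $e^{-U}$, $H(q,p)=U(q)+\|p\|^2/2$; $D^kU$ is the $k$-th differential with operator norm, $D^2U(q)\{a\otimes b\}=\langle a,\nabla^2U(q)b\rangle$. For $h>0$ the leapfrog map is $\Phi_h=\Psi^{(1)}_h\circ\Psi^{(2)}_h\circ\Psi^{(1)}_h$ with $\Psi^{(1)}_h(q,p)=(q,p-(h/2)\nabla U(q))$, $\Psi^{(2)}_h(q,p)=(q+hp,p)$; $\Phi_h^{\circ T}$ is the $T$-fold composition and $\Phi^{q,T}_h$ its position component. With $\alpha_H((q,p),(\tilde q,\tilde p))=\min[1,\exp(H(q,p)-H(\tilde q,\tilde p))]$ and $\varphi$ the standard Gaussian density on $\mathbb{R}^d$, the HMC kernel is $P_{h,T}(q,A)=\int 1_A(\Phi^{q,T}_h(q,p))\alpha_H((q,p),\Phi_h^{\circ T}(q,p))\varphi(p)dp+\delta_q(A)\int[1-\alpha_H((q,p),\Phi_h^{\circ T}(q,p))]\varphi(p)dp$; it has $\pi$ as invariant distribution. Geometric ergodicity: there exist a measurable $V:\mathbb{R}^d\to[1,\infty)$, $\rho\in[0,1)$ and $\varsigma\ge0$ such that $\|P^k_{h,T}(q,\cdot)-\pi\|_V\le\varsigma\rho^kV(q)$ for all $q$ and $k$, where $\|\mu-\nu\|_V=\sup_{|f|\le V}|\mu(f)-\nu(f)|$. *)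

theory Defs
  imports "HOL-Probability.Probability"
begin

definition hamiltonian :: "('a::euclidean_space \<Rightarrow> real) \<Rightarrow> 'a \<times> 'a \<Rightarrow> real" where
  "hamiltonian U x = U (fst x) + (norm (snd x))\<^sup>2 / 2"

text \<open>Leapfrog sub-steps; gU is the gradient of U.\<close>
definition psi1 :: "real \<Rightarrow> ('a::euclidean_space \<Rightarrow> 'a) \<Rightarrow> 'a \<times> 'a \<Rightarrow> 'a \<times> 'a" where
  "psi1 h gU x = (fst x, snd x - (h / 2) *\<^sub>R gU (fst x))"

definition psi2 :: "real \<Rightarrow> 'a::euclidean_space \<times> 'a \<Rightarrow> 'a \<times> 'a" where
  "psi2 h x = (fst x + h *\<^sub>R snd x, snd x)"

definition leapfrog :: "real \<Rightarrow> ('a::euclidean_space \<Rightarrow> 'a) \<Rightarrow> 'a \<times> 'a \<Rightarrow> 'a \<times> 'a" where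
  "leapfrog h gU = psi1 h gU \<circ> psi2 h \<circ> psi1 h gU"

definition leapfrog_T :: "real \<Rightarrow> nat \<Rightarrow> ('a::euclidean_space \<Rightarrow> 'a) \<Rightarrow> 'a \<times> 'a \<Rightarrow> 'a \<times> 'a" where
  "leapfrog_T h T gU = (leapfrog h gU) ^^ T"

definition accept_prob :: "('a::euclidean_space \<Rightarrow> real) \<Rightarrow> 'a \<times> 'a \<Rightarrow> 'a \<times> 'a \<Rightarrow> real" where
  "accept_prob U x y = min 1 (exp (hamiltonian U x - hamiltonian U y))"

definition std_gauss :: "'a::euclidean_space \<Rightarrow> real" where
  "std_gauss p = (2 * pi) powr (- real DIM('a) / 2) * exp (- (norm p)\<^sup>2 / 2)"

definition hmc_kernel :: "('a::euclidean_space \<Rightarrow> real) \<Rightarrow> ('a \<Rightarrow> 'a) \<Rightarrow> real \<Rightarrow> nat \<Rightarrow> 'a \<Rightarrow> 'a measure" where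
  "hmc_kernel U gU h T q = measure_of UNIV (sets borel)
     (\<lambda>A. (\<integral>\<^sup>+ p. ennreal (indicator A (fst (leapfrog_T h T gU (q, p)))
                     * accept_prob U (q, p) (leapfrog_T h T gU (q, p)) * std_gauss p) \<partial>lborel)
        + indicator A q * (\<integral>\<^sup>+ p. ennreal ((1 - accept_prob U (q, p) (leapfrog_T h T gU (q, p)))
                     * std_gauss p) \<partial>lborel))"

primrec kernel_pow :: "('a::topological_space \<Rightarrow> 'a measure) \<Rightarrow> nat \<Rightarrow> 'a \<Rightarrow> 'a measure" where
  "kernel_pow P 0 q = return borel q"
| "kernel_pow P (Suc k) q = bind (kernel_pow P k q) P"

definition target :: "('a::euclidean_space \<Rightarrow> real) \<Rightarrow> 'a measure" where
  "target U = density lborel (\<lambda>q. ennreal (exp (- U q) / (\<integral>x. exp (- U x) \<partial>lborel)))"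

definition V_norm :: "'a::topological_space measure \<Rightarrow> 'a measure \<Rightarrow> ('a \<Rightarrow> real) \<Rightarrow> ereal" where
  "V_norm \<mu> \<nu> V = (SUP f \<in> {f. f \<in> borel_measurable borel \<and> (\<forall>x. \<bar>f x\<bar> \<le> V x)}.
      (if integrable \<mu> f \<and> integrable \<nu> f
       then ereal \<bar>(\<integral>x. f x \<partial>\<mu>) - (\<integral>x. f x \<partial>\<nu>)\<bar> else \<infinity>))"

definition geometrically_ergodic :: "('a::topological_space \<Rightarrow> 'a measure) \<Rightarrow> 'a measure \<Rightarrow> bool" where
  "geometrically_ergodic P \<pi> \<longleftrightarrow>
     (\<exists>V \<rho> \<sigma>. V \<in> borel_measurable borel \<and> (\<forall>q. 1 \<le> V q) \<and> 0 \<le> \<rho> \<and> \<rho> < 1 \<and> 0 \<le> \<sigma> \<and>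
        (\<forall>q k. V_norm (kernel_pow P k q) \<pi> V \<le> ereal (\<sigma> * \<rho> ^ k * V q)))"

end

theory Submission
  imports Defs
begin

text \<open>The Lyapunov function is \<open>V q = exp \<parallel>q\<parallel>\<close>. Write \<open>s = h\<^sup>2 \<parallel>q\<parallel>\<^bsup>m-2\<^esup>\<close> and \<open>D = s \<parallel>q\<parallel>\<close>; \<open>s\<close> is small for large \<open>q\<close>
  if \<open>m < 2\<close> and for small \<open>h\<close> if \<open>m = 2\<close>. For momenta with \<open>h \<parallel>p\<parallel>\<close> small against \<open>D\<close> the trajectory is, to leading
  order, that of a particle in the constant force field \<open>- gU q\<close>, so (C) moves the proposal inwards by a multiple of
  \<open>D\<close>, while (B) makes the energy error at most \<open>0\<close>: the proposal is accepted. All other momenta have Gaussian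
  probability at most \<open>exp (- c \<parallel>q\<parallel>\<^bsup>2m-2\<^esup>)\<close>, which beats the possible gain \<open>exp (C \<parallel>q\<parallel>\<^bsup>m-1\<^esup>)\<close> of \<open>V\<close>. Hence
  \<open>P V / V\<close> tends to \<open>0\<close>.

  For the minorization no degree theory is needed: on a suitable ball of momenta (far away if \<open>m < 2\<close>)
  the map from the momentum to the proposal is \<open>T h\<close> times the identity up to a perturbation with small Lipschitz
  constant, uniformly in \<open>q\<close> in bounded sets, so its images contain a common ball on which the kernel has a
  density bounded below. Reversibility gives invariance, and Harris' theorem concludes.\<close>

section \<open>Harris' theorem in a weighted norm\<close>

text \<open>Rejection leaves mass at \<open>q\<close>, so inward proposals contribute to the drift
  only if they are also accepted. The energy error itself need not be small: \<open>D\<close> tends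
  to infinity with \<open>norm q\<close> because \<open>m > 1\<close>. Only its sign is controlled.
  The displacement is close to \<open>- (T\<^sup>2 / 2) * h\<^sup>2\<close> times
  \<open>gU q\<close>. After multiplication of the energy balance by h^2, the change of the squared
  gradient has order \<open>s * D\<^sup>2\<close> and its sign comes from (B), whereas the
  trapezoidal errors, which involve the third derivative, have order
  \<open>s\<^sup>2 * D\<^sup>2\<close>. Hence smallness of \<open>s\<close> alone decides the sign.
  The exponential in \<open>V\<close> matches the fact that every trajectory moves by at most a
  constant times \<open>norm (gU q) + norm p\<close>: the possible gain is integrable against the
  Gaussian, and an inward move by \<open>c * D\<close> multiplies \<open>V\<close> by at most
  \<open>exp (- c * D)\<close>, which tends to 0. Since \<open>V_norm\<close> is infinite as soon as
  some test function is not integrable, integrability of \<open>V\<close> under the target and under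
  all iterates must be proved; it is extracted from the drift and the invariance.\<close>

lemma integral_abs_le_integral:
  fixes f g :: "'a \<Rightarrow> real"
  assumes "integrable M f" "integrable M g" "\<And>x. x \<in> space M \<Longrightarrow> \<bar>f x\<bar> \<le> g x"
  shows "\<bar>\<integral>x. f x \<partial>M\<bar> \<le> (\<integral>x. g x \<partial>M)"
  by (rule order_trans[OF integral_abs_bound]) (rule integral_mono, use assms in auto)

text \<open>The minorization is demanded at every level \<open>r\<close>, with a measure of
  arbitrary positive mass depending on \<open>r\<close>. The level can therefore be fixed after
  \<open>\<gamma>\<close> and \<open>K\<close>, as large as the contraction argument
  requires.\<close>

locale harris_chain =
  fixes P :: "'a::topological_space \<Rightarrow> 'a measure" and \<pi> :: "'a measure"
    and V :: "'a \<Rightarrow> real" and \<gamma> K :: real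
  assumes P [measurable]: "P \<in> borel \<rightarrow>\<^sub>M prob_algebra borel"
    and pi: "\<pi> \<in> space (prob_algebra borel)"
    and inv: "\<pi> \<bind> P = \<pi>"
    and V_meas [measurable]: "V \<in> borel_measurable borel"
    and V_ge1: "1 \<le> V x"
    and gamma: "0 \<le> \<gamma>" "\<gamma> < 1" and K: "0 \<le> K"
    and drift: "(\<integral>\<^sup>+y. ennreal (V y) \<partial>P x) \<le> ennreal (\<gamma> * V x + K)"
    and minor: "\<exists>\<mu>. finite_measure \<mu> \<and> sets \<mu> = sets borel \<and> emeasure \<mu> UNIV \<noteq> 0 \<and>
                  (\<forall>x. V x \<le> r \<longrightarrow> (\<forall>A\<in>sets borel. emeasure \<mu> A \<le> emeasure (P x) A))"
begin

lemma sets_P [simp, measurable_cong]: "sets (P x) = sets borel"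
  and prob_space_P: "prob_space (P x)"
  using measurable_space[OF P, of x] by (auto simp: space_prob_algebra)

lemma sets_pi [simp, measurable_cong]: "sets \<pi> = sets borel"
  and prob_space_pi: "prob_space \<pi>"
  using pi by (auto simp: space_prob_algebra)

lemma V_pos: "0 < V x" "0 \<le> V x" using V_ge1[of x] by auto

lemma P_subprob [measurable]: "P \<in> borel \<rightarrow>\<^sub>M subprob_algebra borel"
  by (rule measurable_prob_algebraD[OF P])

lemma nn_integral_bind_P:
  assumes "sets M = sets borel" "f \<in> borel_measurable borel"
  shows "(\<integral>\<^sup>+x. f x \<partial>(M \<bind> P)) = (\<integral>\<^sup>+x. (\<integral>\<^sup>+y. f y \<partial>P x) \<partial>M)"
  using assms P_subprob by (intro nn_integral_bind[where B=borel]) (auto cong: measurable_cong_sets)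

lemma integrable_V_bound:
  fixes f :: "'a \<Rightarrow> real"
  assumes s: "sets M = sets borel" and V: "(\<integral>\<^sup>+y. ennreal (V y) \<partial>M) < \<infinity>"
    and f: "f \<in> borel_measurable borel" and b: "\<And>x. \<bar>f x\<bar> \<le> c * V x"
  shows "integrable M f"
proof -
  have "integrable M V"
    using V s V_pos by (subst integrable_iff_bounded) (auto cong: measurable_cong_sets)
  then have "integrable M (\<lambda>x. c * V x)" by simp
  then show ?thesis
    by (rule Bochner_Integration.integrable_bound)
      (use f s b in \<open>auto cong: measurable_cong_sets intro: order_trans[OF _ abs_ge_self]\<close>)
qed

lemma drift_finite: "(\<integral>\<^sup>+y. ennreal (V y) \<partial>P x) < \<infinity>"
  using drift[of x] by (simp add: order.strict_trans1)

lemma integrable_P: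
  fixes f :: "'a \<Rightarrow> real"
  assumes "f \<in> borel_measurable borel" "\<And>x. \<bar>f x\<bar> \<le> c * V x"
  shows "integrable (P x) f"
  by (rule integrable_V_bound[OF _ drift_finite assms]) auto

lemma integrable_P_V: "integrable (P x) V"
  by (rule integrable_P[where c=1]) (use V_pos in auto)

lemma integral_V_le: "(\<integral>y. V y \<partial>P x) \<le> \<gamma> * V x + K"
proof -
  have "ennreal (\<integral>y. V y \<partial>P x) \<le> ennreal (\<gamma> * V x + K)"
    using drift[of x] by (subst nn_integral_eq_integral[symmetric]) (use integrable_P_V V_pos in auto)
  moreover have "0 \<le> \<gamma> * V x + K" using gamma K V_pos(2)[of x] by simp
  ultimately show ?thesis by (rule ennreal_le_iff[THEN iffD1, rotated])
qed

lemma integral_P_measurable [measurable]: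
  "f \<in> borel_measurable borel \<Longrightarrow> (\<lambda>x. \<integral>y. f y \<partial>P x) \<in> borel_measurable borel" for f :: "'a \<Rightarrow> real"
  using measurable_compose[OF P_subprob integral_measurable_subprob_algebra[of f borel]] by simp

text \<open>Integrating \<open>min V n\<close> against the invariant measure avoids subtracting infinities; then Fatou.\<close>
lemma pi_V_finite: "(\<integral>\<^sup>+y. ennreal (V y) \<partial>\<pi>) < \<infinity>"
proof -
  interpret pi: prob_space \<pi> by (rule prob_space_pi)
  define W where "W n x = min (\<gamma> * V x + K) (real n)" for n x
  \<comment> \<open>The drift deficit of the truncated function, shifted by \<open>K\<close> to be
    nonnegative. Its integral is at most \<open>K\<close> by invariance, and at each point it equals
    \<open>(1 - \<gamma>) * V x\<close> once \<open>n\<close> exceeds both truncated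
    quantities.\<close>
  define G where "G n x = min (V x) (real n) - W n x + K" for n x
  have W_nn: "0 \<le> W n x" for n x using gamma K V_pos(2)[of x] by (simp add: W_def)
  have W_meas [measurable]: "W n \<in> borel_measurable borel" for n unfolding W_def by measurable
  have W_le: "(\<integral>\<^sup>+y. ennreal (min (V y) (real n)) \<partial>P x) \<le> ennreal (W n x)" for n x
  proof -
    interpret prob_space "P x" by (rule prob_space_P)
    have "(\<integral>\<^sup>+y. ennreal (min (V y) (real n)) \<partial>P x) \<le> (\<integral>\<^sup>+y. ennreal (real n) \<partial>P x)"
      by (intro nn_integral_mono) (auto intro: ennreal_leI)
    also have "\<dots> = ennreal (real n)" by (simp add: emeasure_space_1)
    finally have 1: "(\<integral>\<^sup>+y. ennreal (min (V y) (real n)) \<partial>P x) \<le> ennreal (real n)" .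
    have 2: "(\<integral>\<^sup>+y. ennreal (min (V y) (real n)) \<partial>P x) \<le> ennreal (\<gamma> * V x + K)"
      by (rule order_trans[OF _ drift]) (intro nn_integral_mono ennreal_leI, auto)
    show ?thesis using 1 2 by (auto simp: W_def min_def)
  qed
  have G_nn: "0 \<le> G n x" for n x
  proof -
    have "\<gamma> * V x \<le> V x" using gamma V_pos(2)[of x] by (simp add: mult_left_le_one_le)
    then show ?thesis using K by (auto simp: G_def W_def min_def)
  qed
  have int_b: "integrable \<pi> f" if "f \<in> borel_measurable borel" "\<And>x. 0 \<le> f x" "\<And>x. f x \<le> real n" for f :: "'a \<Rightarrow> real" and n
    by (rule pi.integrable_const_bound[of _ "real n"]) (use that in \<open>auto cong: measurable_cong_sets\<close>)
  have iW: "integrable \<pi> (W n)" for n by (rule int_b[of _ n]) (use W_nn in \<open>auto simp: W_def\<close>)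
  have iV: "integrable \<pi> (\<lambda>x. min (V x) (real n))" for n
    by (rule int_b[of _ n]) (use V_pos in auto)
  have le: "(\<integral>x. min (V x) (real n) \<partial>\<pi>) \<le> (\<integral>x. W n x \<partial>\<pi>)" for n
  proof -
    have "(\<integral>\<^sup>+x. ennreal (min (V x) (real n)) \<partial>\<pi>) = (\<integral>\<^sup>+x. (\<integral>\<^sup>+y. ennreal (min (V y) (real n)) \<partial>P x) \<partial>\<pi>)"
      by (subst inv[symmetric], rule nn_integral_bind_P) auto
    also have "\<dots> \<le> (\<integral>\<^sup>+x. ennreal (W n x) \<partial>\<pi>)" by (intro nn_integral_mono W_le)
    also have "(\<integral>\<^sup>+x. ennreal (min (V x) (real n)) \<partial>\<pi>) = ennreal (\<integral>x. min (V x) (real n) \<partial>\<pi>)"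
      by (rule nn_integral_eq_integral[OF iV]) (simp add: V_pos)
    also have "(\<integral>\<^sup>+x. ennreal (W n x) \<partial>\<pi>) = ennreal (\<integral>x. W n x \<partial>\<pi>)"
      by (rule nn_integral_eq_integral[OF iW]) (simp add: W_nn)
    finally have "ennreal (\<integral>x. min (V x) (real n) \<partial>\<pi>) \<le> ennreal (\<integral>x. W n x \<partial>\<pi>)" .
    moreover have "0 \<le> (\<integral>x. W n x \<partial>\<pi>)" by (rule Bochner_Integration.integral_nonneg) (rule W_nn)
    ultimately show ?thesis by (rule ennreal_le_iff[THEN iffD1, rotated])
  qed
  have G_le: "(\<integral>\<^sup>+x. ennreal (G n x) \<partial>\<pi>) \<le> ennreal K" for n
  proof -
    have "(\<integral>\<^sup>+x. ennreal (G n x) \<partial>\<pi>) = ennreal (\<integral>x. G n x \<partial>\<pi>)"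
      by (intro nn_integral_eq_integral) (use iW iV G_nn in \<open>auto simp: G_def\<close>)
    also have "(\<integral>x. G n x \<partial>\<pi>) = (\<integral>x. min (V x) (real n) \<partial>\<pi>) - (\<integral>x. W n x \<partial>\<pi>) + K"
      unfolding G_def using iW iV by (simp add: pi.prob_space)
    also have "\<dots> \<le> K" using le by simp
    finally show ?thesis by (simp add: ennreal_leI)
  qed
  have lim: "(\<lambda>n. ennreal (G n x)) \<longlonglongrightarrow> ennreal ((1 - \<gamma>) * V x)" for x
  proof (rule tendsto_eventually)
    obtain N where N: "max (V x) (\<gamma> * V x + K) \<le> real N" using real_arch_simple by blast
    show "eventually (\<lambda>n. ennreal (G n x) = ennreal ((1 - \<gamma>) * V x)) sequentially"
      using eventually_ge_at_top[of N]
    proof eventually_elim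
      case (elim n)
      then have "real N \<le> real n" by simp
      then show ?case using N by (simp add: G_def W_def min_def algebra_simps)
    qed
  qed
  have "(\<integral>\<^sup>+x. ennreal ((1 - \<gamma>) * V x) \<partial>\<pi>) = (\<integral>\<^sup>+x. liminf (\<lambda>n. ennreal (G n x)) \<partial>\<pi>)"
    by (intro nn_integral_cong lim_imp_Liminf[symmetric] lim) simp
  also have "\<dots> \<le> liminf (\<lambda>n. \<integral>\<^sup>+x. ennreal (G n x) \<partial>\<pi>)"
    by (intro nn_integral_liminf) (auto simp: G_def)
  also have "\<dots> \<le> ennreal K"
    by (rule order_trans[OF Liminf_mono[where g="\<lambda>_. ennreal K"]]) (use G_le in \<open>auto simp: Liminf_const\<close>)
  finally have "ennreal (1 - \<gamma>) * (\<integral>\<^sup>+x. ennreal (V x) \<partial>\<pi>) \<le> ennreal K"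
    using gamma V_pos by (simp add: nn_integral_cmult ennreal_mult)
  then have "ennreal (1 - \<gamma>) * (\<integral>\<^sup>+x. ennreal (V x) \<partial>\<pi>) < \<infinity>"
    by (simp add: order.strict_trans1)
  then show ?thesis using gamma by (auto simp: ennreal_mult_less_top)
qed

text \<open>For nonnegative integrands the identity is the disintegration of \<open>bind\<close>. A
  signed \<open>f\<close> becomes nonnegative, and stays dominated by a multiple of
  \<open>V\<close>, after adding \<open>\<bar>c\<bar> * V\<close>; since \<open>V\<close> is
  integrable on both sides, the added part can be subtracted again.\<close>

lemma integral_bind_P:
  fixes f :: "'a \<Rightarrow> real"
  assumes M: "M \<in> space (prob_algebra borel)" and VM: "(\<integral>\<^sup>+y. ennreal (V y) \<partial>M) < \<infinity>"
    and f [measurable]: "f \<in> borel_measurable borel" and b: "\<And>x. \<bar>f x\<bar> \<le> c * V x"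
  shows "(\<integral>\<^sup>+y. ennreal (V y) \<partial>(M \<bind> P)) < \<infinity>"
    and "(\<integral>x. f x \<partial>(M \<bind> P)) = (\<integral>x. (\<integral>y. f y \<partial>P x) \<partial>M)"
proof -
  have sM [simp, measurable_cong]: "sets M = sets borel" and "prob_space M" using M by (auto simp: space_prob_algebra)
  interpret M: prob_space M by fact
  have sB [simp, measurable_cong]: "sets (M \<bind> P) = sets borel" by (rule sets_bind'[OF M P])
  have iMV: "integrable M V" by (rule integrable_V_bound[OF sM VM, where c=1]) (use V_pos in auto)
  have "(\<integral>\<^sup>+y. ennreal (V y) \<partial>(M \<bind> P)) = (\<integral>\<^sup>+x. (\<integral>\<^sup>+y. ennreal (V y) \<partial>P x) \<partial>M)"
    by (rule nn_integral_bind_P) auto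
  also have "\<dots> \<le> (\<integral>\<^sup>+x. ennreal (\<gamma> * V x + K) \<partial>M)" by (intro nn_integral_mono drift)
  also have "\<dots> = ennreal (\<integral>x. \<gamma> * V x + K \<partial>M)"
    using iMV gamma K V_pos by (intro nn_integral_eq_integral) auto
  also have "\<dots> < \<infinity>" by simp
  finally show VB: "(\<integral>\<^sup>+y. ennreal (V y) \<partial>(M \<bind> P)) < \<infinity>" .
  have nonneg: "(\<integral>x. g x \<partial>(M \<bind> P)) = (\<integral>x. (\<integral>y. g y \<partial>P x) \<partial>M)"
    if [measurable]: "g \<in> borel_measurable borel" and g: "\<And>x. 0 \<le> g x" "\<And>x. g x \<le> d * V x" for g :: "'a \<Rightarrow> real" and d
  proof -
    have gb: "\<bar>g x\<bar> \<le> d * V x" for x using g[of x] by simp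
    have "(\<integral>x. g x \<partial>(M \<bind> P)) = enn2real (\<integral>\<^sup>+x. ennreal (g x) \<partial>(M \<bind> P))"
      by (rule integral_eq_nn_integral) (use g in auto)
    also have "(\<integral>\<^sup>+x. ennreal (g x) \<partial>(M \<bind> P)) = (\<integral>\<^sup>+x. (\<integral>\<^sup>+y. ennreal (g y) \<partial>P x) \<partial>M)"
      by (rule nn_integral_bind_P) auto
    also have "\<dots> = (\<integral>\<^sup>+x. ennreal (\<integral>y. g y \<partial>P x) \<partial>M)"
      by (intro nn_integral_cong nn_integral_eq_integral integrable_P[OF _ gb]) (use g in auto)
    also have "enn2real \<dots> = (\<integral>x. (\<integral>y. g y \<partial>P x) \<partial>M)"
      by (rule integral_eq_nn_integral[symmetric]) (use g in \<open>auto intro!: integral_nonneg_AE\<close>)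
    finally show ?thesis .
  qed
  have P_bound: "\<bar>\<integral>y. g y \<partial>P x\<bar> \<le> (\<bar>d\<bar> * (\<gamma> + K)) * V x"
    if [measurable]: "g \<in> borel_measurable borel" and g: "\<And>x. \<bar>g x\<bar> \<le> d * V x" for g :: "'a \<Rightarrow> real" and d x
  proof -
    have gd: "\<bar>g y\<bar> \<le> \<bar>d\<bar> * V y" for y
      using g[of y] mult_right_mono[OF abs_ge_self[of d] V_pos(2)[of y]] by linarith
    have "\<bar>\<integral>y. g y \<partial>P x\<bar> \<le> (\<integral>y. \<bar>d\<bar> * V y \<partial>P x)"
      by (rule integral_abs_le_integral)
        (use integrable_P[OF that] integrable_P_V gd in auto)
    also have "\<dots> \<le> \<bar>d\<bar> * (\<gamma> * V x + K)" using integral_V_le[of x] by (simp add: mult_left_mono)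
    also have "\<dots> \<le> \<bar>d\<bar> * (\<gamma> * V x + K * V x)" using mult_left_mono[OF V_ge1[of x] K] by (intro mult_left_mono add_left_mono) auto
    finally show ?thesis by (simp add: algebra_simps)
  qed
  have bV: "\<bar>c * V x\<bar> \<le> \<bar>c\<bar> * V x" for x using V_pos[of x] by (simp add: abs_mult)
  have b': "f x + \<bar>c\<bar> * V x \<ge> 0" "f x + \<bar>c\<bar> * V x \<le> (2 * \<bar>c\<bar>) * V x" for x
    using b[of x] bV[of x] by linarith+
  have cb: "\<bar>\<bar>c\<bar> * V x\<bar> \<le> \<bar>c\<bar> * V x" for x using V_pos[of x] by (simp add: abs_mult)
  have bb: "\<bar>f x + \<bar>c\<bar> * V x\<bar> \<le> (2 * \<bar>c\<bar>) * V x" for x using b'[of x] by simp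
  have iB: "integrable (M \<bind> P) g" if "g \<in> borel_measurable borel" "\<And>x. \<bar>g x\<bar> \<le> d * V x" for g :: "'a \<Rightarrow> real" and d
    by (rule integrable_V_bound[OF sB VB that])
  have iM: "integrable M (\<lambda>x. \<integral>y. g y \<partial>P x)" if "g \<in> borel_measurable borel" "\<And>x. \<bar>g x\<bar> \<le> d * V x" for g :: "'a \<Rightarrow> real" and d
    by (rule integrable_V_bound[OF sM VM _ P_bound[OF that]]) (use that in measurable)
  have "(\<integral>x. f x \<partial>(M \<bind> P)) = (\<integral>x. (f x + \<bar>c\<bar> * V x) - \<bar>c\<bar> * V x \<partial>(M \<bind> P))" by simp
  also have "\<dots> = (\<integral>x. f x + \<bar>c\<bar> * V x \<partial>(M \<bind> P)) - (\<integral>x. \<bar>c\<bar> * V x \<partial>(M \<bind> P))"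
    by (rule Bochner_Integration.integral_diff; rule iB, measurable) (rule bb, rule cb)
  also have "\<dots> = (\<integral>x. (\<integral>y. f y + \<bar>c\<bar> * V y \<partial>P x) \<partial>M) - (\<integral>x. (\<integral>y. \<bar>c\<bar> * V y \<partial>P x) \<partial>M)"
    using nonneg[OF _ b'] nonneg[of "\<lambda>x. \<bar>c\<bar> * V x" "\<bar>c\<bar>"] V_pos by simp
  also have "\<dots> = (\<integral>x. (\<integral>y. f y + \<bar>c\<bar> * V y \<partial>P x) - (\<integral>y. \<bar>c\<bar> * V y \<partial>P x) \<partial>M)"
    by (rule Bochner_Integration.integral_diff[symmetric]; rule iM, measurable) (rule bb, rule cb)
  also have "\<dots> = (\<integral>x. (\<integral>y. f y \<partial>P x) \<partial>M)"
  proof (rule Bochner_Integration.integral_cong[OF refl])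
    fix x
    have "(\<integral>y. f y + \<bar>c\<bar> * V y \<partial>P x) = (\<integral>y. f y \<partial>P x) + (\<integral>y. \<bar>c\<bar> * V y \<partial>P x)"
      by (rule Bochner_Integration.integral_add) (use integrable_P[OF f b] integrable_P_V in auto)
    then show "(\<integral>y. f y + \<bar>c\<bar> * V y \<partial>P x) - (\<integral>y. \<bar>c\<bar> * V y \<partial>P x) = (\<integral>y. f y \<partial>P x)" by simp
  qed
  finally show "(\<integral>x. f x \<partial>(M \<bind> P)) = (\<integral>x. (\<integral>y. f y \<partial>P x) \<partial>M)" .
qed


lemma pi_bind_integral:
  fixes f :: "'a \<Rightarrow> real"
  assumes "f \<in> borel_measurable borel" "\<And>x. \<bar>f x\<bar> \<le> c * V x"
  shows "(\<integral>x. (\<integral>y. f y \<partial>P x) \<partial>\<pi>) = (\<integral>x. f x \<partial>\<pi>)"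
  using integral_bind_P(2)[OF pi pi_V_finite assms] by (simp add: inv)

text \<open>The hypothesis says that every lower envelope
  \<open>f x - L * (1 + \<beta> * V x)\<close> lies below every upper envelope
  \<open>f y + L * (1 + \<beta> * V y)\<close>, so the supremum of the former separates them. This
  turns the weighted oscillation seminorm into a weighted sup norm modulo constants.\<close>

lemma weighted_osc_center:
  fixes f :: "'a \<Rightarrow> real"
  assumes "\<And>x y. \<bar>f x - f y\<bar> \<le> L * (2 + \<beta> * V x + \<beta> * V y)"
  obtains c where "\<And>x. \<bar>f x - c\<bar> \<le> L * (1 + \<beta> * V x)"
proof
  define c where "c = (SUP x. f x - L * (1 + \<beta> * V x))"
  have le: "f x - L * (1 + \<beta> * V x) \<le> f y + L * (1 + \<beta> * V y)" for x y
    using assms[of x y] by (simp add: algebra_simps abs_le_iff)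
  then have bdd: "bdd_above (range (\<lambda>x. f x - L * (1 + \<beta> * V x)))" by (intro bdd_aboveI) auto
  fix x
  have "f x - L * (1 + \<beta> * V x) \<le> c" unfolding c_def by (rule cSUP_upper[OF _ bdd]) simp
  moreover have "c \<le> f x + L * (1 + \<beta> * V x)" unfolding c_def by (rule cSUP_least) (use le in auto)
  ultimately show "\<bar>f x - c\<bar> \<le> L * (1 + \<beta> * V x)" by (simp add: abs_le_iff)
qed

lemma V_bound_of_affine: "L * (1 + \<beta> * V x) \<le> (L * (1 + \<beta>)) * V x" if "0 \<le> L"
proof -
  have "L * (1 + \<beta> * V x) \<le> L * (V x + \<beta> * V x)" using V_ge1[of x] that by (intro mult_left_mono) auto
  then show ?thesis by (simp add: algebra_simps)
qed

text \<open>After centring \<open>f\<close>, the drift contracts pairs with \<open>V x + V y \<ge> R\<close> and the common component \<open>\<mu>\<close> contracts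
  the others; \<open>\<beta>\<close> is chosen so that the additive drift constant costs at most the mass of \<open>\<mu>\<close>.\<close>
lemma contraction:
  obtains \<beta> \<rho> where "0 < \<beta>" "0 \<le> \<rho>" "\<rho> < 1"
    "\<And>(f :: 'a \<Rightarrow> real) L x y. f \<in> borel_measurable borel \<Longrightarrow> 0 \<le> L \<Longrightarrow>
      (\<And>x y. \<bar>f x - f y\<bar> \<le> L * (2 + \<beta> * V x + \<beta> * V y)) \<Longrightarrow>
      \<bar>(\<integral>z. f z \<partial>P x) - (\<integral>z. f z \<partial>P y)\<bar> \<le> \<rho> * L * (2 + \<beta> * V x + \<beta> * V y)"
proof -
  \<comment> \<open>Beyond this level the additive term \<open>2 * K\<close> costs at most half of
    the gain \<open>(1 - \<gamma>) * S\<close>, which leaves the rate \<open>\<gamma>1\<close>, the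
    midpoint of \<open>\<gamma>\<close> and 1. The summand 1 keeps \<open>R\<close> positive when
    \<open>K = 0\<close>.\<close>
  define R where "R = 4 * (K + 1) / (1 - \<gamma>)"
  have R: "0 < R" "2 * K \<le> (1 - \<gamma>) * R / 2" using gamma K by (auto simp: R_def field_simps)
  obtain \<mu> where \<mu>: "finite_measure \<mu>" "emeasure \<mu> UNIV \<noteq> 0"
    and s\<mu> [simp, measurable_cong]: "sets \<mu> = sets borel"
    and dom: "\<And>x A. V x \<le> R \<Longrightarrow> A \<in> sets borel \<Longrightarrow> emeasure \<mu> A \<le> emeasure (P x) A"
    using minor[of R] by blast
  interpret \<mu>: finite_measure \<mu> by fact
  have sp\<mu>: "space \<mu> = UNIV" using sets_eq_imp_space_eq[OF s\<mu>] by simp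
  define e where "e = measure \<mu> UNIV"
  have e: "0 < e" using \<mu> by (auto simp: e_def \<mu>.emeasure_eq_measure zero_less_measure_iff)
  \<comment> \<open>Two points in the small set contribute \<open>2 * \<beta> * K\<close> through
    the drift, and the common mass removes \<open>2 * e\<close>; this choice lets the former cost at
    most \<open>e\<close>.\<close>
  define \<beta> where "\<beta> = e / (2 * K + 1)"
  have \<beta>: "0 < \<beta>" "2 * \<beta> * K \<le> e" using e K by (auto simp: \<beta>_def field_simps)
  define \<gamma>1 where "\<gamma>1 = (1 + \<gamma>) / 2"
  have \<gamma>1: "0 \<le> \<gamma>1" "\<gamma>1 < 1" using gamma by (auto simp: \<gamma>1_def)
  \<comment> \<open>The quotient \<open>(2 + \<beta> * \<gamma>1 * S) / (2 + \<beta> * S)\<close>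
    decreases in \<open>S\<close>, so its value at \<open>S = R\<close> is a bound for all larger
    \<open>S\<close>.\<close>
  define \<rho>2 where "\<rho>2 = (2 + \<beta> * \<gamma>1 * R) / (2 + \<beta> * R)"
  have den: "0 < 2 + \<beta> * R" using \<beta> R by (simp add: add_pos_pos)
  have \<rho>2: "\<rho>2 < 1"
    unfolding \<rho>2_def using \<beta> R \<gamma>1 den by (simp add: divide_simps)
  define \<rho> where "\<rho> = max (max (1 - e / 2) \<gamma>) \<rho>2"
  have \<rho>: "0 \<le> \<rho>" "\<rho> < 1" "1 - e / 2 \<le> \<rho>" "\<gamma> \<le> \<rho>" "\<rho>2 \<le> \<rho>"
    using gamma e \<rho>2 by (auto simp: \<rho>_def)
  have key: "(\<integral>z. f z \<partial>P x) - (\<integral>z. f z \<partial>P y) \<le> \<rho> * L * (2 + \<beta> * V x + \<beta> * V y)"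
    if fm [measurable]: "f \<in> borel_measurable borel" and L: "0 \<le> L"
      and osc: "\<And>x y. \<bar>f x - f y\<bar> \<le> L * (2 + \<beta> * V x + \<beta> * V y)" for f :: "'a \<Rightarrow> real" and L x y
  proof -
    obtain c where c: "\<And>x. \<bar>f x - c\<bar> \<le> L * (1 + \<beta> * V x)" using weighted_osc_center[OF osc] by blast
    define g where "g x = f x - c" for x
    define W where "W x = L * (1 + \<beta> * V x)" for x
    define S where "S = V x + V y"
    have [measurable]: "g \<in> borel_measurable borel" "W \<in> borel_measurable borel"
      unfolding g_def W_def by measurable
    have g: "\<bar>g x\<bar> \<le> W x" for x using c by (simp add: g_def W_def)
    have W0: "0 \<le> W x" for x using g[of x] by linarith
    have WV: "W x \<le> (L * (1 + \<beta>)) * V x" for x unfolding W_def by (rule V_bound_of_affine[OF L])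
    have gV: "\<bar>g x\<bar> \<le> (L * (1 + \<beta>)) * V x" for x using g[of x] WV[of x] by linarith
    have WV': "\<bar>W x\<bar> \<le> (L * (1 + \<beta>)) * V x" for x using W0[of x] WV[of x] by linarith
    have ig: "integrable (P x) g" "integrable (P x) W" for x
      using integrable_P[OF _ gV] integrable_P[OF _ WV'] by auto
    have eq: "(\<integral>z. f z \<partial>P x) - (\<integral>z. f z \<partial>P y) = (\<integral>z. g z \<partial>P x) - (\<integral>z. g z \<partial>P y)"
    proof -
      have "(\<integral>z. f z \<partial>P x) = (\<integral>z. g z \<partial>P x) + c" for x
      proof -
        interpret prob_space "P x" by (rule prob_space_P)
        have "(\<integral>z. f z \<partial>P x) = (\<integral>z. g z + c \<partial>P x)" by (simp add: g_def)
        also have "\<dots> = (\<integral>z. g z \<partial>P x) + c" using ig by (simp add: prob_space)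
        finally show ?thesis .
      qed
      then show ?thesis by simp
    qed
    have PW: "(\<integral>z. W z \<partial>P x) \<le> L * (1 + \<beta> * (\<gamma> * V x + K))" for x
    proof -
      interpret prob_space "P x" by (rule prob_space_P)
      have "(\<integral>z. W z \<partial>P x) = L * (1 + \<beta> * (\<integral>z. V z \<partial>P x))"
        unfolding W_def using integrable_P_V[of x] by (simp add: prob_space)
      also have "\<dots> \<le> L * (1 + \<beta> * (\<gamma> * V x + K))"
        using L \<beta> integral_V_le[of x] by (intro mult_left_mono add_left_mono) auto
      finally show ?thesis .
    qed
    have S: "0 \<le> S" using V_pos(2)[of x] V_pos(2)[of y] by (simp add: S_def)
    have split: "(\<integral>z. h z \<partial>P x) = (\<integral>z. W z \<partial>P x) - (\<integral>z. W z - h z \<partial>P x)"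
      if "integrable (P x) h" for h x using that ig by simp
    have goal: "(\<integral>z. g z \<partial>P x) - (\<integral>z. g z \<partial>P y) \<le> L * (\<rho> * (2 + \<beta> * S))"
    proof (cases "R \<le> S")
      case True
      have "(\<integral>z. g z \<partial>P x) \<le> (\<integral>z. W z \<partial>P x)"
        by (rule integral_mono[OF ig]) (use g in \<open>auto simp: abs_le_iff\<close>)
      moreover have "(\<integral>z. - g z \<partial>P y) \<le> (\<integral>z. W z \<partial>P y)"
        by (rule integral_mono) (use g ig in \<open>auto simp: abs_le_iff\<close>)
      ultimately have "(\<integral>z. g z \<partial>P x) - (\<integral>z. g z \<partial>P y) \<le> L * (1 + \<beta> * (\<gamma> * V x + K)) + L * (1 + \<beta> * (\<gamma> * V y + K))"
        using PW[of x] PW[of y] by simp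
      also have "\<dots> = L * (2 + \<beta> * (\<gamma> * S + 2 * K))" by (simp add: S_def algebra_simps)
      also have "\<dots> \<le> L * (2 + \<beta> * (\<gamma>1 * S))"
      proof -
        have "(1 - \<gamma>) * R / 2 \<le> (1 - \<gamma>) * S / 2" using True gamma by (simp add: mult_left_mono)
        then have "\<gamma> * S + 2 * K \<le> \<gamma>1 * S" using R by (simp add: \<gamma>1_def field_simps)
        then show ?thesis using L \<beta> by (intro mult_left_mono add_left_mono) auto
      qed
      also have "\<dots> \<le> L * (\<rho>2 * (2 + \<beta> * S))"
      proof (rule mult_left_mono[OF _ L])
        have "\<beta> * (1 - \<gamma>1) * R \<le> \<beta> * (1 - \<gamma>1) * S" using True \<beta> \<gamma>1 by (intro mult_left_mono) auto
        then have "(2 + \<beta> * (\<gamma>1 * S)) * (2 + \<beta> * R) \<le> (2 + \<beta> * \<gamma>1 * R) * (2 + \<beta> * S)"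
          by (simp add: algebra_simps)
        then show "2 + \<beta> * (\<gamma>1 * S) \<le> \<rho>2 * (2 + \<beta> * S)"
          unfolding \<rho>2_def using den by (simp add: pos_le_divide_eq)
      qed
      also have "\<dots> \<le> L * (\<rho> * (2 + \<beta> * S))"
        using L \<rho> \<beta> S by (intro mult_left_mono mult_right_mono) auto
      finally show ?thesis .
    next
      case False
      then have VR: "V x \<le> R" "V y \<le> R" using V_pos(2)[of x] V_pos(2)[of y] by (auto simp: S_def)
      have le\<mu>: "\<mu> \<le> P w" if "V w \<le> R" for w
        by (subst le_measure) (use dom[OF that] in auto)
      have V\<mu>: "(\<integral>\<^sup>+y. ennreal (V y) \<partial>\<mu>) < \<infinity>"
        by (rule order.strict_trans1[OF nn_integral_mono_measure[OF _ le\<mu>[OF VR(1)]] drift_finite]) simp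
      have i\<mu>: "integrable \<mu> g" "integrable \<mu> W"
        using integrable_V_bound[OF s\<mu> V\<mu> _ gV] integrable_V_bound[OF s\<mu> V\<mu> _ WV'] by auto
      have lower: "(\<integral>z. h z \<partial>\<mu>) \<le> (\<integral>z. h z \<partial>P w)"
        if "V w \<le> R" "integrable \<mu> h" "integrable (P w) h" "\<And>z. 0 \<le> h z" for h :: "'a \<Rightarrow> real" and w
      proof -
        have "ennreal (\<integral>z. h z \<partial>\<mu>) = (\<integral>\<^sup>+z. ennreal (h z) \<partial>\<mu>)"
          by (rule nn_integral_eq_integral[symmetric]) (use that in auto)
        also have "\<dots> \<le> (\<integral>\<^sup>+z. ennreal (h z) \<partial>P w)"
          by (rule nn_integral_mono_measure[OF _ le\<mu>[OF that(1)]]) simp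
        also have "\<dots> = ennreal (\<integral>z. h z \<partial>P w)"
          by (rule nn_integral_eq_integral) (use that in auto)
        finally show ?thesis using that by (simp add: integral_nonneg_AE)
      qed
      \<comment> \<open>Both \<open>W - g\<close> and \<open>W + g\<close> are nonnegative, hence
        their integrals dominate those over the common component \<open>\<mu>\<close>. When the two
        lower bounds are added, \<open>g\<close> cancels over \<open>\<mu>\<close> and
        \<open>2 * (\<integral>z. W z \<partial>\<mu>)\<close> remains as the gain.\<close>
      have 1: "(\<integral>z. W z - g z \<partial>\<mu>) \<le> (\<integral>z. W z - g z \<partial>P x)"
      proof (rule lower)
        show "0 \<le> W z - g z" for z using g[of z] by linarith
      qed (use VR ig i\<mu> in simp_all)
      have 2: "(\<integral>z. W z - - g z \<partial>\<mu>) \<le> (\<integral>z. W z - - g z \<partial>P y)"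
      proof (rule lower)
        show "0 \<le> W z - - g z" for z using g[of z] by linarith
      qed (use VR ig i\<mu> in simp_all)
      have 3: "L * e \<le> (\<integral>z. W z \<partial>\<mu>)"
      proof -
        have "(\<integral>z. L \<partial>\<mu>) \<le> (\<integral>z. W z \<partial>\<mu>)"
        proof (rule integral_mono)
          show "L \<le> W z" for z
            using mult_left_mono[of 1 "1 + \<beta> * V z" L] L \<beta> V_pos(2)[of z] by (simp add: W_def)
        qed (use i\<mu> in simp_all)
        then show ?thesis by (simp add: e_def sp\<mu> mult.commute)
      qed
      have "(\<integral>z. g z \<partial>P x) - (\<integral>z. g z \<partial>P y) \<le> (\<integral>z. W z \<partial>P x) + (\<integral>z. W z \<partial>P y) - 2 * (L * e)"
        using 1 2 3 ig i\<mu> by simp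
      also have "\<dots> \<le> L * (2 - 2 * e + \<beta> * \<gamma> * S + 2 * \<beta> * K)"
        using PW[of x] PW[of y] by (simp add: S_def algebra_simps)
      also have "\<dots> \<le> L * (2 * \<rho> + \<beta> * \<rho> * S)"
      proof (rule mult_left_mono[OF _ L])
        have "\<beta> * \<gamma> * S \<le> \<beta> * \<rho> * S" using \<beta> \<rho> S by (intro mult_right_mono mult_left_mono) auto
        then show "2 - 2 * e + \<beta> * \<gamma> * S + 2 * \<beta> * K \<le> 2 * \<rho> + \<beta> * \<rho> * S" using \<beta>(2) \<rho>(3) by linarith
      qed
      finally show ?thesis by (simp add: algebra_simps)
    qed
    then show ?thesis unfolding eq by (simp add: S_def algebra_simps)
  qed
  show thesis
  proof (rule that[OF \<beta>(1) \<rho>(1,2)])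
    fix f :: "'a \<Rightarrow> real" and L x y
    assume f: "f \<in> borel_measurable borel" "0 \<le> L" "\<And>x y. \<bar>f x - f y\<bar> \<le> L * (2 + \<beta> * V x + \<beta> * V y)"
    show "\<bar>(\<integral>z. f z \<partial>P x) - (\<integral>z. f z \<partial>P y)\<bar> \<le> \<rho> * L * (2 + \<beta> * V x + \<beta> * V y)"
      using key[OF f, of x y] key[OF f, of y x] by (simp add: abs_le_iff algebra_simps)
  qed
qed

lemma kernel_pow_props:
  "kernel_pow P k q \<in> space (prob_algebra borel) \<and> (\<integral>\<^sup>+y. ennreal (V y) \<partial>kernel_pow P k q) < \<infinity>"
proof (induction k)
  case 0
  then show ?case by (auto simp: space_prob_algebra prob_space_return nn_integral_return)
next
  case (Suc k)
  then have 1: "kernel_pow P k q \<in> space (prob_algebra borel)" and 2: "(\<integral>\<^sup>+y. ennreal (V y) \<partial>kernel_pow P k q) < \<infinity>"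
    by auto
  have "kernel_pow P (Suc k) q \<in> space (prob_algebra borel)"
    using prob_space_bind'[OF 1 P] sets_bind'[OF 1 P] by (simp add: space_prob_algebra)
  moreover have "(\<integral>\<^sup>+y. ennreal (V y) \<partial>kernel_pow P (Suc k) q) < \<infinity>"
    using integral_bind_P(1)[OF 1 2, of "\<lambda>_. 0" 0] by simp
  ultimately show ?case by simp
qed

text \<open>The kernel acts on test functions: \<open>k + 1\<close> steps applied to
  \<open>f\<close> are \<open>k\<close> steps applied to the averaged function, whose oscillation
  constant is smaller by the factor \<open>\<rho>\<close>. The induction therefore generalizes over
  \<open>f\<close> and \<open>L\<close>, and invariance lets the target absorb the same
  averaging.\<close>

theorem harris: "geometrically_ergodic P \<pi>"
proof -
  interpret pi: prob_space \<pi> by (rule prob_space_pi)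
  obtain \<beta> \<rho> where \<beta>: "0 < \<beta>" and \<rho>: "0 \<le> \<rho>" "\<rho> < 1"
    and contr: "\<And>(f :: 'a \<Rightarrow> real) L x y. f \<in> borel_measurable borel \<Longrightarrow> 0 \<le> L \<Longrightarrow>
      (\<And>x y. \<bar>f x - f y\<bar> \<le> L * (2 + \<beta> * V x + \<beta> * V y)) \<Longrightarrow>
      \<bar>(\<integral>z. f z \<partial>P x) - (\<integral>z. f z \<partial>P y)\<bar> \<le> \<rho> * L * (2 + \<beta> * V x + \<beta> * V y)"
    using contraction by blast
  define v where "v = (\<integral>x. V x \<partial>\<pi>)"
  have iV: "integrable \<pi> V" by (rule integrable_V_bound[OF sets_pi pi_V_finite, where c=1]) (use V_pos in auto)
  have v: "0 \<le> v" unfolding v_def by (rule integral_nonneg_AE) (use V_pos in auto)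
  have Vbound: "\<exists>c. \<forall>x. \<bar>f x\<bar> \<le> c * V x"
    if L: "0 \<le> L" and osc: "\<And>x y. \<bar>f x - f y\<bar> \<le> L * (2 + \<beta> * V x + \<beta> * V y)" for f :: "'a \<Rightarrow> real" and L
  proof -
    obtain c where c: "\<And>x. \<bar>f x - c\<bar> \<le> L * (1 + \<beta> * V x)" using weighted_osc_center[OF osc] by blast
    have "\<bar>f x\<bar> \<le> (\<bar>c\<bar> + L * (1 + \<beta>)) * V x" for x
    proof -
      have "\<bar>f x\<bar> \<le> \<bar>c\<bar> * 1 + L * (1 + \<beta> * V x)" using c[of x] by simp
      also have "\<dots> \<le> \<bar>c\<bar> * V x + (L * (1 + \<beta>)) * V x"
        by (intro add_mono V_bound_of_affine L mult_left_mono V_ge1) auto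
      finally show ?thesis by (simp add: algebra_simps)
    qed
    then show ?thesis by blast
  qed
  have main: "\<bar>(\<integral>x. f x \<partial>kernel_pow P k q) - (\<integral>x. f x \<partial>\<pi>)\<bar> \<le> L * \<rho> ^ k * (2 + \<beta> * V q + \<beta> * v)"
    if "f \<in> borel_measurable borel" "0 \<le> L" "\<And>x y. \<bar>f x - f y\<bar> \<le> L * (2 + \<beta> * V x + \<beta> * V y)"
    for f :: "'a \<Rightarrow> real" and L q k
    using that
  proof (induction k arbitrary: f L)
    case 0
    obtain c where c: "\<And>x. \<bar>f x\<bar> \<le> c * V x" using Vbound[OF 0(2,3)] by blast
    have if_: "integrable \<pi> f" by (rule integrable_V_bound[OF sets_pi pi_V_finite 0(1) c])
    have "\<bar>f q - (\<integral>x. f x \<partial>\<pi>)\<bar> = \<bar>\<integral>x. f q - f x \<partial>\<pi>\<bar>" using if_ by (simp add: pi.prob_space)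
    also have "\<dots> \<le> (\<integral>x. L * (2 + \<beta> * V q + \<beta> * V x) \<partial>\<pi>)"
      by (rule integral_abs_le_integral) (use if_ iV 0(3)[of q] in auto)
    also have "\<dots> = L * (2 + \<beta> * V q + \<beta> * v)" using iV by (simp add: pi.prob_space v_def algebra_simps)
    finally show ?case using 0(1) by (simp add: integral_return)
  next
    case (Suc k)
    obtain c where c: "\<And>x. \<bar>f x\<bar> \<le> c * V x" using Vbound[OF Suc.prems(2,3)] by blast
    note [measurable] = Suc.prems(1)
    have "(\<integral>x. f x \<partial>kernel_pow P (Suc k) q) = (\<integral>x. (\<integral>y. f y \<partial>P x) \<partial>kernel_pow P k q)"
      using integral_bind_P(2)[OF _ _ Suc.prems(1) c] kernel_pow_props[of k q] by simp
    moreover have "(\<integral>x. f x \<partial>\<pi>) = (\<integral>x. (\<integral>y. f y \<partial>P x) \<partial>\<pi>)"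
      by (rule pi_bind_integral[OF Suc.prems(1) c, symmetric])
    moreover have "\<bar>(\<integral>x. (\<integral>y. f y \<partial>P x) \<partial>kernel_pow P k q) - (\<integral>x. (\<integral>y. f y \<partial>P x) \<partial>\<pi>)\<bar>
         \<le> (\<rho> * L) * \<rho> ^ k * (2 + \<beta> * V q + \<beta> * v)"
      by (rule Suc.IH) (use contr[OF Suc.prems] Suc.prems(2) \<rho> in auto)
    ultimately show ?case by (simp add: mult_ac)
  qed
  \<comment> \<open>A test function bounded by \<open>V\<close> has oscillation constant
    \<open>1 / \<beta>\<close>; the second factor turns
    \<open>2 + \<beta> * V q + \<beta> * v\<close> into a multiple of \<open>V q\<close>.\<close>
  define \<sigma> where "\<sigma> = (1 + 1 / \<beta>) * (2 + \<beta> + \<beta> * v)"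
  have \<sigma>: "0 \<le> \<sigma>" using \<beta> v by (auto simp: \<sigma>_def)
  have "V_norm (kernel_pow P k q) \<pi> V \<le> ereal (\<sigma> * \<rho> ^ k * V q)" for k q
    unfolding V_norm_def
  proof (rule SUP_least)
    fix f assume "f \<in> {f. f \<in> borel_measurable borel \<and> (\<forall>x. \<bar>f x\<bar> \<le> V x)}"
    then have f: "f \<in> borel_measurable borel" "\<And>x. \<bar>f x\<bar> \<le> 1 * V x" by auto
    have i: "integrable (kernel_pow P k q) f" "integrable \<pi> f"
      using integrable_V_bound[OF _ _ f] kernel_pow_props[of k q] pi_V_finite by (auto simp: space_prob_algebra)
    have "\<bar>f x - f y\<bar> \<le> (1 / \<beta>) * (2 + \<beta> * V x + \<beta> * V y)" for x y
    proof -
      have "\<bar>f x - f y\<bar> \<le> V x + V y" using f(2)[of x] f(2)[of y] by simp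
      also have "\<dots> \<le> 2 / \<beta> + V x + V y" using \<beta> by simp
      also have "\<dots> = (1 / \<beta>) * (2 + \<beta> * V x + \<beta> * V y)" using \<beta> by (simp add: field_simps)
      finally show ?thesis .
    qed
    then have "\<bar>(\<integral>x. f x \<partial>kernel_pow P k q) - (\<integral>x. f x \<partial>\<pi>)\<bar> \<le> (1 / \<beta>) * \<rho> ^ k * (2 + \<beta> * V q + \<beta> * v)"
      using \<beta> by (intro main f) auto
    also have "\<dots> \<le> (1 + 1 / \<beta>) * \<rho> ^ k * ((2 + \<beta> + \<beta> * v) * V q)"
    proof (intro mult_mono)
      have "2 + \<beta> * v \<le> (2 + \<beta> * v) * V q"
        using mult_left_mono[OF V_ge1[of q], of "2 + \<beta> * v"] \<beta> v by simp
      then show "2 + \<beta> * V q + \<beta> * v \<le> (2 + \<beta> + \<beta> * v) * V q" by (simp add: algebra_simps)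
    qed (use \<beta> \<rho> v V_pos(2)[of q] in auto)
    also have "\<dots> = \<sigma> * \<rho> ^ k * V q" by (simp add: \<sigma>_def)
    finally show "(if integrable (kernel_pow P k q) f \<and> integrable \<pi> f
        then ereal \<bar>(\<integral>x. f x \<partial>kernel_pow P k q) - (\<integral>x. f x \<partial>\<pi>)\<bar> else \<infinity>) \<le> ereal (\<sigma> * \<rho> ^ k * V q)"
      using i by simp
  qed
  then show ?thesis
    unfolding geometrically_ergodic_def using V_meas V_ge1 \<rho> \<sigma> by blast
qed

end

section \<open>Gaussian integrals and volume-preserving maps\<close>

lemma prod_normal_density:
  fixes p :: "'a::euclidean_space"
  shows "(\<Prod>b\<in>Basis. normal_density 0 \<sigma> (p \<bullet> b)) =
    (1 / sqrt (2 * pi * \<sigma>\<^sup>2)) ^ DIM('a) * exp (- (norm p)\<^sup>2 / (2 * \<sigma>\<^sup>2))"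
proof -
  have "(norm p)\<^sup>2 = (\<Sum>b\<in>Basis. (p \<bullet> b)\<^sup>2)"
    unfolding power2_norm_eq_inner by (subst euclidean_inner) (simp add: power2_eq_square)
  then have "(\<Prod>b\<in>(Basis :: 'a set). exp (- (p \<bullet> b)\<^sup>2 / (2 * \<sigma>\<^sup>2))) = exp (- (norm p)\<^sup>2 / (2 * \<sigma>\<^sup>2))"
    by (simp add: exp_sum[symmetric] sum_divide_distrib[symmetric] sum_negf)
  then show ?thesis by (simp add: normal_density_def prod_dividef power_one_over)
qed

lemma nn_integral_isotropic_gauss:
  assumes "0 < \<sigma>"
  shows "(\<integral>\<^sup>+p. ennreal ((1 / sqrt (2 * pi * \<sigma>\<^sup>2)) ^ DIM('a) * exp (- (norm (p::'a::euclidean_space))\<^sup>2 / (2 * \<sigma>\<^sup>2))) \<partial>lborel) = 1"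
proof -
  have 1: "(\<integral>\<^sup>+x. ennreal (normal_density 0 \<sigma> x) \<partial>lborel) = 1"
    by (subst nn_integral_eq_integral) (use assms in \<open>auto intro!: integrable_normal_density integral_normal_density\<close>)
  have "(\<integral>\<^sup>+p. (\<Prod>b\<in>Basis. ennreal (normal_density 0 \<sigma> ((p::'a) \<bullet> b))) \<partial>lborel)
      = (\<Prod>b\<in>(Basis::'a set). (\<integral>\<^sup>+x. ennreal (normal_density 0 \<sigma> x) \<partial>lborel))"
    by (rule nn_integral_lborel_prod) auto
  also have "\<dots> = 1" by (simp add: 1)
  finally show ?thesis by (simp add: prod_ennreal prod_normal_density)
qed

lemma std_gauss_eq: "std_gauss (p::'a::euclidean_space) = (1 / sqrt (2 * pi * 1\<^sup>2)) ^ DIM('a) * exp (- (norm p)\<^sup>2 / (2 * 1\<^sup>2))"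
proof -
  have "(2 * pi) powr (- real DIM('a) / 2) = (1 / sqrt (2 * pi)) ^ DIM('a)"
    by (simp add: powr_half_sqrt[symmetric] powr_minus_divide[symmetric] powr_powr powr_realpow[symmetric])
  then show ?thesis by (simp add: std_gauss_def)
qed

lemma std_gauss_pos: "0 < std_gauss p"
  by (simp add: std_gauss_def)

lemma continuous_on_std_gauss: "continuous_on UNIV (std_gauss :: 'a::euclidean_space \<Rightarrow> real)"
  unfolding std_gauss_def[abs_def] by (intro continuous_intros) auto

lemma std_gauss_measurable [measurable]: "(std_gauss :: 'a::euclidean_space \<Rightarrow> real) \<in> borel_measurable borel"
  by (rule borel_measurable_continuous_onI[OF continuous_on_std_gauss])

lemma nn_integral_std_gauss: "(\<integral>\<^sup>+p. ennreal (std_gauss (p::'a::euclidean_space)) \<partial>lborel) = 1"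
  unfolding std_gauss_eq by (rule nn_integral_isotropic_gauss) simp

text \<open>The factor \<open>exp ((norm p)\<^sup>2 / 4)\<close> is there to pay for Gaussian tails
  in the drift estimate. It uses up half of the Gaussian exponent; completing a square absorbs the
  linear term into half of what is left, and a Gaussian of variance 4 remains.\<close>

lemma std_gauss_exp_moment:
  "(\<integral>\<^sup>+p. ennreal (exp (c * norm p + (norm p)\<^sup>2 / 4) * std_gauss (p::'a::euclidean_space)) \<partial>lborel) < \<infinity>"
proof -
  define a where "a = (1 / sqrt (2 * pi * 2\<^sup>2)) ^ DIM('a)"
  define b where "b = (2 * pi) powr (- real DIM('a) / 2)"
  have a: "0 < a" and b: "0 < b" by (auto simp: a_def b_def)
  have bound: "exp (c * norm p + (norm p)\<^sup>2 / 4) * std_gauss p \<le> (b * exp (2 * c\<^sup>2) / a) * (a * exp (- (norm p)\<^sup>2 / (2 * 2\<^sup>2)))" for p :: 'a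
  proof -
    have "0 \<le> (4 * c - norm p)\<^sup>2" by simp
    then have "c * norm p - (norm p)\<^sup>2 / 4 \<le> 2 * c\<^sup>2 - (norm p)\<^sup>2 / 8"
      by (simp add: power2_eq_square algebra_simps)
    then have "exp (c * norm p - (norm p)\<^sup>2 / 4) \<le> exp (2 * c\<^sup>2 - (norm p)\<^sup>2 / 8)" by simp
    then have "b * exp (c * norm p - (norm p)\<^sup>2 / 4) \<le> b * exp (2 * c\<^sup>2 - (norm p)\<^sup>2 / 8)" using b by simp
    moreover have "exp (c * norm p + (norm p)\<^sup>2 / 4) * std_gauss p = b * exp (c * norm p - (norm p)\<^sup>2 / 4)"
      by (simp add: std_gauss_def b_def mult_ac exp_add[symmetric])
    moreover have "(b * exp (2 * c\<^sup>2) / a) * (a * exp (- (norm p)\<^sup>2 / (2 * 2\<^sup>2))) = b * exp (2 * c\<^sup>2 - (norm p)\<^sup>2 / 8)"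
    proof -
      have "exp (2 * c\<^sup>2 - (norm p)\<^sup>2 / 8) = exp (2 * c\<^sup>2) * exp (- (norm p)\<^sup>2 / (2 * 2\<^sup>2))"
        unfolding exp_add[symmetric] by simp
      then show ?thesis using a by simp
    qed
    ultimately show ?thesis by simp
  qed
  have "(\<integral>\<^sup>+p. ennreal (exp (c * norm p + (norm p)\<^sup>2 / 4) * std_gauss (p::'a)) \<partial>lborel)
     \<le> (\<integral>\<^sup>+p. ennreal (b * exp (2 * c\<^sup>2) / a) * ennreal (a * exp (- (norm (p::'a))\<^sup>2 / (2 * 2\<^sup>2))) \<partial>lborel)"
    by (intro nn_integral_mono) (use bound a b in \<open>simp add: ennreal_mult[symmetric] ennreal_leI\<close>)
  also have "\<dots> = ennreal (b * exp (2 * c\<^sup>2) / a) * 1"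
    unfolding a_def by (subst nn_integral_cmult) (use nn_integral_isotropic_gauss[where 'a='a, of 2] in auto)
  finally show ?thesis by (simp add: order.strict_trans1)
qed

text \<open>Stated as invariance of all nonnegative integrals, so that composition is mere
  substitution, without inverses or Jacobians.\<close>

definition volume_preserving :: "('b::euclidean_space \<Rightarrow> 'b) \<Rightarrow> bool" where
  "volume_preserving G \<longleftrightarrow> G \<in> borel_measurable borel \<and>
     (\<forall>g::'b \<Rightarrow> ennreal. g \<in> borel_measurable borel \<longrightarrow> (\<integral>\<^sup>+z. g (G z) \<partial>lborel) = (\<integral>\<^sup>+z. g z \<partial>lborel))"

lemma volume_preservingD:
  assumes "volume_preserving G" "g \<in> borel_measurable borel"
  shows "(\<integral>\<^sup>+z. g (G z) \<partial>lborel) = (\<integral>\<^sup>+z. g z \<partial>lborel)"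
  using assms by (auto simp: volume_preserving_def)

lemma volume_preserving_comp:
  assumes "volume_preserving F" "volume_preserving G"
  shows "volume_preserving (F \<circ> G)"
  unfolding volume_preserving_def
proof (intro conjI allI impI)
  have m: "F \<in> borel_measurable borel" "G \<in> borel_measurable borel" using assms by (auto simp: volume_preserving_def)
  show "F \<circ> G \<in> borel_measurable borel" by (rule measurable_comp[OF m(2) m(1)])
  fix g :: "'a \<Rightarrow> ennreal" assume g: "g \<in> borel_measurable borel"
  have "(\<integral>\<^sup>+z. g (F (G z)) \<partial>lborel) = (\<integral>\<^sup>+z. g (F z) \<partial>lborel)"
    by (rule volume_preservingD[OF assms(2)]) (rule measurable_compose[OF m(1) g])
  then show "(\<integral>\<^sup>+z. g ((F \<circ> G) z) \<partial>lborel) = (\<integral>\<^sup>+z. g z \<partial>lborel)"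
    using volume_preservingD[OF assms(1) g] by simp
qed

lemma nn_integral_lborel_affine:
  fixes g :: "'a::euclidean_space \<Rightarrow> ennreal"
  assumes [measurable]: "g \<in> borel_measurable borel" and c: "\<bar>c\<bar> = 1"
  shows "(\<integral>\<^sup>+x. g (t + c *\<^sub>R x) \<partial>lborel) = (\<integral>\<^sup>+x. g x \<partial>lborel)"
proof -
  have "(\<integral>\<^sup>+x. g x \<partial>lborel) = (\<integral>\<^sup>+x. g x \<partial>density (distr lborel borel (\<lambda>x. t + c *\<^sub>R x)) (\<lambda>_. ennreal (\<bar>c\<bar> ^ DIM('a))))"
    by (subst lborel_affine[of c t]) (use c in auto)
  also have "\<dots> = (\<integral>\<^sup>+x. g (t + c *\<^sub>R x) \<partial>lborel)"
    using c by (simp add: nn_integral_density nn_integral_distr)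
  finally show ?thesis by simp
qed

lemma nn_integral_lborel_pair:
  fixes g :: "'a::euclidean_space \<times> 'a \<Rightarrow> ennreal"
  assumes g: "g \<in> borel_measurable borel"
  shows "(\<integral>\<^sup>+z. g z \<partial>lborel) = (\<integral>\<^sup>+q. (\<integral>\<^sup>+p. g (q, p) \<partial>lborel) \<partial>lborel)"
    and "(\<integral>\<^sup>+z. g z \<partial>lborel) = (\<integral>\<^sup>+p. (\<integral>\<^sup>+q. g (q, p) \<partial>lborel) \<partial>lborel)"
proof -
  have g': "g \<in> borel_measurable (lborel \<Otimes>\<^sub>M lborel)" using g by (simp add: borel_prod measurable_lborel1 lborel_prod)
  show "(\<integral>\<^sup>+z. g z \<partial>lborel) = (\<integral>\<^sup>+q. (\<integral>\<^sup>+p. g (q, p) \<partial>lborel) \<partial>lborel)"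
    by (subst lborel.nn_integral_fst[OF g']) (simp add: lborel_prod)
  show "(\<integral>\<^sup>+z. g z \<partial>lborel) = (\<integral>\<^sup>+p. (\<integral>\<^sup>+q. g (q, p) \<partial>lborel) \<partial>lborel)"
    by (subst lborel_pair.nn_integral_snd[OF g']) (simp add: lborel_prod)
qed

text \<open>By Tonelli the inner integral, at fixed first component, undergoes a translation,
  composed with a reflection if \<open>c = -1\<close>. The latter case with \<open>f = 0\<close> is
  the momentum flip.\<close>

lemma volume_preserving_shear_snd:
  fixes f :: "'a::euclidean_space \<Rightarrow> 'a"
  assumes [measurable]: "f \<in> borel_measurable borel" and c: "\<bar>c\<bar> = 1"
  shows "volume_preserving (\<lambda>z. (fst z, f (fst z) + c *\<^sub>R snd z))"
  unfolding volume_preserving_def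
proof (intro conjI allI impI)
  show m: "(\<lambda>z. (fst z, f (fst z) + c *\<^sub>R snd z)) \<in> borel_measurable borel"
    unfolding borel_prod[symmetric] by measurable
  fix g :: "'a \<times> 'a \<Rightarrow> ennreal" assume g [measurable]: "g \<in> borel_measurable borel"
  have s: "(\<lambda>p. g (q, p)) \<in> borel_measurable borel" for q
    by (rule measurable_compose[OF _ g]) (simp add: borel_prod[symmetric])
  show "(\<integral>\<^sup>+z. g (fst z, f (fst z) + c *\<^sub>R snd z) \<partial>lborel) = (\<integral>\<^sup>+z. g z \<partial>lborel)"
    by (subst (1 2) nn_integral_lborel_pair(1))
       (use measurable_compose[OF m g] s nn_integral_lborel_affine[OF s c] in auto)
qed

lemma volume_preserving_shear_fst:
  fixes f :: "'a::euclidean_space \<Rightarrow> 'a"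
  assumes [measurable]: "f \<in> borel_measurable borel"
  shows "volume_preserving (\<lambda>z. (fst z + f (snd z), snd z))"
  unfolding volume_preserving_def
proof (intro conjI allI impI)
  show m: "(\<lambda>z. (fst z + f (snd z), snd z)) \<in> borel_measurable borel"
    unfolding borel_prod[symmetric] by measurable
  fix g :: "'a \<times> 'a \<Rightarrow> ennreal" assume g [measurable]: "g \<in> borel_measurable borel"
  have s: "(\<lambda>q. g (q, p)) \<in> borel_measurable borel" for p
    by (rule measurable_compose[OF _ g]) (simp add: borel_prod[symmetric])
  have "(\<integral>\<^sup>+q. g (q + f p, p) \<partial>lborel) = (\<integral>\<^sup>+q. g (q, p) \<partial>lborel)" for p
    using nn_integral_lborel_affine[OF s[of p], of 1 "f p"] by (simp add: add.commute)
  then show "(\<integral>\<^sup>+z. g (fst z + f (snd z), snd z) \<partial>lborel) = (\<integral>\<^sup>+z. g z \<partial>lborel)"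
    by (subst (1 2) nn_integral_lborel_pair(2)) (use measurable_compose[OF m g] in auto)
qed

section \<open>Volume preservation and time reversal of the leapfrog flow\<close>

definition momentum_flip :: "'a::euclidean_space \<times> 'a \<Rightarrow> 'a \<times> 'a" where
  "momentum_flip z = (fst z, - snd z)"

lemma volume_preserving_momentum_flip: "volume_preserving (momentum_flip :: 'a::euclidean_space \<times> 'a \<Rightarrow> _)"
  using volume_preserving_shear_snd[of "\<lambda>_. 0" "-1"] by (simp add: momentum_flip_def[abs_def])

lemma volume_preserving_leapfrog:
  fixes gU :: "'a::euclidean_space \<Rightarrow> 'a"
  assumes [measurable]: "gU \<in> borel_measurable borel"
  shows "volume_preserving (leapfrog h gU)"
proof -
  have 1: "volume_preserving (psi1 h gU)"
    using volume_preserving_shear_snd[of "\<lambda>q. - (h / 2) *\<^sub>R gU q" 1] by (simp add: psi1_def[abs_def])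
  have 2: "volume_preserving (psi2 h :: 'a \<times> 'a \<Rightarrow> _)"
    using volume_preserving_shear_fst[of "\<lambda>p. h *\<^sub>R p"] by (simp add: psi2_def[abs_def])
  show ?thesis unfolding leapfrog_def by (intro volume_preserving_comp 1 2)
qed

lemma volume_preserving_leapfrog_T:
  fixes gU :: "'a::euclidean_space \<Rightarrow> 'a"
  assumes "gU \<in> borel_measurable borel"
  shows "volume_preserving (leapfrog_T h T gU)"
proof (induction T)
  case 0
  then show ?case by (simp add: leapfrog_T_def volume_preserving_def)
next
  case (Suc T)
  then show ?case
    using volume_preserving_comp[OF volume_preserving_leapfrog[OF assms] Suc] by (simp add: leapfrog_T_def o_def)
qed

text \<open>Each sub-step is undone by conjugation with the flip, and the composition of the three
  is a palindrome, so the cancellations nest from the inside out.\<close>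

lemma leapfrog_reversible:
  "leapfrog h gU (momentum_flip (leapfrog h gU z)) = momentum_flip z"
proof -
  have 1: "psi1 h gU (momentum_flip (psi1 h gU z)) = momentum_flip z" for z
    by (simp add: psi1_def momentum_flip_def)
  have 2: "psi2 h (momentum_flip (psi2 h z)) = momentum_flip z" for z :: "'a \<times> 'a"
    by (simp add: psi2_def momentum_flip_def)
  show ?thesis by (simp add: leapfrog_def 1 2)
qed

lemma leapfrog_T_reversible:
  "leapfrog_T h T gU (momentum_flip (leapfrog_T h T gU z)) = momentum_flip z"
proof (induction T arbitrary: z)
  case 0
  then show ?case by (simp add: leapfrog_T_def)
next
  case (Suc T)
  have "leapfrog_T h (Suc T) gU (momentum_flip (leapfrog_T h (Suc T) gU z))
      = leapfrog_T h T gU (leapfrog h gU (momentum_flip (leapfrog h gU (leapfrog_T h T gU z))))"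
    by (simp add: leapfrog_T_def funpow_swap1)
  then show ?case using Suc by (simp add: leapfrog_reversible)
qed

lemma hamiltonian_momentum_flip [simp]: "hamiltonian U (momentum_flip z) = hamiltonian U z"
  by (simp add: hamiltonian_def momentum_flip_def)

section \<open>The HMC kernel and its invariant distribution\<close>

locale hmc_setup =
  fixes U :: "'a::euclidean_space \<Rightarrow> real" and gU :: "'a \<Rightarrow> 'a" and h :: real and T :: nat
  assumes U_cont: "continuous_on UNIV U" and gU_cont: "continuous_on UNIV gU"
    and U_int: "integrable lborel (\<lambda>q. exp (- U q))"
begin

abbreviation flow :: "'a \<times> 'a \<Rightarrow> 'a \<times> 'a" where "flow \<equiv> leapfrog_T h T gU"
definition prop_pos :: "'a \<Rightarrow> 'a \<Rightarrow> 'a" where "prop_pos q p = fst (flow (q, p))"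
definition acc :: "'a \<Rightarrow> 'a \<Rightarrow> real" where "acc q p = accept_prob U (q, p) (flow (q, p))"
abbreviation kern :: "'a \<Rightarrow> 'a measure" where "kern \<equiv> hmc_kernel U gU h T"

lemma acc_bounds: "0 < acc q p" "acc q p \<le> 1"
  by (auto simp: acc_def accept_prob_def)

lemma continuous_on_leapfrog: "continuous_on UNIV (leapfrog h gU)"
proof -
  have [continuous_intros]: "continuous_on S (\<lambda>x. gU (f x))" if "continuous_on S f" for f :: "'a \<times> 'a \<Rightarrow> 'a" and S
    using continuous_on_compose2[OF gU_cont that] by simp
  have "continuous_on UNIV (psi1 h gU)" "continuous_on UNIV (psi2 h :: 'a \<times> 'a \<Rightarrow> _)"
    unfolding psi1_def[abs_def] psi2_def[abs_def] by (intro continuous_intros, simp?)+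
  then show ?thesis unfolding leapfrog_def
    by (intro continuous_on_compose) (auto intro: continuous_on_subset)
qed

lemma continuous_on_flow: "continuous_on UNIV flow"
proof (induction T)
  case 0
  then show ?case by (simp add: leapfrog_T_def continuous_on_id id_def)
next
  case (Suc T)
  have "continuous_on UNIV (leapfrog h gU \<circ> leapfrog_T h T gU)"
    by (rule continuous_on_compose[OF Suc]) (rule continuous_on_subset[OF continuous_on_leapfrog], simp)
  then show ?case by (simp add: leapfrog_T_def o_def)
qed

lemma continuous_on_hamiltonian: "continuous_on UNIV (hamiltonian U)"
proof -
  have [continuous_intros]: "continuous_on S (\<lambda>x. U (f x))" if "continuous_on S f" for f :: "'a \<times> 'a \<Rightarrow> 'a" and S
    using continuous_on_compose2[OF U_cont that] by simp
  show ?thesis unfolding hamiltonian_def[abs_def] by (intro continuous_intros) auto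
qed

lemma continuous_on_acc: "continuous_on UNIV (\<lambda>z. acc (fst z) (snd z))"
proof -
  have "continuous_on UNIV (\<lambda>z. hamiltonian U (flow z))"
    using continuous_on_compose2[OF continuous_on_hamiltonian continuous_on_flow] by simp
  then show ?thesis unfolding acc_def accept_prob_def
    by (simp, intro continuous_intros continuous_on_hamiltonian)
qed

lemma flow_measurable: "flow \<in> borel \<rightarrow>\<^sub>M borel"
  by (rule borel_measurable_continuous_onI[OF continuous_on_flow])

lemma prop_pos_measurable2 [measurable]: "(\<lambda>(q, p). prop_pos q p) \<in> borel \<Otimes>\<^sub>M borel \<rightarrow>\<^sub>M borel"
  unfolding prop_pos_def borel_prod
  using measurable_compose[OF flow_measurable, of fst borel] by (simp add: borel_prod[symmetric] case_prod_beta')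

lemma acc_measurable2 [measurable]: "(\<lambda>(q, p). acc q p) \<in> borel \<Otimes>\<^sub>M borel \<rightarrow>\<^sub>M borel"
  unfolding borel_prod using borel_measurable_continuous_onI[OF continuous_on_acc] by (simp add: case_prod_beta')

lemma prop_pos_measurable [measurable]: "prop_pos q \<in> borel \<rightarrow>\<^sub>M borel"
  using measurable_Pair2[OF prop_pos_measurable2, of q] by simp

lemma acc_measurable [measurable]: "acc q \<in> borel \<rightarrow>\<^sub>M borel"
  using measurable_Pair2[OF acc_measurable2, of q] by simp

lemma gU_measurable [measurable]: "gU \<in> borel \<rightarrow>\<^sub>M borel"
  by (rule borel_measurable_continuous_onI[OF gU_cont])

lemma U_measurable [measurable]: "U \<in> borel \<rightarrow>\<^sub>M borel"
  by (rule borel_measurable_continuous_onI[OF U_cont])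

text \<open>The kernel as a functional on nonnegative functions, with acceptance and rejection under
  one integral. Countable additivity, measurability in \<open>q\<close>, the drift and the
  minorization are all read off from this form.\<close>

definition kern_int :: "'a \<Rightarrow> ('a \<Rightarrow> ennreal) \<Rightarrow> ennreal" where
  "kern_int q g = (\<integral>\<^sup>+p. g (prop_pos q p) * ennreal (acc q p * std_gauss p) + g q * ennreal ((1 - acc q p) * std_gauss p) \<partial>lborel)"

lemma kern_int_measurable [measurable]:
  assumes [measurable]: "g \<in> borel_measurable borel"
  shows "(\<lambda>q. kern_int q g) \<in> borel_measurable borel"
  unfolding kern_int_def by (intro lborel.borel_measurable_nn_integral) measurable

lemma kern_int_add:
  assumes [measurable]: "f \<in> borel_measurable borel" "g \<in> borel_measurable borel"
  shows "kern_int q (\<lambda>x. f x + g x) = kern_int q f + kern_int q g"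
  unfolding kern_int_def
  by (subst nn_integral_add[symmetric]) (auto intro!: nn_integral_cong simp: distrib_right add_ac)

lemma kern_int_cmult:
  assumes [measurable]: "f \<in> borel_measurable borel"
  shows "kern_int q (\<lambda>x. c * f x) = c * kern_int q f"
  unfolding kern_int_def
  by (subst nn_integral_cmult[symmetric]) (auto intro!: nn_integral_cong simp: distrib_left mult_ac)

lemma kern_int_suminf:
  assumes [measurable]: "\<And>i::nat. f i \<in> borel_measurable borel"
  shows "kern_int q (\<lambda>x. \<Sum>i. f i x) = (\<Sum>i. kern_int q (f i))"
proof -
  have "(\<Sum>i. kern_int q (f i)) = (\<integral>\<^sup>+p. (\<Sum>i. f i (prop_pos q p) * ennreal (acc q p * std_gauss p) + f i q * ennreal ((1 - acc q p) * std_gauss p)) \<partial>lborel)"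
    unfolding kern_int_def by (rule nn_integral_suminf[symmetric]) measurable
  also have "\<dots> = kern_int q (\<lambda>x. \<Sum>i. f i x)"
    unfolding kern_int_def by (intro nn_integral_cong) (simp add: suminf_add[symmetric] summableI ennreal_suminf_multc)
  finally show ?thesis ..
qed

lemma kern_int_1: "kern_int q (\<lambda>_. 1) = 1"
proof -
  have "kern_int q (\<lambda>_. 1) = (\<integral>\<^sup>+p. ennreal (std_gauss (p::'a)) \<partial>lborel)"
    unfolding kern_int_def
  proof (rule nn_integral_cong)
    fix p :: 'a
    have "ennreal (acc q p * std_gauss p) + ennreal ((1 - acc q p) * std_gauss p)
        = ennreal (acc q p * std_gauss p + (1 - acc q p) * std_gauss p)"
      using acc_bounds[of q p] std_gauss_pos[of p] by (intro ennreal_plus[symmetric]) auto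
    also have "acc q p * std_gauss p + (1 - acc q p) * std_gauss p = std_gauss p" by (simp add: algebra_simps)
    finally show "1 * ennreal (acc q p * std_gauss p) + 1 * ennreal ((1 - acc q p) * std_gauss p) = ennreal (std_gauss p)"
      by simp
  qed
  then show ?thesis by (simp add: nn_integral_std_gauss)
qed

lemma sets_kern [simp, measurable_cong]: "sets (kern q) = sets borel"
  unfolding hmc_kernel_def by (simp add: sets_measure_of_conv sigma_algebra.sigma_sets_eq[of UNIV "sets borel"])
    (metis sets.sigma_sets_eq space_borel)

text \<open>\<open>measure_of\<close> returns the prescribed set function only if that function is
  countably additive; this follows from exchanging \<open>kern_int\<close> with countable
  sums.\<close>

lemma emeasure_kern:
  assumes A: "A \<in> sets borel"
  shows "emeasure (kern q) A = kern_int q (indicator A)"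
proof -
  let ?\<mu> = "\<lambda>A. (\<integral>\<^sup>+ p. ennreal (indicator A (fst (flow (q, p))) * accept_prob U (q, p) (flow (q, p)) * std_gauss p) \<partial>lborel)
        + indicator A q * (\<integral>\<^sup>+ p. ennreal ((1 - accept_prob U (q, p) (flow (q, p))) * std_gauss p) \<partial>lborel)"
  have eq: "?\<mu> A = kern_int q (indicator A)"
    if A [measurable]: "A \<in> sets borel" for A
  proof -
    have "ennreal (indicator A (fst (flow (q, p))) * accept_prob U (q, p) (flow (q, p)) * std_gauss p)
       = indicator A (prop_pos q p) * ennreal (acc q p * std_gauss p)" for p
      by (simp add: prop_pos_def acc_def indicator_def)
    then show ?thesis unfolding kern_int_def
      by (subst nn_integral_add) (auto simp: acc_def[symmetric] nn_integral_cmult)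
  qed
  show ?thesis
  proof (subst emeasure_measure_of[OF hmc_kernel_def])
    show "sets borel \<subseteq> Pow (UNIV :: 'a set)" by simp
    show "A \<in> sets (kern q)" using A by simp
    show "positive (sets (kern q)) ?\<mu>"
      by (simp add: positive_def)
    show "countably_additive (sets (kern q)) ?\<mu>"
    proof (rule countably_additiveI)
      fix B :: "nat \<Rightarrow> 'a set"
      assume B: "range B \<subseteq> sets (kern q)" "disjoint_family B" "\<Union> (range B) \<in> sets (kern q)"
      then have B': "B i \<in> sets borel" "\<Union> (range B) \<in> sets borel" for i by auto
      have "(\<Sum>i. kern_int q (indicator (B i))) = kern_int q (\<lambda>x. \<Sum>i. indicator (B i) x)"
        by (rule kern_int_suminf[symmetric]) (use B' in auto)
      also have "(\<lambda>x. \<Sum>i. indicator (B i) x :: ennreal) = indicator (\<Union> (range B))"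
        by (rule ext) (rule suminf_indicator[OF B(2)])
      finally show "(\<Sum>i. ?\<mu> (B i))
        = ?\<mu> (\<Union> (range B))"
        using B' by (simp only: eq)
    qed
    show "?\<mu> A = kern_int q (indicator A)"
      by (rule eq[OF A])
  qed
qed

lemma prob_space_kern: "prob_space (kern q)"
proof (rule prob_spaceI)
  have "space (kern q) = UNIV" using sets_eq_imp_space_eq[OF sets_kern] by simp
  then show "emeasure (kern q) (space (kern q)) = 1"
    using kern_int_1[of q] by (simp add: emeasure_kern indicator_def)
qed

lemma kern_measurable [measurable]: "kern \<in> borel \<rightarrow>\<^sub>M prob_algebra borel"
proof (rule measurable_prob_algebraI[OF prob_space_kern])
  show "kern \<in> borel \<rightarrow>\<^sub>M subprob_algebra borel"
  proof (rule measurable_subprob_algebra)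
    fix A :: "'a set" assume [measurable]: "A \<in> sets borel"
    have "(\<lambda>q. kern_int q (indicator A)) \<in> borel_measurable borel" by measurable
    then show "(\<lambda>a. emeasure (kern a) A) \<in> borel_measurable borel" by (simp add: emeasure_kern)
  qed (auto intro: prob_space_imp_subprob_space prob_space_kern)
qed

lemma nn_integral_kern:
  assumes "g \<in> borel_measurable borel"
  shows "(\<integral>\<^sup>+x. g x \<partial>kern q) = kern_int q g"
  using assms
proof (induction g rule: borel_measurable_induct)
  case (cong f g)
  have "f = g" using cong by auto
  then show ?case using cong by simp
next
  case (set A)
  then show ?case by (simp add: emeasure_kern)
next
  case (mult u c)
  then show ?case by (subst kern_int_cmult) (auto simp: nn_integral_cmult cong: measurable_cong_sets)
next
  case (add u v)
  then show ?case by (subst kern_int_add) (auto simp: nn_integral_add cong: measurable_cong_sets)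
next
  case (seq F)
  have inc: "incseq F" by fact
  have "(\<integral>\<^sup>+x. (SUP i. F i) x \<partial>kern q) = (SUP i. \<integral>\<^sup>+x. F i x \<partial>kern q)"
    unfolding SUP_apply by (rule nn_integral_monotone_convergence_SUP[OF inc]) (use seq in \<open>auto cong: measurable_cong_sets\<close>)
  also have "\<dots> = (SUP i. kern_int q (F i))" using seq by simp
  also have "\<dots> = kern_int q (SUP i. F i)"
  proof -
    have inc': "incseq (\<lambda>i. F i x)" for x using inc by (auto simp: incseq_def le_fun_def)
    note [measurable] = seq(1)
    have eq: "(\<Squnion>i. F i (prop_pos q p)) * a + (\<Squnion>i. F i q) * b = (SUP i. F i (prop_pos q p) * a + F i q * b)" for p a b
    proof -
      have "(\<Squnion>i. F i (prop_pos q p) * a + F i q * b) = (\<Squnion>i. F i (prop_pos q p) * a) + (\<Squnion>i. F i q * b)"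
        by (rule ennreal_SUP_add) (use inc in \<open>auto simp: incseq_def le_fun_def intro!: mult_right_mono\<close>)
      then show ?thesis by (simp add: SUP_mult_right_ennreal)
    qed
    show ?thesis
      unfolding kern_int_def SUP_apply eq
      by (rule nn_integral_monotone_convergence_SUP[symmetric])
        (use inc in \<open>auto simp: incseq_def le_fun_def intro!: add_mono mult_right_mono\<close>)
  qed
  finally show ?case .
qed

section \<open>Normalised target and its invariance\<close>

definition Z :: real where "Z = (\<integral>x. exp (- U x) \<partial>lborel)"

lemma Z_pos: "0 < Z"
proof -
  have "0 \<le> Z" unfolding Z_def by (rule Bochner_Integration.integral_nonneg) simp
  moreover have "Z \<noteq> 0"
  proof
    assume "Z = 0"
    then have "AE x in lborel. exp (- U x) = 0"
      using integral_nonneg_eq_0_iff_AE[OF U_int] by (simp add: Z_def)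
    then have "AE x in (lborel :: 'a measure). False" by simp
    then show False by (auto simp: AE_iff_null)
  qed
  ultimately show ?thesis by simp
qed

lemma target_eq: "target U = density lborel (\<lambda>q. ennreal (exp (- U q) / Z))"
  by (simp add: target_def Z_def)

lemma sets_target [simp, measurable_cong]: "sets (target U) = sets borel"
  by (simp add: target_eq)

lemma target_space: "target U \<in> space (prob_algebra borel)"
proof -
  have "emeasure (target U) UNIV = (\<integral>\<^sup>+x. ennreal (exp (- U x) / Z) \<partial>lborel)"
    by (simp add: target_eq emeasure_density)
  also have "\<dots> = ennreal (\<integral>x. exp (- U x) / Z \<partial>lborel)"
    by (rule nn_integral_eq_integral) (use U_int Z_pos in auto)
  also have "\<dots> = 1" using Z_pos by (simp add: Z_def[symmetric])
  finally have "prob_space (target U)" by (intro prob_spaceI) (simp add: target_eq)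
  then show ?thesis by (simp add: space_prob_algebra)
qed

text \<open>Detailed balance on phase space. The accepted weight is symmetric under the flow
  followed by the flip, which preserves volume; so the accepted mass arriving in \<open>A\<close>
  equals the accepted mass leaving \<open>A\<close>, and together with the rejected mass it restores
  the target.\<close>

lemma target_invariant: "target U \<bind> kern = target U"
proof (rule measure_eqI)
  show "sets (target U \<bind> kern) = sets (target U)"
    by (simp add: sets_bind'[OF target_space kern_measurable])
  fix A assume "A \<in> sets (target U \<bind> kern)"
  then have A [measurable]: "A \<in> sets borel" by (simp add: sets_bind'[OF target_space kern_measurable])
  define c where "c = (2 * pi) powr (- real DIM('a) / 2) / Z"
  have c: "0 < c" using Z_pos by (simp add: c_def)
  \<comment> \<open>Density times Metropolis ratio, up to normalisation, in the form that shows the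
    symmetry between the two end points.\<close>
  define m where "m z = min (exp (- hamiltonian U z)) (exp (- hamiltonian U (flow z)))" for z :: "'a \<times> 'a"
  define w where "w z = ennreal (c * m z)" for z
  define r where "r z = ennreal (c * (exp (- hamiltonian U z) - m z))" for z
  have hm: "hamiltonian U \<in> borel_measurable borel" by (rule borel_measurable_continuous_onI[OF continuous_on_hamiltonian])
  have [measurable]: "m \<in> borel_measurable borel"
    unfolding m_def using hm measurable_compose[OF flow_measurable hm] by measurable
  have [measurable]: "w \<in> borel_measurable borel" unfolding w_def by measurable
  have [measurable]: "r \<in> borel_measurable borel" unfolding r_def using hm by measurable
  have fm [measurable]: "(fst :: 'a \<times> 'a \<Rightarrow> 'a) \<in> borel_measurable borel" by (simp add: borel_prod[symmetric])
  note [measurable] = flow_measurable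
  have im: "m z = acc (fst z) (snd z) * exp (- hamiltonian U z)" for z
  proof -
    have "acc (fst z) (snd z) * exp (- hamiltonian U z)
       = min (1 * exp (- hamiltonian U z)) (exp (hamiltonian U z - hamiltonian U (flow z)) * exp (- hamiltonian U z))"
      unfolding acc_def accept_prob_def by (simp add: min_mult_distrib_right)
    then show ?thesis by (simp add: m_def exp_add[symmetric])
  qed
  have dens: "exp (- U q) / Z * std_gauss p = c * exp (- hamiltonian U (q, p))" for q p :: 'a
  proof -
    have "exp (- hamiltonian U (q, p)) = exp (- U q) * exp (- (norm p)\<^sup>2 / 2)"
      unfolding exp_add[symmetric] by (simp add: hamiltonian_def)
    then show ?thesis by (simp add: c_def std_gauss_def)
  qed
  have weights: "ennreal (acc q p * std_gauss p) * ennreal (exp (- U q) / Z) = w (q, p)"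
    "ennreal ((1 - acc q p) * std_gauss p) * ennreal (exp (- U q) / Z) = r (q, p)" for q p
  proof -
    have "acc q p * std_gauss p * (exp (- U q) / Z) = acc q p * (exp (- U q) / Z * std_gauss p)"
      "(1 - acc q p) * std_gauss p * (exp (- U q) / Z) = (1 - acc q p) * (exp (- U q) / Z * std_gauss p)"
      by simp_all
    then have "acc q p * std_gauss p * (exp (- U q) / Z) = c * m (q, p)"
      "(1 - acc q p) * std_gauss p * (exp (- U q) / Z) = c * (exp (- hamiltonian U (q, p)) - m (q, p))"
      unfolding dens by (simp_all add: im algebra_simps)
    then show "ennreal (acc q p * std_gauss p) * ennreal (exp (- U q) / Z) = w (q, p)"
      "ennreal ((1 - acc q p) * std_gauss p) * ennreal (exp (- U q) / Z) = r (q, p)"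
      using acc_bounds[of q p] std_gauss_pos[of p] Z_pos
      by (simp_all add: w_def r_def ennreal_mult[symmetric])
  qed
  have pm: "(\<lambda>p. f (q, p)) \<in> borel_measurable borel" if "f \<in> borel_measurable borel" for f :: "'a \<times> 'a \<Rightarrow> ennreal" and q
    by (rule measurable_compose[OF _ that]) (simp add: borel_prod[symmetric])
  have pairm: "(\<lambda>q. \<integral>\<^sup>+p. f (q, p) \<partial>lborel) \<in> borel_measurable borel" if "f \<in> borel_measurable borel" for f :: "'a \<times> 'a \<Rightarrow> ennreal"
    by (rule lborel.borel_measurable_nn_integral) (use that in \<open>simp add: borel_prod[symmetric]\<close>)
  have "emeasure (target U \<bind> kern) A = (\<integral>\<^sup>+q. kern_int q (indicator A) \<partial>target U)"
    by (subst emeasure_bind_prob_algebra[OF target_space kern_measurable A]) (simp add: emeasure_kern)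
  also have "\<dots> = (\<integral>\<^sup>+q. ennreal (exp (- U q) / Z) * kern_int q (indicator A) \<partial>lborel)"
    unfolding target_eq by (rule nn_integral_density) measurable
  also have "\<dots> = (\<integral>\<^sup>+q. (\<integral>\<^sup>+p. indicator A (fst (flow (q, p))) * w (q, p) + indicator A q * r (q, p) \<partial>lborel) \<partial>lborel)"
    unfolding kern_int_def
    by (intro nn_integral_cong, subst nn_integral_cmult[symmetric], measurable)
       (intro nn_integral_cong, simp add: weights[symmetric] prop_pos_def distrib_left mult_ac)
  also have "\<dots> = (\<integral>\<^sup>+z. indicator A (fst (flow z)) * w z + indicator A (fst z) * r z \<partial>lborel)"
    by (subst nn_integral_lborel_pair(1)) (auto, measurable)
  also have "\<dots> = (\<integral>\<^sup>+z. indicator A (fst (flow z)) * w z \<partial>lborel) + (\<integral>\<^sup>+z. indicator A (fst z) * r z \<partial>lborel)"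
    by (rule nn_integral_add) measurable
  \<comment> \<open>Reversibility makes the flow after the flip return to
    \<open>momentum_flip z\<close>, so the two terms of the minimum are exchanged. The flip leaves
    positions unchanged, so \<open>A\<close> is still tested at the proposal.\<close>
  also have "(\<integral>\<^sup>+z. indicator A (fst (flow z)) * w z \<partial>lborel) = (\<integral>\<^sup>+z. indicator A (fst z) * w z \<partial>lborel)"
  proof -
    have "w (momentum_flip (flow z)) = w z" for z
      by (simp add: w_def m_def leapfrog_T_reversible min.commute)
    then have "(\<integral>\<^sup>+z. indicator A (fst (flow z)) * w z \<partial>lborel) =
       (\<integral>\<^sup>+z. (\<lambda>z. indicator A (fst z) * w z) ((momentum_flip \<circ> flow) z) \<partial>lborel)"
      by (simp add: momentum_flip_def)
    also have "\<dots> = (\<integral>\<^sup>+z. indicator A (fst z) * w z \<partial>lborel)"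
      by (rule volume_preservingD[OF volume_preserving_comp[OF volume_preserving_momentum_flip
            volume_preserving_leapfrog_T[OF gU_measurable]]]) measurable
    finally show ?thesis .
  qed
  also have "(\<integral>\<^sup>+z. indicator A (fst z) * w z \<partial>lborel) + (\<integral>\<^sup>+z. indicator A (fst z) * r z \<partial>lborel)
      = (\<integral>\<^sup>+z. indicator A (fst z) * w z + indicator A (fst z) * r z \<partial>lborel)"
    by (rule nn_integral_add[symmetric]) measurable
  also have "\<dots> = (\<integral>\<^sup>+z. indicator A (fst z) * ennreal (c * exp (- hamiltonian U z)) \<partial>lborel)"
  proof (rule nn_integral_cong)
    fix z
    have "0 \<le> m z" "m z \<le> exp (- hamiltonian U z)" by (auto simp: m_def)
    then have "w z + r z = ennreal (c * exp (- hamiltonian U z))"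
      using c by (simp add: w_def r_def ennreal_plus[symmetric] algebra_simps del: ennreal_plus)
    then show "indicator A (fst z) * w z + indicator A (fst z) * r z = indicator A (fst z) * ennreal (c * exp (- hamiltonian U z))"
      by (simp add: distrib_left[symmetric])
  qed
  also have "\<dots> = (\<integral>\<^sup>+q. (\<integral>\<^sup>+p. indicator A q * ennreal (c * exp (- hamiltonian U (q, p))) \<partial>lborel) \<partial>lborel)"
    by (subst nn_integral_lborel_pair(1)) (use hm in \<open>auto, measurable\<close>)
  also have "\<dots> = (\<integral>\<^sup>+q. ennreal (exp (- U q) / Z) * indicator A q \<partial>lborel)"
  proof (rule nn_integral_cong)
    fix q :: 'a
    have "(\<integral>\<^sup>+p. indicator A q * ennreal (c * exp (- hamiltonian U (q, p))) \<partial>lborel)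
       = (\<integral>\<^sup>+p. (ennreal (exp (- U q) / Z) * indicator A q) * ennreal (std_gauss (p::'a)) \<partial>lborel)"
    proof (rule nn_integral_cong)
      fix p :: 'a
      have "ennreal (c * exp (- hamiltonian U (q, p))) = ennreal (exp (- U q) / Z) * ennreal (std_gauss p)"
        unfolding dens[symmetric] by (rule ennreal_mult) (use Z_pos std_gauss_pos[of p] in auto)
      then show "indicator A q * ennreal (c * exp (- hamiltonian U (q, p))) = ennreal (exp (- U q) / Z) * indicator A q * ennreal (std_gauss p)"
        by (simp add: mult_ac)
    qed
    also have "\<dots> = (ennreal (exp (- U q) / Z) * indicator A q) * 1"
      by (subst nn_integral_cmult) (auto simp: nn_integral_std_gauss)
    finally show "(\<integral>\<^sup>+p. indicator A q * ennreal (c * exp (- hamiltonian U (q, p))) \<partial>lborel)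
       = ennreal (exp (- U q) / Z) * indicator A q" by simp
  qed
  also have "\<dots> = emeasure (target U) A" by (simp add: target_eq emeasure_density)
  finally show "emeasure (target U \<bind> kern) A = emeasure (target U) A" .
qed

end

section \<open>Taylor bounds for the potential\<close>

locale potential =
  fixes U :: "'a::euclidean_space \<Rightarrow> real"
    and gU :: "'a \<Rightarrow> 'a"
    and HU :: "'a \<Rightarrow> ('a \<Rightarrow>\<^sub>L 'a)"
    and D3U :: "'a \<Rightarrow> ('a \<Rightarrow>\<^sub>L ('a \<Rightarrow>\<^sub>L 'a))"
    and m A1 A2 R A3 A4 :: real
  assumes m: "1 < m" "m \<le> 2"
    and dU: "\<And>q. (U has_derivative (\<lambda>v. gU q \<bullet> v)) (at q)"
    and d2U: "\<And>q. (gU has_derivative blinfun_apply (HU q)) (at q)"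
    and d3U: "\<And>q. (HU has_derivative blinfun_apply (D3U q)) (at q)"
    and A1: "0 \<le> A1"
    and HU_bound: "\<And>q. norm (HU q) \<le> A1 * (norm q + 1) powr (m - 2)"
    and D3U_bound: "\<And>q. norm (D3U q) \<le> A1 * (norm q + 1) powr (m - 3)"
    and A2: "0 < A2"
    and curvature: "\<And>q. R \<le> norm q \<Longrightarrow> A2 * norm q powr (3 * m - 4) \<le> gU q \<bullet> HU q (gU q)"
    and A3: "0 < A3"
    and coercive: "\<And>q. A3 * norm q powr m - A4 \<le> gU q \<bullet> q"
begin

lemma gU_lipschitz_on_convex:
  assumes "convex S" "\<And>z. z \<in> S \<Longrightarrow> norm (HU z) \<le> L" "x \<in> S" "y \<in> S"
  shows "norm (gU y - gU x) \<le> L * norm (y - x)"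
  by (rule differentiable_bound[OF assms(1) has_derivative_at_withinI[OF d2U] _ assms(4,3)])
     (use assms(2) in \<open>simp add: norm_blinfun.rep_eq[symmetric]\<close>)

lemma HU_lipschitz_on_convex:
  assumes "convex S" "\<And>z. z \<in> S \<Longrightarrow> norm (D3U z) \<le> M" "x \<in> S" "y \<in> S"
  shows "norm (HU y - HU x) \<le> M * norm (y - x)"
  by (rule differentiable_bound[OF assms(1) has_derivative_at_withinI[OF d3U] _ assms(4,3)])
     (use assms(2) in \<open>simp add: norm_blinfun.rep_eq[symmetric]\<close>)

text \<open>The linearization point \<open>z\<close> is left free on the segment: the trapezoidal
  error linearizes at the far end point, the change of the squared gradient at the near one.\<close>

lemma gU_taylor_on_convex:
  assumes S: "convex S" and M: "\<And>z. z \<in> S \<Longrightarrow> norm (D3U z) \<le> M"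
    and x: "x \<in> S" and y: "y \<in> S" and z: "z \<in> closed_segment x y"
  shows "norm (gU y - gU x - HU z (y - x)) \<le> M * (norm (y - x))\<^sup>2"
proof -
  have sub: "closed_segment x y \<subseteq> S" using S x y by (simp add: closed_segment_subset)
  have M0: "0 \<le> M" using M[OF x] norm_ge_zero[of "D3U x"] by linarith
  have "norm (gU y - gU x - HU z (y - x)) \<le> norm (y - x) * (M * norm (y - x))"
  proof (rule differentiable_bound_linearization[where S="closed_segment x y" and f'="\<lambda>x. blinfun_apply (HU x)"])
    show "x + t *\<^sub>R (y - x) \<in> closed_segment x y" if "t \<in> {0..1}" for t
      using that by (auto simp: closed_segment_def algebra_simps intro!: exI[of _ t])
    show "(gU has_derivative blinfun_apply (HU v)) (at v within closed_segment x y)" for v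
      by (rule has_derivative_at_withinI[OF d2U])
    show "z \<in> closed_segment x y" by (rule z)
    show "onorm (blinfun_apply (HU v) - blinfun_apply (HU z)) \<le> M * norm (y - x)" if v: "v \<in> closed_segment x y" for v
    proof -
      have "onorm (blinfun_apply (HU v) - blinfun_apply (HU z)) = norm (HU v - HU z)"
        by (simp add: norm_blinfun.rep_eq minus_blinfun.rep_eq fun_diff_def)
      also have "\<dots> \<le> M * norm (v - z)" by (rule HU_lipschitz_on_convex[OF S M]) (use sub z v in auto)
      also have "norm (v - z) \<le> norm (y - x)"
      proof -
        obtain s t where st: "v = (1 - s) *\<^sub>R x + s *\<^sub>R y" "0 \<le> s" "s \<le> 1" "z = (1 - t) *\<^sub>R x + t *\<^sub>R y" "0 \<le> t" "t \<le> 1"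
          using v z by (auto simp: closed_segment_def)
        have "v - z = (s - t) *\<^sub>R (y - x)" unfolding st by (simp add: algebra_simps)
        then have "norm (v - z) = \<bar>s - t\<bar> * norm (y - x)" by simp
        also have "\<dots> \<le> 1 * norm (y - x)" using st by (intro mult_right_mono) auto
        finally show ?thesis by simp
      qed
      finally show ?thesis using M0 by (simp add: mult_left_mono)
    qed
  qed
  then show ?thesis by (simp add: power2_eq_square mult_ac)
qed

text \<open>As a function of the end point the error has derivative \<open>E'\<close>, half the
  inner product of \<open>v\<close> with a Taylor remainder of the gradient. The remainder is
  quadratic in \<open>v\<close>, hence the cubic bound; the constant is not optimized.\<close>

lemma trapezoid_error_on_convex:
  assumes S: "convex S" and M: "\<And>z. z \<in> S \<Longrightarrow> norm (D3U z) \<le> M"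
    and x: "x \<in> S" and y: "y \<in> S"
  shows "\<bar>U y - U x - (1/2) * ((y - x) \<bullet> (gU x + gU y))\<bar> \<le> M * norm (y - x) ^ 3"
proof -
  define v where "v = y - x"
  have M0: "0 \<le> M" using M[OF x] norm_ge_zero[of "D3U x"] by linarith
  define E where "E t = U (x + t *\<^sub>R v) - U x - (t / 2) * (v \<bullet> (gU x + gU (x + t *\<^sub>R v)))" for t :: real
  define E' where "E' t = (1/2) * (v \<bullet> (gU (x + t *\<^sub>R v) - gU x - t *\<^sub>R HU (x + t *\<^sub>R v) v))" for t :: real
  have line: "((\<lambda>t. x + t *\<^sub>R v) has_derivative (\<lambda>s. s *\<^sub>R v)) (at t)" for t :: real
    by (auto intro!: derivative_eq_intros)
  have dUl: "((\<lambda>t. U (x + t *\<^sub>R v)) has_derivative (\<lambda>s. gU (x + t *\<^sub>R v) \<bullet> (s *\<^sub>R v))) (at t)" for t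
    using has_derivative_compose[OF line[of t] dU] by simp
  have dgl: "((\<lambda>t. gU (x + t *\<^sub>R v)) has_derivative (\<lambda>s. HU (x + t *\<^sub>R v) (s *\<^sub>R v))) (at t)" for t
    using has_derivative_compose[OF line[of t] d2U] by simp
  have dE: "(E has_derivative (\<lambda>s. s * E' t)) (at t)" for t
    unfolding E_def E'_def
    by (rule derivative_eq_intros dUl dgl refl | simp)+
       (auto simp: algebra_simps inner_diff_right inner_add_right inner_commute blinfun.scaleR_right)
  have in_S: "x + t *\<^sub>R v \<in> S" if "t \<in> {0..1}" for t
  proof -
    have "x + t *\<^sub>R v = (1 - t) *\<^sub>R x + t *\<^sub>R y" by (simp add: v_def algebra_simps)
    then show ?thesis using convexD[OF S x y, of "1 - t" t] that by simp
  qed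
  have bnd: "\<bar>E' t\<bar> \<le> M * norm v ^ 3" if t: "t \<in> {0..1}" for t
  proof -
    have "norm (gU (x + t *\<^sub>R v) - gU x - HU (x + t *\<^sub>R v) ((x + t *\<^sub>R v) - x)) \<le> M * (norm ((x + t *\<^sub>R v) - x))\<^sup>2"
      by (rule gU_taylor_on_convex[OF S M x in_S[OF t]]) auto
    also have "\<dots> \<le> M * (norm v)\<^sup>2"
      using t M0 by (intro mult_left_mono power_mono) (auto simp: mult_left_le_one_le)
    finally have 1: "norm (gU (x + t *\<^sub>R v) - gU x - t *\<^sub>R HU (x + t *\<^sub>R v) v) \<le> M * (norm v)\<^sup>2"
      by (simp add: blinfun.scaleR_right)
    have "\<bar>E' t\<bar> \<le> (1/2) * (norm v * norm (gU (x + t *\<^sub>R v) - gU x - t *\<^sub>R HU (x + t *\<^sub>R v) v))"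
      unfolding E'_def abs_mult by (intro mult_mono Cauchy_Schwarz_ineq2) auto
    also have "\<dots> \<le> (1/2) * (norm v * (M * (norm v)\<^sup>2))" by (intro mult_left_mono 1) auto
    also have "\<dots> \<le> M * norm v ^ 3" using M0 by (simp add: power2_eq_square power3_eq_cube)
    finally show ?thesis .
  qed
  have "norm (E 1 - E 0) \<le> (M * norm v ^ 3) * norm (1 - 0 :: real)"
  proof (rule differentiable_bound[where S="{0..1}"])
    show "(E has_derivative (\<lambda>s. s * E' t)) (at t within {0..1})" for t by (rule has_derivative_at_withinI[OF dE])
    show "onorm (\<lambda>s. s * E' t) \<le> M * norm v ^ 3" if "t \<in> {0..1}" for t
      by (rule onorm_le) (use bnd[OF that] in \<open>simp add: abs_mult mult.commute mult_left_mono\<close>)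
  qed auto
  then show ?thesis by (simp add: E_def v_def)
qed

text \<open>The first-order term is isolated because (B) gives it a sign for displacements against
  the gradient; the rest is quadratic in the displacement.\<close>

lemma grad_norm_diff_on_convex:
  assumes S: "convex S" and L: "\<And>z. z \<in> S \<Longrightarrow> norm (HU z) \<le> L" and M: "\<And>z. z \<in> S \<Longrightarrow> norm (D3U z) \<le> M"
    and x: "x \<in> S" and y: "y \<in> S"
  shows "(norm (gU y))\<^sup>2 - (norm (gU x))\<^sup>2
     \<le> 2 * (gU x \<bullet> HU x (y - x)) + 2 * norm (gU x) * M * (norm (y - x))\<^sup>2 + L\<^sup>2 * (norm (y - x))\<^sup>2"
proof -
  have "(norm (gU y))\<^sup>2 - (norm (gU x))\<^sup>2 = 2 * (gU x \<bullet> HU x (y - x)) + 2 * (gU x \<bullet> (gU y - gU x - HU x (y - x))) + (norm (gU y - gU x))\<^sup>2"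
    unfolding power2_norm_eq_inner by (simp add: inner_diff_left inner_diff_right inner_commute)
  moreover have "gU x \<bullet> (gU y - gU x - HU x (y - x)) \<le> norm (gU x) * (M * (norm (y - x))\<^sup>2)"
    by (rule order_trans[OF norm_cauchy_schwarz])
       (intro mult_left_mono gU_taylor_on_convex[OF S M x y], auto)
  moreover have "(norm (gU y - gU x))\<^sup>2 \<le> (L * norm (y - x))\<^sup>2"
    by (intro power_mono gU_lipschitz_on_convex[OF S L x y]) auto
  ultimately show ?thesis by (simp add: power_mult_distrib mult_ac)
qed

lemma HU_le_A1: "norm (HU q) \<le> A1"
proof -
  have "(norm q + 1) powr (m - 2) \<le> (norm q + 1) powr 0" using m by (intro powr_mono) auto
  moreover have "norm q + 1 \<noteq> 0" using norm_ge_zero[of q] by linarith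
  ultimately show ?thesis using mult_left_mono[OF _ A1, of "(norm q + 1) powr (m - 2)" 1] HU_bound[of q] by simp
qed

lemma gU_lipschitz: "norm (gU y - gU x) \<le> A1 * norm (y - x)"
  by (rule gU_lipschitz_on_convex[of UNIV]) (auto intro: HU_le_A1)

text \<open>The Hessian bound is integrated along the ray from the origin; \<open>\<phi>\<close> is
  its primitive, with a finite constant because \<open>m > 1\<close>.\<close>

lemma gU_growth: "norm (gU q) \<le> norm (gU 0) + A1 / (m - 1) * (norm q + 1) powr (m - 1)"
proof -
  define Q where "Q = norm q"
  define \<phi> where "\<phi> t = A1 / (m - 1) * (t * Q + 1) powr (m - 1)" for t
  have "norm (gU (1 *\<^sub>R q) - gU (0 *\<^sub>R q)) \<le> \<phi> 1 - \<phi> 0"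
  proof (rule differentiable_bound_general[where f="\<lambda>t. gU (t *\<^sub>R q)" and \<phi>'="\<lambda>t. A1 * (t * Q + 1) powr (m - 2) * Q" and f'="\<lambda>t. HU (t *\<^sub>R q) q"])
    have "continuous_on UNIV gU"
      using has_derivative_continuous[OF d2U] by (simp add: continuous_on_eq_continuous_within)
    then show "continuous_on {0..1} (\<lambda>t. gU (t *\<^sub>R q))"
      by (rule continuous_on_compose2) (auto intro!: continuous_intros)
    have pos: "0 < t * Q + 1" if "0 \<le> t" for t
      using that mult_nonneg_nonneg[of t Q] by (simp add: Q_def add_nonneg_pos)
    show "continuous_on {0..1} \<phi>"
      unfolding \<phi>_def using pos by (intro continuous_intros) force+
    fix t :: real assume t: "0 < t" "t < 1"
    have line: "((\<lambda>t. t *\<^sub>R q) has_derivative (\<lambda>s. s *\<^sub>R q)) (at t)"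
      by (auto intro!: derivative_eq_intros)
    show "((\<lambda>t. gU (t *\<^sub>R q)) has_vector_derivative HU (t *\<^sub>R q) q) (at t)"
      unfolding has_vector_derivative_def
      using has_derivative_compose[OF line d2U] by (simp add: blinfun.scaleR_right)
    have "(\<phi> has_real_derivative A1 / (m - 1) * ((m - 1) * (t * Q + 1) powr (m - 1 - 1) * Q)) (at t)"
      unfolding \<phi>_def
      by (intro DERIV_cmult DERIV_fun_powr[where m=Q, simplified])
        (use pos[of t] t in \<open>auto intro!: derivative_eq_intros\<close>)
    moreover have "A1 / (m - 1) * ((m - 1) * (t * Q + 1) powr (m - 1 - 1) * Q) = A1 * (t * Q + 1) powr (m - 2) * Q"
      using m by (simp add: field_simps)
    ultimately show "(\<phi> has_vector_derivative A1 * (t * Q + 1) powr (m - 2) * Q) (at t)"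
      by (simp add: has_real_derivative_iff_has_vector_derivative)
    have "norm (HU (t *\<^sub>R q) q) \<le> norm (HU (t *\<^sub>R q)) * Q" unfolding Q_def by (rule norm_blinfun)
    also have "\<dots> \<le> (A1 * (norm (t *\<^sub>R q) + 1) powr (m - 2)) * Q"
      by (intro mult_right_mono HU_bound) (simp add: Q_def)
    finally show "norm (HU (t *\<^sub>R q) q) \<le> A1 * (t * Q + 1) powr (m - 2) * Q" using t by (simp add: Q_def)
  qed simp
  moreover have "0 \<le> \<phi> 0" using A1 m by (simp add: \<phi>_def)
  ultimately have "norm (gU q - gU 0) \<le> \<phi> 1" by simp
  then show ?thesis using norm_triangle_sub[of "gU q" "gU 0"] by (simp add: \<phi>_def Q_def)
qed

text \<open>Growth constant of the gradient outside the unit ball. The factor 2 comes from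
  \<open>norm q + 1 \<le> 2 * norm q\<close> there, raised to a power at most 1.\<close>

definition G where "G = norm (gU 0) + 2 * A1 / (m - 1)"

lemma G_nonneg: "0 \<le> G" using A1 m by (simp add: G_def)

lemma gU_growth_far:
  assumes "1 \<le> norm q"
  shows "norm (gU q) \<le> G * norm q powr (m - 1)"
proof -
  have "(norm q + 1) powr (m - 1) \<le> (2 * norm q) powr (m - 1)" using assms m by (intro powr_mono2) auto
  also have "\<dots> = 2 powr (m - 1) * norm q powr (m - 1)" by (simp add: powr_mult)
  also have "\<dots> \<le> 2 powr 1 * norm q powr (m - 1)" using m by (intro mult_right_mono powr_mono) auto
  finally have 1: "A1 / (m - 1) * (norm q + 1) powr (m - 1) \<le> A1 / (m - 1) * (2 * norm q powr (m - 1))"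
    using A1 m by (intro mult_left_mono) auto
  have "norm (gU 0) * 1 \<le> norm (gU 0) * norm q powr (m - 1)"
    using assms m by (intro mult_left_mono) (auto simp: ge_one_powr_ge_zero)
  then show ?thesis using 1 gU_growth[of q] by (simp add: G_def algebra_simps)
qed

text \<open>On this ball \<open>norm x + 1\<close> is at least \<open>norm q / 2\<close>, so the
  negative powers change by a bounded factor only. A trajectory that stays in the ball sees
  derivatives of the size they have at \<open>q\<close>.\<close>

lemma local_bounds:
  assumes q: "0 < norm q" and x: "x \<in> cball q (norm q / 2)"
  shows "norm (HU x) \<le> 2 * A1 * norm q powr (m - 2)"
    and "norm (D3U x) \<le> 4 * A1 * norm q powr (m - 3)"
proof -
  have "norm q \<le> norm x + norm (q - x)" using norm_triangle_sub[of q x] by simp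
  then have nx: "norm q / 2 \<le> norm x + 1" using x by (simp add: dist_norm)
  have half: "(norm q / 2) powr - b = 2 powr b * norm q powr - b" for b
    using q by (simp add: powr_divide powr_minus field_simps)
  have gen: "(norm x + 1) powr - b \<le> 2 powr b * norm q powr - b" if "0 \<le> b" for b
    unfolding half[symmetric] using that nx q by (intro powr_mono2') auto
  have "2 powr (2 - m) \<le> (2 powr 1 :: real)" "2 powr (3 - m) \<le> (2 powr 2 :: real)" using m by (intro powr_mono; simp)+
  then have "2 powr (2 - m) * norm q powr (m - 2) \<le> 2 * norm q powr (m - 2)"
     "2 powr (3 - m) * norm q powr (m - 3) \<le> 4 * norm q powr (m - 3)"
    by (auto intro!: mult_right_mono)
  then have "(norm x + 1) powr (m - 2) \<le> 2 * norm q powr (m - 2)" "(norm x + 1) powr (m - 3) \<le> 4 * norm q powr (m - 3)"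
    using gen[of "2 - m"] gen[of "3 - m"] m by auto
  then show "norm (HU x) \<le> 2 * A1 * norm q powr (m - 2)" "norm (D3U x) \<le> 4 * A1 * norm q powr (m - 3)"
    using order_trans[OF HU_bound[of x] mult_left_mono[OF _ A1], of "2 * norm q powr (m - 2)"]
      order_trans[OF D3U_bound[of x] mult_left_mono[OF _ A1], of "4 * norm q powr (m - 3)"]
    by (simp_all add: mult_ac)
qed

end

section \<open>Leapfrog trajectories\<close>

definition traj_pos :: "real \<Rightarrow> ('a::euclidean_space \<Rightarrow> 'a) \<Rightarrow> 'a \<Rightarrow> 'a \<Rightarrow> nat \<Rightarrow> 'a" where
  "traj_pos h g q p k = fst (leapfrog_T h k g (q, p))"

definition traj_mom :: "real \<Rightarrow> ('a::euclidean_space \<Rightarrow> 'a) \<Rightarrow> 'a \<Rightarrow> 'a \<Rightarrow> nat \<Rightarrow> 'a" where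
  "traj_mom h g q p k = snd (leapfrog_T h k g (q, p))"

lemma traj_0 [simp]: "traj_pos h g q p 0 = q" "traj_mom h g q p 0 = p"
  by (simp_all add: traj_pos_def traj_mom_def leapfrog_T_def)

lemma leapfrog_T_traj: "leapfrog_T h k g (q, p) = (traj_pos h g q p k, traj_mom h g q p k)"
  by (simp add: traj_pos_def traj_mom_def)

lemma traj_pos_Suc:
  "traj_pos h g q p (Suc k) = traj_pos h g q p k + h *\<^sub>R traj_mom h g q p k - (h\<^sup>2 / 2) *\<^sub>R g (traj_pos h g q p k)"
  by (simp add: traj_pos_def traj_mom_def leapfrog_T_def leapfrog_def psi1_def psi2_def algebra_simps power2_eq_square)

lemma traj_mom_Suc:
  "traj_mom h g q p (Suc k) = traj_mom h g q p k - (h / 2) *\<^sub>R (g (traj_pos h g q p k) + g (traj_pos h g q p (Suc k)))"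
  by (simp add: traj_pos_def traj_mom_def leapfrog_T_def leapfrog_def psi1_def psi2_def algebra_simps)

text \<open>The second-order terms of the trapezoidal energy balance telescope along the trajectory, which
  leaves \<open>h\<^sup>2/8\<close> times the increment of the squared gradient norm.\<close>
lemma hamiltonian_traj_diff:
  "hamiltonian U (leapfrog_T h n g (q, p)) - hamiltonian U (q, p) =
    (\<Sum>k<n. U (traj_pos h g q p (Suc k)) - U (traj_pos h g q p k)
        - (1/2) * ((traj_pos h g q p (Suc k) - traj_pos h g q p k) \<bullet> (g (traj_pos h g q p k) + g (traj_pos h g q p (Suc k)))))
    + h\<^sup>2 / 8 * ((norm (g (traj_pos h g q p n)))\<^sup>2 - (norm (g q))\<^sup>2)"
proof (induction n)
  case 0
  then show ?case by (simp add: leapfrog_T_def)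
next
  case (Suc n)
  define x y a b where "x = traj_pos h g q p n" and "y = traj_pos h g q p (Suc n)" and "a = g x" and "b = g y"
  \<comment> \<open>The momentum after the first half kick. The position moves by
    \<open>h *\<^sub>R v\<close>, and the momenta before and after are \<open>v\<close> plus and
    minus half kicks, so the difference of kinetic energies splits into the trapezoidal term and a
    difference of squared gradients.\<close>
  define v where "v = traj_mom h g q p n - (h / 2) *\<^sub>R a"
  have m0: "traj_mom h g q p n = v + (h / 2) *\<^sub>R a" by (simp add: v_def)
  have m1: "traj_mom h g q p (Suc n) = v - (h / 2) *\<^sub>R b"
    by (simp add: traj_mom_Suc v_def x_def[symmetric] y_def[symmetric] a_def[symmetric] b_def[symmetric] algebra_simps)
  have yx: "y - x = h *\<^sub>R v"
    by (simp add: y_def traj_pos_Suc x_def[symmetric] a_def[symmetric] v_def algebra_simps power2_eq_square)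
  have "(norm (v - (h / 2) *\<^sub>R b))\<^sup>2 / 2 - (norm (v + (h / 2) *\<^sub>R a))\<^sup>2 / 2
      = - (1/2) * ((h *\<^sub>R v) \<bullet> (a + b)) + h\<^sup>2 / 8 * ((norm b)\<^sup>2 - (norm a)\<^sup>2)"
    unfolding power2_norm_eq_inner
    by (simp add: inner_diff_left inner_diff_right inner_add_left inner_add_right inner_commute power2_eq_square field_simps)
  then have "hamiltonian U (leapfrog_T h (Suc n) g (q, p)) - hamiltonian U (leapfrog_T h n g (q, p))
     = U y - U x - (1/2) * ((y - x) \<bullet> (a + b)) + h\<^sup>2 / 8 * ((norm b)\<^sup>2 - (norm a)\<^sup>2)"
    by (simp add: leapfrog_T_traj hamiltonian_def m0 m1 yx x_def[symmetric] y_def[symmetric])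
  then show ?case using Suc
    by (simp add: x_def[symmetric] y_def[symmetric] a_def[symmetric] b_def[symmetric] algebra_simps)
qed

text \<open>One constant serves for the momentum error, the position error and the displacement.
  With \<open>C\<close> the previous value, each new bound is at most \<open>3 * C\<close> plus half
  of \<open>(real (Suc k))\<^sup>2 * G\<close>, the share of the constant force.\<close>

fun expansion_const :: "real \<Rightarrow> nat \<Rightarrow> real" where
  "expansion_const G 0 = 1"
| "expansion_const G (Suc k) = 4 * expansion_const G k + (real (Suc k))\<^sup>2 * G"

lemma expansion_const_ge_1: "0 \<le> G \<Longrightarrow> 1 \<le> expansion_const G k"
proof (induction k)
  case (Suc k)
  moreover have "0 \<le> (real (Suc k))\<^sup>2 * G" using Suc.prems by simp
  ultimately show ?case unfolding expansion_const.simps by linarith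
qed simp

lemma expansion_const_mono: "0 \<le> G \<Longrightarrow> j \<le> k \<Longrightarrow> expansion_const G j \<le> expansion_const G k"
proof (rule lift_Suc_mono_le[of "expansion_const G"])
  fix n assume "0 \<le> G"
  then have "expansion_const G n \<le> 4 * expansion_const G n" "0 \<le> (real (Suc n))\<^sup>2 * G"
    using expansion_const_ge_1[of G n] by auto
  then show "expansion_const G n \<le> expansion_const G (Suc n)" by simp
qed

text \<open>When the momentum is small against \<open>D / h\<close> and the gradient is nearly constant on the scale \<open>D\<close>,
  the trajectory is that of a particle in the constant force field \<open>- g q\<close>.\<close>
lemma traj_expansion:
  fixes g :: "'a::euclidean_space \<Rightarrow> 'a"
  assumes h: "0 < h" and G: "0 \<le> G" and \<tau>: "0 \<le> \<tau>" "\<tau> \<le> 1" and D: "0 \<le> D"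
    and gq: "h\<^sup>2 * norm (g q) \<le> G * D" and p: "h * norm p \<le> \<tau> * D"
    and \<epsilon>: "h\<^sup>2 * \<epsilon> \<le> \<tau>"
    and lip: "\<And>x. norm (x - q) \<le> r \<Longrightarrow> norm (g x - g q) \<le> \<epsilon> * norm (x - q)"
    and r: "expansion_const G n * D \<le> r" and k: "k \<le> n"
  shows "norm (h *\<^sub>R traj_mom h g q p k + (real k * h\<^sup>2) *\<^sub>R g q) \<le> expansion_const G k * \<tau> * D \<and>
    norm (traj_pos h g q p k - q + ((real k)\<^sup>2 / 2 * h\<^sup>2) *\<^sub>R g q) \<le> expansion_const G k * \<tau> * D \<and>
    norm (traj_pos h g q p k - q) \<le> expansion_const G k * D"
  using k
proof (induction k)
  case 0
  then show ?case using h p \<tau> D by simp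
next
  case (Suc k)
  define C C' where "C = expansion_const G k" and "C' = expansion_const G (Suc k)"
  have C: "1 \<le> C" "1 \<le> C'" unfolding C_def C'_def by (rule expansion_const_ge_1[OF G])+
  define x y P a b where "x = traj_pos h g q p k" and "y = traj_pos h g q p (Suc k)"
    and "P = traj_mom h g q p k" and "a = g x - g q" and "b = g y - g q"
  define ga where "ga = g q"
  have gx: "g x = a + ga" and gy: "g y = b + ga" by (simp_all add: a_def b_def ga_def)
  have IH: "norm (h *\<^sub>R P + (real k * h\<^sup>2) *\<^sub>R ga) \<le> C * \<tau> * D"
    "norm (x - q + ((real k)\<^sup>2 / 2 * h\<^sup>2) *\<^sub>R ga) \<le> C * \<tau> * D" "norm (x - q) \<le> C * D"
    using Suc by (auto simp: C_def x_def P_def ga_def)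
  \<comment> \<open>A displacement of size \<open>B * D\<close> changes the kick by at most
    \<open>h\<^sup>2 * \<epsilon> * B * D\<close>; this is where the small factor
    \<open>\<tau>\<close> is gained.\<close>
  have force: "norm (h\<^sup>2 *\<^sub>R (g z - g q)) \<le> B * \<tau> * D" if "norm (z - q) \<le> B * D" "B * D \<le> r" for z B
  proof -
    have "norm (h\<^sup>2 *\<^sub>R (g z - g q)) \<le> h\<^sup>2 * (\<epsilon> * norm (z - q))"
      using lip[of z] that by (simp add: mult_left_mono)
    also have "\<dots> \<le> \<tau> * norm (z - q)" using mult_right_mono[OF \<epsilon>, of "norm (z - q)"] by (simp add: mult_ac)
    also have "\<dots> \<le> \<tau> * (B * D)" using \<tau> that by (intro mult_left_mono) auto
    finally show ?thesis by (simp add: mult_ac)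
  qed
  have Cn: "C * D \<le> r" "C' * D \<le> r"
    using mult_right_mono[OF expansion_const_mono[OF G, of k n] D] mult_right_mono[OF expansion_const_mono[OF G, of "Suc k" n] D] r Suc.prems
    by (auto simp: C_def C'_def)
  have fa: "norm (h\<^sup>2 *\<^sub>R a) \<le> C * \<tau> * D" unfolding a_def by (rule force[OF IH(3) Cn(1)])
  have gs: "0 \<le> (real (Suc k))\<^sup>2 * G" using G by simp
  have C': "C' = 4 * C + (real (Suc k))\<^sup>2 * G" by (simp add: C_def C'_def)
  have \<tau>D: "0 \<le> \<tau> * D" "\<tau> * D \<le> D" using \<tau> D by (auto simp: mult_left_le_one_le)
  have ysplit: "y - q + ((real (Suc k))\<^sup>2 / 2 * h\<^sup>2) *\<^sub>R ga =
     (x - q + ((real k)\<^sup>2 / 2 * h\<^sup>2) *\<^sub>R ga) + (h *\<^sub>R P + (real k * h\<^sup>2) *\<^sub>R ga) - (1/2) *\<^sub>R (h\<^sup>2 *\<^sub>R a)"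
  proof -
    have "((real (Suc k))\<^sup>2 / 2 * h\<^sup>2) *\<^sub>R ga = ((real k)\<^sup>2 / 2 * h\<^sup>2) *\<^sub>R ga + (real k * h\<^sup>2) *\<^sub>R ga + (h\<^sup>2 / 2) *\<^sub>R ga"
      unfolding scaleR_left_distrib[symmetric] by (simp add: power2_eq_square field_simps)
    moreover have "y = x + h *\<^sub>R P - (h\<^sup>2 / 2) *\<^sub>R (a + ga)"
      by (simp add: y_def traj_pos_Suc x_def[symmetric] P_def[symmetric] gx)
    ultimately show ?thesis by (simp add: algebra_simps)
  qed
  have y1: "norm (y - q + ((real (Suc k))\<^sup>2 / 2 * h\<^sup>2) *\<^sub>R ga) \<le> 3 * C * (\<tau> * D)"
  proof -
    have "norm (y - q + ((real (Suc k))\<^sup>2 / 2 * h\<^sup>2) *\<^sub>R ga) \<le> C * \<tau> * D + C * \<tau> * D + (1/2) * (C * \<tau> * D)"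
      unfolding ysplit
      by (rule order_trans[OF norm_triangle_ineq4 add_mono[OF order_trans[OF norm_triangle_ineq add_mono[OF IH(2) IH(1)]]]])
         (use fa in simp)
    also have "\<dots> \<le> 3 * C * (\<tau> * D)" using C \<tau>D by (simp add: algebra_simps)
    finally show ?thesis .
  qed
  have y2: "norm (y - q) \<le> C' * D"
  proof -
    have "norm (y - q) \<le> norm (y - q + ((real (Suc k))\<^sup>2 / 2 * h\<^sup>2) *\<^sub>R ga) + norm (((real (Suc k))\<^sup>2 / 2 * h\<^sup>2) *\<^sub>R ga)"
      using norm_triangle_ineq4[of "y - q + ((real (Suc k))\<^sup>2 / 2 * h\<^sup>2) *\<^sub>R ga" "((real (Suc k))\<^sup>2 / 2 * h\<^sup>2) *\<^sub>R ga"] by simp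
    also have "norm (((real (Suc k))\<^sup>2 / 2 * h\<^sup>2) *\<^sub>R ga) = (real (Suc k))\<^sup>2 / 2 * (h\<^sup>2 * norm ga)" by simp
    also have "\<dots> \<le> (real (Suc k))\<^sup>2 / 2 * (G * D)" using gq by (intro mult_left_mono) (auto simp: ga_def)
    also have "norm (y - q + ((real (Suc k))\<^sup>2 / 2 * h\<^sup>2) *\<^sub>R ga) \<le> 3 * C * D"
      using y1 \<tau>D C mult_left_mono[OF \<tau>D(2), of "3 * C"] by linarith
    finally have "norm (y - q) \<le> (3 * C + (real (Suc k))\<^sup>2 / 2 * G) * D" by (simp add: algebra_simps)
    also have "\<dots> \<le> C' * D"
    proof (rule mult_right_mono[OF _ D])
      show "3 * C + (real (Suc k))\<^sup>2 / 2 * G \<le> C'" unfolding C' using C gs by linarith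
    qed
    finally show ?thesis .
  qed
  have fb: "norm (h\<^sup>2 *\<^sub>R b) \<le> (3 * C + (real (Suc k))\<^sup>2 * G) * \<tau> * D"
    unfolding b_def
  proof (rule force)
    have "norm (y - q) \<le> norm (y - q + ((real (Suc k))\<^sup>2 / 2 * h\<^sup>2) *\<^sub>R ga) + norm (((real (Suc k))\<^sup>2 / 2 * h\<^sup>2) *\<^sub>R ga)"
      using norm_triangle_ineq4[of "y - q + ((real (Suc k))\<^sup>2 / 2 * h\<^sup>2) *\<^sub>R ga" "((real (Suc k))\<^sup>2 / 2 * h\<^sup>2) *\<^sub>R ga"] by simp
    also have "norm (((real (Suc k))\<^sup>2 / 2 * h\<^sup>2) *\<^sub>R ga) = (real (Suc k))\<^sup>2 / 2 * (h\<^sup>2 * norm ga)" by simp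
    also have "\<dots> \<le> (real (Suc k))\<^sup>2 * (G * D)" using gq G D by (rule_tac mult_mono) (auto simp: ga_def)
    also have "norm (y - q + ((real (Suc k))\<^sup>2 / 2 * h\<^sup>2) *\<^sub>R ga) \<le> 3 * C * D"
      using y1 \<tau>D C mult_left_mono[OF \<tau>D(2), of "3 * C"] by linarith
    finally show "norm (y - q) \<le> (3 * C + (real (Suc k))\<^sup>2 * G) * D" by (simp add: algebra_simps)
    show "(3 * C + (real (Suc k))\<^sup>2 * G) * D \<le> r"
      using Cn(2) mult_right_mono[OF _ D, of "3 * C + (real (Suc k))\<^sup>2 * G" C'] C unfolding C' by linarith
  qed
  have psplit: "h *\<^sub>R traj_mom h g q p (Suc k) + (real (Suc k) * h\<^sup>2) *\<^sub>R ga
     = (h *\<^sub>R P + (real k * h\<^sup>2) *\<^sub>R ga) - ((1/2) *\<^sub>R (h\<^sup>2 *\<^sub>R a) + (1/2) *\<^sub>R (h\<^sup>2 *\<^sub>R b))"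
    by (simp add: traj_mom_Suc x_def[symmetric] y_def[symmetric] P_def[symmetric] gx gy algebra_simps power2_eq_square)
      (simp add: scaleR_left_distrib[symmetric] scaleR_add_right[symmetric])
  have "norm (h *\<^sub>R traj_mom h g q p (Suc k) + (real (Suc k) * h\<^sup>2) *\<^sub>R ga)
      \<le> C * \<tau> * D + ((1/2) * (C * \<tau> * D) + (1/2) * ((3 * C + (real (Suc k))\<^sup>2 * G) * \<tau> * D))"
    unfolding psplit
    by (rule order_trans[OF norm_triangle_ineq4 add_mono[OF IH(1) order_trans[OF norm_triangle_ineq add_mono]]])
       (use fa fb in simp_all)
  also have "\<dots> = (3 * C + (real (Suc k))\<^sup>2 * G / 2) * (\<tau> * D)" by (simp add: algebra_simps)
  also have "\<dots> \<le> C' * (\<tau> * D)" using C gs by (intro mult_right_mono \<tau>D) (unfold C', linarith)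
  finally have 1: "norm (h *\<^sub>R traj_mom h g q p (Suc k) + (real (Suc k) * h\<^sup>2) *\<^sub>R ga) \<le> C' * \<tau> * D" by (simp add: mult_ac)
  have "3 * C * (\<tau> * D) \<le> C' * (\<tau> * D)" using C gs by (intro mult_right_mono \<tau>D) (unfold C', linarith)
  then have 2: "norm (y - q + ((real (Suc k))\<^sup>2 / 2 * h\<^sup>2) *\<^sub>R ga) \<le> C' * \<tau> * D" using y1 by (simp add: mult_ac)
  show ?case using 1 2 y2 by (simp add: C'_def[symmetric] y_def ga_def del: of_nat_Suc expansion_const.simps)
qed

text \<open>A crude bound from the global Lipschitz property alone, with a constant independent of
  \<open>q\<close> and \<open>p\<close> and no restriction on the step. It controls the momenta for
  which nothing better is known.\<close>

lemma traj_linear_bound: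
  fixes g :: "'a::euclidean_space \<Rightarrow> 'a"
  assumes h: "0 < h" and L: "0 \<le> L" and lip: "\<And>x y. norm (g y - g x) \<le> L * norm (y - x)"
  shows "\<exists>C\<ge>0. \<forall>q p. norm (traj_pos h g q p k - q) \<le> C * (norm (g q) + norm p)
                 \<and> norm (traj_mom h g q p k) \<le> C * (norm (g q) + norm p)"
proof (induction k)
  case 0
  then show ?case by (intro exI[of _ 1]) auto
next
  case (Suc k)
  then obtain C where C: "0 \<le> C" and b: "\<And>q p. norm (traj_pos h g q p k - q) \<le> C * (norm (g q) + norm p)"
     "\<And>q p. norm (traj_mom h g q p k) \<le> C * (norm (g q) + norm p)" by blast
  define C1 where "C1 = C + h * C + h\<^sup>2 / 2 * (1 + L * C)"
  define C2 where "C2 = C + h / 2 * (2 + L * C + L * C1)"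
  have C1: "0 \<le> C1" unfolding C1_def using C h L by simp
  have C2: "0 \<le> C2" unfolding C2_def using C C1 h L by simp
  have gb: "norm (g x) \<le> (1 + L * B) * (norm (g q) + norm p)" if "norm (x - q) \<le> B * (norm (g q) + norm p)" for x q p B
  proof -
    have "norm (g x) \<le> norm (g q) + norm (g x - g q)" using norm_triangle_sub[of "g x" "g q"] by simp
    also have "norm (g x - g q) \<le> L * (B * (norm (g q) + norm p))"
      using lip[of x q] mult_left_mono[OF that L] by linarith
    finally show ?thesis by (simp add: algebra_simps) (smt (verit) norm_ge_zero)
  qed
  have 1: "norm (traj_pos h g q p (Suc k) - q) \<le> C1 * (norm (g q) + norm p)" for q p
  proof -
    have "norm (traj_pos h g q p (Suc k) - q) = norm ((traj_pos h g q p k - q) + h *\<^sub>R traj_mom h g q p k - (h\<^sup>2 / 2) *\<^sub>R g (traj_pos h g q p k))"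
      by (simp add: traj_pos_Suc algebra_simps)
    also have "\<dots> \<le> C * (norm (g q) + norm p) + h * (C * (norm (g q) + norm p)) + (h\<^sup>2 / 2) * ((1 + L * C) * (norm (g q) + norm p))"
    proof -
      have tri: "norm (a + b - c) \<le> norm a + norm b + norm c" for a b c :: 'a
        using norm_triangle_ineq4[of "a + b" c] norm_triangle_ineq[of a b] by linarith
      show ?thesis
        by (rule order_trans[OF tri], intro add_mono b)
          (use h b[of q p] gb[OF b(1), of q p] in \<open>auto intro!: mult_left_mono simp del: times_divide_eq_left\<close>)
    qed
    finally show ?thesis by (simp add: C1_def field_simps)
  qed
  have 2: "norm (traj_mom h g q p (Suc k)) \<le> C2 * (norm (g q) + norm p)" for q p
  proof -
    have "norm (traj_mom h g q p (Suc k)) \<le> C * (norm (g q) + norm p) + (h / 2) * ((1 + L * C) * (norm (g q) + norm p) + (1 + L * C1) * (norm (g q) + norm p))"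
      unfolding traj_mom_Suc using h b[of q p] gb[OF b(1)] gb[OF 1]
      by (intro order_trans[OF norm_triangle_ineq4] add_mono) (auto intro!: mult_left_mono order_trans[OF norm_triangle_ineq] add_mono)
    then show ?thesis by (simp add: C2_def field_simps)
  qed
  have le: "B * (norm (g q) + norm p) \<le> (C1 + C2) * (norm (g q) + norm p)" if "B \<le> C1 + C2" for B q p
    using that by (intro mult_right_mono) auto
  show ?case
  proof (intro exI[of _ "C1 + C2"] conjI allI)
    show "norm (traj_pos h g q p (Suc k) - q) \<le> (C1 + C2) * (norm (g q) + norm p)" for q p
      by (rule order_trans[OF 1 le]) (use C2 in simp)
    show "norm (traj_mom h g q p (Suc k)) \<le> (C1 + C2) * (norm (g q) + norm p)" for q p
      by (rule order_trans[OF 2 le]) (use C1 in simp)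
  qed (use C1 C2 in simp)
qed

section \<open>Accepted inward proposals\<close>

context potential
begin

text \<open>With \<open>s = h\<^sup>2 \<parallel>q\<parallel>\<^bsup>m-2\<^esup>\<close> and \<open>D = s \<parallel>q\<parallel>\<close> the energy balance is \<open>s D\<^sup>2\<close> times a negative constant plus
  terms of order \<open>s + \<tau>\<close>: proposals from \<open>q\<close> with \<open>h \<parallel>p\<parallel> \<le> \<tau> D\<close> are accepted and move inwards by at least \<open>c D\<close>.\<close>
lemma inward_accepted_proposal:
  assumes T: "1 \<le> T"
  obtains s0 Q0 c where "0 < s0" "1 \<le> Q0" "0 < c"
    "\<And>h q p. 0 < h \<Longrightarrow> Q0 \<le> norm q \<Longrightarrow> h\<^sup>2 * norm q powr (m - 2) \<le> s0 \<Longrightarrow>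
       norm p \<le> s0 * h * norm q powr (m - 1) \<Longrightarrow>
       hamiltonian U (leapfrog_T h T gU (q, p)) \<le> hamiltonian U (q, p) \<and>
       norm (fst (leapfrog_T h T gU (q, p))) \<le> norm q - c * h\<^sup>2 * norm q powr (m - 1)"
proof -
  define C where "C = expansion_const G T"
  have C: "1 \<le> C" unfolding C_def by (rule expansion_const_ge_1[OF G_nonneg])
  define t where "t = real T"
  have t: "1 \<le> t" using T by (simp add: t_def)
  \<comment> \<open>Here \<open>\<kappa>\<close> collects the errors in the squared norm of the
    proposal: \<open>2 * C\<close> from the inner product with the remainder \<open>e\<close>,
    \<open>C\<^sup>2\<close> from the squared displacement. The next constant,
    \<open>\<omega>\<close>, collects those of the energy: \<open>T\<close> trapezoidal errors and
    one eighth of the gradient errors.\<close>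
  define \<kappa> where "\<kappa> = 2 * C + C\<^sup>2"
  define \<omega> where "\<omega> = t * (32 * A1 * C ^ 3) + (4 * G * A1 * C + 8 * A1 * G * C\<^sup>2 + 4 * A1\<^sup>2 * C\<^sup>2) / 8"
  have \<kappa>: "0 < \<kappa>" unfolding \<kappa>_def using C by (simp add: add_pos_nonneg)
  have \<omega>: "0 \<le> \<omega>" unfolding \<omega>_def using A1 C G_nonneg t by (intro add_nonneg_nonneg mult_nonneg_nonneg divide_nonneg_nonneg) auto
  \<comment> \<open>In order, the entries serve the trajectory expansion, keep the trajectory within
    \<open>norm q / 2\<close> of \<open>q\<close>, save half of the inward move, and make the energy
    balance nonpositive.\<close>
  define \<tau> where "\<tau> = min (min 1 (1 / (2 * C))) (min (t\<^sup>2 * A3 / 4 / \<kappa>) (t\<^sup>2 * A2 / 8 / (\<omega> + 1)))"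
  have \<tau>: "0 < \<tau>" "\<tau> \<le> 1" "C * \<tau> \<le> 1 / 2" "\<kappa> * \<tau> \<le> t\<^sup>2 * A3 / 4" "\<omega> * \<tau> \<le> t\<^sup>2 * A2 / 8"
  proof -
    show "0 < \<tau>" unfolding \<tau>_def using C \<kappa> \<omega> t A2 A3 by auto
    show "\<tau> \<le> 1" by (simp add: \<tau>_def)
    have "\<tau> \<le> 1 / (2 * C)" by (simp add: \<tau>_def)
    then show "C * \<tau> \<le> 1 / 2" using C by (simp add: field_simps)
    have "\<tau> \<le> t\<^sup>2 * A3 / 4 / \<kappa>" by (simp add: \<tau>_def)
    then show "\<kappa> * \<tau> \<le> t\<^sup>2 * A3 / 4" using \<kappa> by (simp add: pos_le_divide_eq mult_ac)
    have "\<tau> \<le> t\<^sup>2 * A2 / 8 / (\<omega> + 1)" by (simp add: \<tau>_def)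
    moreover have "0 < \<omega> + 1" using \<omega> by simp
    ultimately have "\<tau> * (\<omega> + 1) \<le> t\<^sup>2 * A2 / 8" by (simp only: pos_le_divide_eq)
    then show "\<omega> * \<tau> \<le> t\<^sup>2 * A2 / 8" using \<open>0 < \<tau>\<close> by (simp add: algebra_simps)
  qed
  \<comment> \<open>Used twice: as a bound on \<open>s\<close>, where
    \<open>2 * A1 * s \<le> \<tau>\<close> is the Lipschitz requirement of the expansion, and as the
    admissible ratio of \<open>h * norm p\<close> to \<open>D\<close>.\<close>
  define s0 where "s0 = \<tau> / (1 + 2 * A1)"
  have s0: "0 < s0" "s0 \<le> \<tau>" "2 * A1 * s0 \<le> \<tau>"
    using \<tau>(1) A1 by (auto simp: s0_def field_simps add_pos_nonneg)
  define Q0 where "Q0 = max (max 1 R) ((2 * \<bar>A4\<bar> / A3) powr (1 / m))"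
  define c where "c = t\<^sup>2 * A3 / 8"
  show thesis
  proof (rule that[of s0 Q0 c])
    show "0 < s0" "1 \<le> Q0" "0 < c" using s0 A3 t by (auto simp: Q0_def c_def)
    fix h :: real and q p :: 'a
    assume h: "0 < h" and q: "Q0 \<le> norm q" and s_le: "h\<^sup>2 * norm q powr (m - 2) \<le> s0"
      and p: "norm p \<le> s0 * h * norm q powr (m - 1)"
    define Q where "Q = norm q"
    define a where "a = Q powr (m - 2)"
    define s where "s = h\<^sup>2 * a"
    define D where "D = s * Q"
    have Q: "1 \<le> Q" "R \<le> Q" using q by (auto simp: Q_def Q0_def)
    have a: "0 < a" using Q by (simp add: a_def)
    have s: "0 < s" "s \<le> \<tau>" "2 * A1 * s \<le> \<tau>"
    proof -
      show "0 < s" using h a by (simp add: s_def)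
      have "s \<le> s0" using s_le by (simp add: s_def a_def Q_def)
      then show "s \<le> \<tau>" "2 * A1 * s \<le> \<tau>" using s0 mult_left_mono[of s s0 "2 * A1"] A1 by linarith+
    qed
    have D: "0 < D" using s Q by (simp add: D_def)
    \<comment> \<open>All powers are written through \<open>a\<close> and \<open>Q\<close>, so that
      what follows is polynomial algebra in \<open>s\<close>, \<open>D\<close> and \<open>Q\<close>.
      The last identity shows that the exponent in (B) is exactly the scale of the leading energy
      term.\<close>
    have pw: "Q powr (m - 1) = a * Q" "Q powr m = a * Q\<^sup>2" "Q powr (m - 3) = a / Q" "Q powr (3 * m - 4) = a ^ 3 * Q\<^sup>2"
    proof -
      have "Q powr (m - 1) = Q powr ((m - 2) + 1)" by simp
      then show "Q powr (m - 1) = a * Q" unfolding powr_add a_def using Q by simp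
      have "Q powr m = Q powr ((m - 2) + 2)" by simp
      then show "Q powr m = a * Q\<^sup>2" unfolding powr_add a_def using Q by simp
      have "Q powr (m - 3) = Q powr ((m - 2) - 1)" by simp
      then show "Q powr (m - 3) = a / Q" unfolding powr_diff a_def using Q by simp
      have "Q powr (3 * m - 4) = Q powr ((m - 2) + (m - 2) + (m - 2) + 2)" by (simp add: algebra_simps)
      then show "Q powr (3 * m - 4) = a ^ 3 * Q\<^sup>2" unfolding powr_add a_def using Q by (simp add: power3_eq_cube)
    qed
    have gq: "norm (gU q) \<le> G * (a * Q)"
      using gU_growth_far[of q] Q by (simp add: Q_def[symmetric] pw)
    have hgq: "h\<^sup>2 * norm (gU q) \<le> G * D"
      using mult_left_mono[OF gq, of "h\<^sup>2"] by (simp add: D_def s_def mult_ac)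
    have hp: "h * norm p \<le> \<tau> * D"
    proof -
      have "h * norm p \<le> h * (s0 * h * (a * Q))" using p h by (simp add: Q_def[symmetric] pw)
      also have "\<dots> = s0 * D" by (simp add: D_def s_def power2_eq_square)
      also have "\<dots> \<le> \<tau> * D" using s0 D by (intro mult_right_mono) auto
      finally show ?thesis .
    qed
    define S where "S = cball q (Q / 2)"
    have qS: "q \<in> S" and S: "convex S" using Q by (auto simp: S_def)
    have L: "norm (HU x) \<le> 2 * A1 * a" and M: "norm (D3U x) \<le> 4 * A1 * (a / Q)" if "x \<in> S" for x
      using local_bounds[of q x] that Q by (auto simp: S_def Q_def[symmetric] a_def[symmetric] pw)
    have lip: "norm (gU x - gU q) \<le> (2 * A1 * a) * norm (x - q)" if "norm (x - q) \<le> Q / 2" for x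
      by (rule gU_lipschitz_on_convex[OF S L qS]) (use that in \<open>auto simp: S_def dist_norm norm_minus_commute\<close>)
    have CD: "C * D \<le> Q / 2"
    proof -
      have "C * s \<le> 1 / 2" using mult_left_mono[OF s(2), of C] \<tau>(3) C by linarith
      then have "C * s * Q \<le> 1 / 2 * Q" using Q by (intro mult_right_mono) auto
      then show ?thesis by (simp add: D_def mult_ac)
    qed
    define x where "x k = traj_pos h gU q p k" for k
    have \<epsilon>: "h\<^sup>2 * (2 * A1 * a) \<le> \<tau>" using s(3) by (simp add: s_def mult_ac)
    have exp: "norm (x k - q + ((real k)\<^sup>2 / 2 * h\<^sup>2) *\<^sub>R gU q) \<le> expansion_const G k * \<tau> * D"
       "norm (x k - q) \<le> expansion_const G k * D" if "k \<le> T" for k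
      using traj_expansion[OF h G_nonneg less_imp_le[OF \<tau>(1)] \<tau>(2) less_imp_le[OF D] hgq hp \<epsilon> lip CD[unfolded C_def] that]
      unfolding x_def by blast+
    have xq: "norm (x k - q) \<le> C * D" if "k \<le> T" for k
      using exp(2)[OF that] mult_right_mono[OF expansion_const_mono[OF G_nonneg that] less_imp_le[OF D]]
      by (simp add: C_def)
    have xS: "x k \<in> S" if "k \<le> T" for k
      using xq[OF that] CD by (simp add: S_def dist_norm norm_minus_commute)
    define w where "w = x T - q"
    define e where "e = w + (t\<^sup>2 / 2 * h\<^sup>2) *\<^sub>R gU q"
    have w: "norm w \<le> C * D" using xq[of T] by (simp add: w_def)
    have e: "norm e \<le> C * \<tau> * D" using exp(1)[of T] by (simp add: e_def w_def t_def C_def)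
    have w_eq: "w = e - (t\<^sup>2 / 2 * h\<^sup>2) *\<^sub>R gU q" by (simp add: e_def)
    have w2: "(norm w)\<^sup>2 \<le> C\<^sup>2 * D\<^sup>2" using power_mono[OF w, of 2] by (simp add: power_mult_distrib)
    have DQ: "0 \<le> D * Q" using D Q by simp

    have inward: "norm (x T) \<le> Q - c * D"
    proof -
      have "A4 \<le> A3 * (a * Q\<^sup>2) / 2"
      proof -
        have "2 * \<bar>A4\<bar> / A3 = ((2 * \<bar>A4\<bar> / A3) powr (1 / m)) powr m" using m A3 by (simp add: powr_powr)
        also have "\<dots> \<le> Q powr m" using q m by (intro powr_mono2) (auto simp: Q0_def Q_def)
        finally have "2 * \<bar>A4\<bar> \<le> A3 * Q powr m" using A3 by (simp add: field_simps)
        then show ?thesis by (simp add: pw)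
      qed
      then have "A3 * (a * Q\<^sup>2) / 2 \<le> gU q \<bullet> q" using coercive[of q] by (simp add: Q_def[symmetric] pw)
      then have "(t\<^sup>2 / 2 * h\<^sup>2) * (A3 * (a * Q\<^sup>2) / 2) \<le> (t\<^sup>2 / 2 * h\<^sup>2) * (gU q \<bullet> q)" by (intro mult_left_mono) auto
      moreover have "(t\<^sup>2 / 2 * h\<^sup>2) * (A3 * (a * Q\<^sup>2) / 2) = t\<^sup>2 * A3 / 4 * (D * Q)"
        by (simp add: D_def s_def power2_eq_square)
      moreover have "q \<bullet> w = q \<bullet> e - (t\<^sup>2 / 2 * h\<^sup>2) * (gU q \<bullet> q)" unfolding w_eq by (simp add: inner_diff_right inner_commute)
      moreover have "q \<bullet> e \<le> C * \<tau> * (D * Q)"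
      proof -
        have "q \<bullet> e \<le> Q * norm e" unfolding Q_def by (rule norm_cauchy_schwarz)
        also have "\<dots> \<le> Q * (C * \<tau> * D)" using e Q by (intro mult_left_mono) auto
        finally show ?thesis by (simp add: mult_ac)
      qed
      ultimately have qw: "q \<bullet> w \<le> C * \<tau> * (D * Q) - t\<^sup>2 * A3 / 4 * (D * Q)" by linarith
      have "(norm w)\<^sup>2 \<le> C\<^sup>2 * \<tau> * (D * Q)"
      proof -
        have "C\<^sup>2 * D\<^sup>2 = C\<^sup>2 * s * (D * Q)" by (simp add: D_def power2_eq_square)
        also have "\<dots> \<le> C\<^sup>2 * \<tau> * (D * Q)" using s DQ by (intro mult_right_mono mult_left_mono) auto
        finally show ?thesis using w2 by linarith
      qed
      moreover have "(norm (x T))\<^sup>2 = Q\<^sup>2 + 2 * (q \<bullet> w) + (norm w)\<^sup>2"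
        unfolding Q_def power2_norm_eq_inner by (simp add: w_def inner_diff_left inner_diff_right inner_commute)
      moreover have "\<kappa> * \<tau> * (D * Q) \<le> t\<^sup>2 * A3 / 4 * (D * Q)" by (intro mult_right_mono \<tau>(4) DQ)
      moreover have "\<kappa> * \<tau> * (D * Q) = 2 * (C * \<tau> * (D * Q)) + C\<^sup>2 * \<tau> * (D * Q)" by (simp add: \<kappa>_def algebra_simps)
      moreover have "c * (D * Q) = t\<^sup>2 * A3 / 4 * (D * Q) / 2" by (simp add: c_def)
      ultimately have le: "(norm (x T))\<^sup>2 \<le> Q\<^sup>2 - 2 * (c * (D * Q))" using qw by linarith
      \<comment> \<open>Before square roots are compared, \<open>Q - c * D\<close> must be
        nonnegative; this is forced by the squared norm on the left being nonnegative.\<close>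
      have "2 * (c * (D * Q)) \<le> Q\<^sup>2" using le zero_le_power2[of "norm (x T)"] by linarith
      then have "2 * c * D \<le> Q" using Q by (simp add: power2_eq_square mult_ac)
      moreover have "0 \<le> c * D" using A3 D by (simp add: c_def)
      ultimately have nn: "0 \<le> Q - c * D" by linarith
      have "(Q - c * D)\<^sup>2 = Q\<^sup>2 - 2 * (c * (D * Q)) + (c * D)\<^sup>2"
        unfolding power2_diff by (simp add: mult_ac)
      then have "(norm (x T))\<^sup>2 \<le> (Q - c * D)\<^sup>2"
        using le zero_le_power2[of "c * D"] by linarith
      then show ?thesis using nn by (rule power2_le_imp_le)
    qed

    \<comment> \<open>Multiplying by h^2 makes the terms expressible in \<open>s\<close> and
      \<open>D\<close>: \<open>h\<^sup>2 * (a / Q) * D ^ 3\<close> is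
      \<open>s\<^sup>2 * D\<^sup>2\<close>, one factor \<open>s\<close> smaller than the leading
      gradient term.\<close>
    have trap: "h\<^sup>2 * \<bar>U (x (Suc k)) - U (x k) - (1/2) * ((x (Suc k) - x k) \<bullet> (gU (x k) + gU (x (Suc k))))\<bar>
        \<le> 32 * A1 * C ^ 3 * \<tau> * (s * D\<^sup>2)" if "k < T" for k
    proof -
      have "norm (x (Suc k) - x k) \<le> 2 * C * D"
        using norm_triangle_ineq4[of "x (Suc k) - q" "x k - q"] xq[of k] xq[of "Suc k"] that by simp
      then have "norm (x (Suc k) - x k) ^ 3 \<le> (2 * C * D) ^ 3" by (intro power_mono) auto
      then have "4 * A1 * (a / Q) * norm (x (Suc k) - x k) ^ 3 \<le> 4 * A1 * (a / Q) * (2 * C * D) ^ 3"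
        using A1 a Q by (intro mult_left_mono) auto
      moreover have "\<bar>U (x (Suc k)) - U (x k) - (1/2) * ((x (Suc k) - x k) \<bullet> (gU (x k) + gU (x (Suc k))))\<bar>
          \<le> 4 * A1 * (a / Q) * norm (x (Suc k) - x k) ^ 3"
        by (rule trapezoid_error_on_convex[OF S M]) (use xS that in auto)
      ultimately have "h\<^sup>2 * \<bar>U (x (Suc k)) - U (x k) - (1/2) * ((x (Suc k) - x k) \<bullet> (gU (x k) + gU (x (Suc k))))\<bar>
          \<le> h\<^sup>2 * (4 * A1 * (a / Q) * (2 * C * D) ^ 3)" by (intro mult_left_mono) auto
      also have "\<dots> = 32 * A1 * C ^ 3 * s * (s * D\<^sup>2)"
        using Q by (simp add: D_def s_def power3_eq_cube power2_eq_square)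
      also have "\<dots> \<le> 32 * A1 * C ^ 3 * \<tau> * (s * D\<^sup>2)"
        using s A1 C by (intro mult_right_mono mult_left_mono) auto
      finally show ?thesis .
    qed
    have grad: "h\<^sup>2 * (h\<^sup>2 * ((norm (gU (x T)))\<^sup>2 - (norm (gU q))\<^sup>2))
       \<le> (s * D\<^sup>2) * (- t\<^sup>2 * A2 + (4 * G * A1 * C + 8 * A1 * G * C\<^sup>2 + 4 * A1\<^sup>2 * C\<^sup>2) * \<tau>)"
    proof -
      have g1: "(norm (gU (x T)))\<^sup>2 - (norm (gU q))\<^sup>2 \<le> 2 * (gU q \<bullet> HU q w) + 2 * norm (gU q) * (4 * A1 * (a / Q)) * (norm w)\<^sup>2 + (2 * A1 * a)\<^sup>2 * (norm w)\<^sup>2"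
        unfolding w_def by (rule grad_norm_diff_on_convex[OF S L M qS xS]) auto
      have g2: "2 * norm (gU q) * (4 * A1 * (a / Q)) * (norm w)\<^sup>2 \<le> 2 * (G * (a * Q)) * (4 * A1 * (a / Q)) * (C\<^sup>2 * D\<^sup>2)"
        using gq w2 A1 a Q G_nonneg by (intro mult_mono) auto
      have g3: "(2 * A1 * a)\<^sup>2 * (norm w)\<^sup>2 \<le> (2 * A1 * a)\<^sup>2 * (C\<^sup>2 * D\<^sup>2)"
        using w2 by (intro mult_left_mono) auto
      \<comment> \<open>The displacement is the constant-force part, to which (B) applies, plus the
        remainder \<open>e\<close>, which is smaller by the factor \<open>\<tau>\<close>.\<close>
      have g4: "gU q \<bullet> HU q w \<le> (G * (a * Q)) * (2 * A1 * a) * (C * \<tau> * D) - (t\<^sup>2 / 2 * h\<^sup>2) * (A2 * (a ^ 3 * Q\<^sup>2))"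
      proof -
        have "gU q \<bullet> HU q w = gU q \<bullet> HU q e - (t\<^sup>2 / 2 * h\<^sup>2) * (gU q \<bullet> HU q (gU q))"
          unfolding w_eq by (simp add: blinfun.diff_right blinfun.scaleR_right inner_diff_right)
        moreover have "(t\<^sup>2 / 2 * h\<^sup>2) * (A2 * (a ^ 3 * Q\<^sup>2)) \<le> (t\<^sup>2 / 2 * h\<^sup>2) * (gU q \<bullet> HU q (gU q))"
          using curvature[of q] Q by (intro mult_left_mono) (auto simp: Q_def[symmetric] pw)
        moreover have "gU q \<bullet> HU q e \<le> (G * (a * Q)) * (2 * A1 * a) * (C * \<tau> * D)"
        proof -
          have "gU q \<bullet> HU q e \<le> norm (gU q) * norm (HU q e)" by (rule norm_cauchy_schwarz)
          also have "\<dots> \<le> norm (gU q) * (norm (HU q) * norm e)" by (intro mult_left_mono norm_blinfun) auto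
          also have "\<dots> \<le> (G * (a * Q)) * ((2 * A1 * a) * (C * \<tau> * D))"
            using gq L[OF qS] e A1 a G_nonneg Q by (intro mult_mono) auto
          finally show ?thesis by (simp add: mult_ac)
        qed
        ultimately show ?thesis by linarith
      qed
      have "(norm (gU (x T)))\<^sup>2 - (norm (gU q))\<^sup>2 \<le>
         2 * ((G * (a * Q)) * (2 * A1 * a) * (C * \<tau> * D) - (t\<^sup>2 / 2 * h\<^sup>2) * (A2 * (a ^ 3 * Q\<^sup>2)))
         + 2 * (G * (a * Q)) * (4 * A1 * (a / Q)) * (C\<^sup>2 * D\<^sup>2) + (2 * A1 * a)\<^sup>2 * (C\<^sup>2 * D\<^sup>2)"
        by (rule order_trans[OF g1 add_mono[OF add_mono[OF mult_left_mono[OF g4] g2] g3]]) simp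
      then have "h\<^sup>2 * (h\<^sup>2 * ((norm (gU (x T)))\<^sup>2 - (norm (gU q))\<^sup>2)) \<le> h\<^sup>2 * (h\<^sup>2 * (
         2 * ((G * (a * Q)) * (2 * A1 * a) * (C * \<tau> * D) - (t\<^sup>2 / 2 * h\<^sup>2) * (A2 * (a ^ 3 * Q\<^sup>2)))
         + 2 * (G * (a * Q)) * (4 * A1 * (a / Q)) * (C\<^sup>2 * D\<^sup>2) + (2 * A1 * a)\<^sup>2 * (C\<^sup>2 * D\<^sup>2)))"
        by (intro mult_left_mono) auto
      also have "\<dots> = (s * D\<^sup>2) * (- t\<^sup>2 * A2 + 4 * G * A1 * C * \<tau> + (8 * A1 * G * C\<^sup>2 + 4 * A1\<^sup>2 * C\<^sup>2) * s)"
        using Q by (simp add: D_def s_def power2_eq_square power3_eq_cube algebra_simps)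
      also have "\<dots> \<le> (s * D\<^sup>2) * (- t\<^sup>2 * A2 + 4 * G * A1 * C * \<tau> + (8 * A1 * G * C\<^sup>2 + 4 * A1\<^sup>2 * C\<^sup>2) * \<tau>)"
        using s A1 G_nonneg by (intro mult_left_mono add_left_mono) auto
      finally show ?thesis by (simp add: algebra_simps)
    qed
    define err where "err k = U (x (Suc k)) - U (x k) - (1/2) * ((x (Suc k) - x k) \<bullet> (gU (x k) + gU (x (Suc k))))" for k
    have "hamiltonian U (leapfrog_T h T gU (q, p)) - hamiltonian U (q, p)
       = (\<Sum>k<T. err k) + h\<^sup>2 / 8 * ((norm (gU (x T)))\<^sup>2 - (norm (gU q))\<^sup>2)"
      unfolding err_def x_def by (rule hamiltonian_traj_diff)
    then have "h\<^sup>2 * (hamiltonian U (leapfrog_T h T gU (q, p)) - hamiltonian U (q, p))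
       = (\<Sum>k<T. h\<^sup>2 * err k) + h\<^sup>2 * (h\<^sup>2 * ((norm (gU (x T)))\<^sup>2 - (norm (gU q))\<^sup>2)) / 8"
      by (simp only: distrib_left sum_distrib_left times_divide_eq_left times_divide_eq_right)
    also have "\<dots> \<le> (\<Sum>k<T. 32 * A1 * C ^ 3 * \<tau> * (s * D\<^sup>2))
         + (s * D\<^sup>2) * (- t\<^sup>2 * A2 + (4 * G * A1 * C + 8 * A1 * G * C\<^sup>2 + 4 * A1\<^sup>2 * C\<^sup>2) * \<tau>) / 8"
    proof (intro add_mono sum_mono divide_right_mono grad)
      fix k assume "k \<in> {..<T}"
      then have "h\<^sup>2 * \<bar>err k\<bar> \<le> 32 * A1 * C ^ 3 * \<tau> * (s * D\<^sup>2)"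
        unfolding err_def by (intro trap) simp
      moreover have "h\<^sup>2 * err k \<le> h\<^sup>2 * \<bar>err k\<bar>" by (intro mult_left_mono) auto
      ultimately show "h\<^sup>2 * err k \<le> 32 * A1 * C ^ 3 * \<tau> * (s * D\<^sup>2)" by linarith
    qed simp
    also have "\<dots> = (s * D\<^sup>2) * (\<omega> * \<tau> - t\<^sup>2 * A2 / 8)"
    proof -
      have "(\<Sum>k<T. 32 * A1 * C ^ 3 * \<tau> * (s * D\<^sup>2)) = (s * D\<^sup>2) * (t * (32 * A1 * C ^ 3) * \<tau>)"
        by (simp add: t_def)
      moreover have "X * (Z * \<tau>) + X * (- t\<^sup>2 * A2 + Y * \<tau>) / 8 = X * ((Z + Y / 8) * \<tau> - t\<^sup>2 * A2 / 8)" for X Y Z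
        by (simp add: field_simps)
      ultimately show ?thesis unfolding \<omega>_def by (simp only:)
    qed
    also have "\<dots> \<le> 0" using \<tau>(5) s by (intro mult_nonneg_nonpos) auto
    finally have "hamiltonian U (leapfrog_T h T gU (q, p)) - hamiltonian U (q, p) \<le> 0"
      using h by (simp add: mult_le_0_iff)
    moreover have "norm (fst (leapfrog_T h T gU (q, p))) \<le> norm q - c * h\<^sup>2 * norm q powr (m - 1)"
      using inward by (simp add: x_def traj_pos_def D_def s_def Q_def[symmetric] pw mult_ac)
    ultimately show "hamiltonian U (leapfrog_T h T gU (q, p)) \<le> hamiltonian U (q, p) \<and>
       norm (fst (leapfrog_T h T gU (q, p))) \<le> norm q - c * h\<^sup>2 * norm q powr (m - 1)" by simp
  qed
qed

end

section \<open>Geometric drift\<close>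

locale hmc_potential = potential U gU HU D3U m A1 A2 R A3 A4
  for U :: "'a::euclidean_space \<Rightarrow> real" and gU HU D3U m A1 A2 R A3 A4 +
  fixes h :: real and T :: nat
  assumes h: "0 < h" and T: "1 \<le> T" and U_integrable: "integrable lborel (\<lambda>q. exp (- U q))"
begin

sublocale hmc_setup U gU h T
proof
  show "continuous_on UNIV U"
    using has_derivative_continuous[OF dU] by (simp add: continuous_on_eq_continuous_within)
  show "continuous_on UNIV gU"
    using has_derivative_continuous[OF d2U] by (simp add: continuous_on_eq_continuous_within)
qed (rule U_integrable)

lemma prop_pos_eq_traj: "prop_pos q p = traj_pos h gU q p T"
  by (simp add: prop_pos_def traj_pos_def)

lemma prop_pos_linear_bound:
  obtains C where "0 \<le> C" "\<And>q p. norm (prop_pos q p - q) \<le> C * (norm (gU q) + norm p)"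
  using traj_linear_bound[OF h A1 gU_lipschitz, of T] by (auto simp: prop_pos_eq_traj)

lemma kern_int_le:
  fixes V F :: "'a \<Rightarrow> real"
  assumes V: "\<And>x. 0 \<le> V x"
    and le: "\<And>p. V (prop_pos q p) * acc q p + V q * (1 - acc q p) \<le> F p"
  shows "kern_int q (\<lambda>x. ennreal (V x)) \<le> (\<integral>\<^sup>+p. ennreal (F p * std_gauss p) \<partial>lborel)"
  unfolding kern_int_def
proof (rule nn_integral_mono)
  fix p :: 'a
  have g: "0 \<le> std_gauss p" and a: "0 \<le> acc q p" "0 \<le> 1 - acc q p"
    using acc_bounds[of q p] std_gauss_pos[of p] by auto
  have "ennreal (V (prop_pos q p)) * ennreal (acc q p * std_gauss p) + ennreal (V q) * ennreal ((1 - acc q p) * std_gauss p)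
     = ennreal (V (prop_pos q p) * (acc q p * std_gauss p) + V q * ((1 - acc q p) * std_gauss p))"
    using V g a by (simp add: ennreal_mult[symmetric] ennreal_plus[symmetric] del: ennreal_plus)
  also have "V (prop_pos q p) * (acc q p * std_gauss p) + V q * ((1 - acc q p) * std_gauss p)
      = (V (prop_pos q p) * acc q p + V q * (1 - acc q p)) * std_gauss p" by (simp add: algebra_simps)
  also have "\<dots> \<le> F p * std_gauss p" by (rule mult_right_mono[OF le g])
  finally show "ennreal (V (prop_pos q p)) * ennreal (acc q p * std_gauss p) + ennreal (V q) * ennreal ((1 - acc q p) * std_gauss p)
     \<le> ennreal (F p * std_gauss p)" by (simp add: ennreal_leI)
qed

lemma accept_prob_eq_1: "hamiltonian U (flow (q, p)) \<le> hamiltonian U (q, p) \<Longrightarrow> acc q p = 1"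
  by (simp add: acc_def accept_prob_def)

lemma convex_combination_le:
  fixes x y b :: real
  assumes "x \<le> b" "y \<le> b"
  shows "x * acc q p + y * (1 - acc q p) \<le> b"
proof -
  have "x * acc q p + y * (1 - acc q p) \<le> b * acc q p + b * (1 - acc q p)"
    using acc_bounds[of q p] assms by (intro add_mono mult_right_mono) auto
  then show ?thesis by (simp add: algebra_simps)
qed

text \<open>At large \<open>q\<close> the momenta are split at \<open>\<kappa> * y\<close>, with
  \<open>y\<close> of order \<open>norm q powr (m - 1)\<close>: below it the proposal is accepted
  and inward, above it the Gaussian tail outweighs the largest possible gain. Both contributions are
  made at most a quarter of \<open>V q\<close>.\<close>

lemma hmc_drift:
  assumes s0: "0 < s0" "0 < c"
    and good: "\<And>q p. Q0 \<le> norm q \<Longrightarrow> h\<^sup>2 * norm q powr (m - 2) \<le> s0 \<Longrightarrow> norm p \<le> s0 * h * norm q powr (m - 1) \<Longrightarrow>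
       hamiltonian U (leapfrog_T h T gU (q, p)) \<le> hamiltonian U (q, p) \<and>
       norm (fst (leapfrog_T h T gU (q, p))) \<le> norm q - c * h\<^sup>2 * norm q powr (m - 1)"
    and far: "\<And>x. Q2 \<le> x \<Longrightarrow> h\<^sup>2 * x powr (m - 2) \<le> s0"
  shows "\<exists>K\<ge>0. \<forall>q. kern_int q (\<lambda>x. ennreal (exp (norm x))) \<le> ennreal (1 / 2 * exp (norm q) + K)"
proof -
  obtain C where C: "0 \<le> C" and move: "\<And>q p. norm (prop_pos q p - q) \<le> C * (norm (gU q) + norm p)"
    by (rule prop_pos_linear_bound) blast
  have move': "norm (prop_pos q p) \<le> norm q + C * (norm (gU q) + norm p)" for q p
    using move[of q p] norm_triangle_sub[of "prop_pos q p" q] by simp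
  define E where "E p = exp (C * norm p + (norm p)\<^sup>2 / 4)" for p :: 'a
  define K0 where "K0 = enn2real (\<integral>\<^sup>+p. ennreal (E p * std_gauss p) \<partial>lborel)"
  have K0: "(\<integral>\<^sup>+p. ennreal (E p * std_gauss p) \<partial>lborel) = ennreal K0" "0 \<le> K0"
    using std_gauss_exp_moment[where 'a='a, of C] by (auto simp: K0_def E_def less_top)
  have E_meas [measurable]: "E \<in> borel_measurable borel" unfolding E_def by measurable
  have int: "(\<integral>\<^sup>+p. ennreal ((a + b * E p) * std_gauss p) \<partial>lborel) = ennreal (a + b * K0)" if "0 \<le> a" "0 \<le> b" for a b
  proof -
    have "ennreal ((a + b * E p) * std_gauss p) = ennreal a * ennreal (std_gauss p) + ennreal b * ennreal (E p * std_gauss p)" for p :: 'a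
    proof -
      have n: "0 \<le> std_gauss p" "0 \<le> E p * std_gauss p" using std_gauss_pos[of p] by (auto simp: E_def)
      have "(a + b * E p) * std_gauss p = a * std_gauss p + b * (E p * std_gauss p)" by (simp add: algebra_simps)
      then show ?thesis using that n by (simp add: ennreal_mult ennreal_plus)
    qed
    then have "(\<integral>\<^sup>+p. ennreal ((a + b * E p) * std_gauss p) \<partial>lborel) = ennreal a * 1 + ennreal b * ennreal K0"
      by (simp add: nn_integral_add nn_integral_cmult nn_integral_std_gauss K0)
    also have "\<dots> = ennreal (a + b * K0)" using that K0 by (simp add: ennreal_mult ennreal_plus)
    finally show ?thesis .
  qed
  define \<kappa> where "\<kappa> = s0 * h"
  define c' where "c' = c * h\<^sup>2"
  have pos: "0 < \<kappa>" "0 < c'" using s0 h by (auto simp: \<kappa>_def c'_def)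
  \<comment> \<open>In order, the terms ensure \<open>y \<ge> 1\<close>,
    \<open>exp (- c' * y) \<le> 1 / 4\<close>, an exponent of \<open>B\<close> at most
    \<open>- y\<close>, and \<open>K0 * exp (- y) \<le> 1 / 4\<close>.\<close>
  define Y where "Y = 1 + ln 4 / c' + 4 * (C * G + 1) / \<kappa>\<^sup>2 + 4 * K0"
  define Q3 where "Q3 = max (max 1 Q0) (max Q2 (Y powr (1 / (m - 1))))"
  have Y_terms: "0 \<le> ln 4 / c'" "0 \<le> 4 * (C * G + 1) / \<kappa>\<^sup>2"
    using pos C G_nonneg by auto
  then have Y: "1 \<le> Y" "ln 4 / c' \<le> Y" "4 * (C * G + 1) / \<kappa>\<^sup>2 \<le> Y" "4 * K0 \<le> Y"
    using K0(2) unfolding Y_def by linarith+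
  have large: "kern_int q (\<lambda>x. ennreal (exp (norm x))) \<le> ennreal (1 / 2 * exp (norm q))" if q: "Q3 \<le> norm q" for q
  proof -
    define y where "y = norm q powr (m - 1)"
    have q': "1 \<le> norm q" "Q0 \<le> norm q" "Q2 \<le> norm q" using q by (auto simp: Q3_def)
    have "Y = (Y powr (1 / (m - 1))) powr (m - 1)" using Y m by (simp add: powr_powr)
    also have "\<dots> \<le> y" unfolding y_def using q m by (intro powr_mono2) (auto simp: Q3_def)
    finally have yY: "Y \<le> y" .
    have gq: "norm (gU q) \<le> G * y" using gU_growth_far[OF q'(1)] by (simp add: y_def)
    define B where "B = exp (C * G * y - \<kappa>\<^sup>2 * y\<^sup>2 / 4)"
    have pw: "exp (norm (prop_pos q p)) * acc q p + exp (norm q) * (1 - acc q p)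
        \<le> exp (norm q) * exp (- c' * y) + exp (norm q) * B * E p" for p
    proof (cases "norm p \<le> \<kappa> * y")
      case True
      have "hamiltonian U (flow (q, p)) \<le> hamiltonian U (q, p) \<and> norm (prop_pos q p) \<le> norm q - c' * y"
        using good[OF q'(2) far[OF q'(3)], of p] True by (simp add: y_def \<kappa>_def c'_def prop_pos_def)
      then have "acc q p = 1" "exp (norm (prop_pos q p)) \<le> exp (norm q + - c' * y)"
        by (auto simp: accept_prob_eq_1)
      moreover have "0 \<le> exp (norm q) * B * E p" by (simp add: B_def E_def)
      ultimately show ?thesis by (simp only: exp_add) simp
    next
      \<comment> \<open>Chernoff bound: on this set \<open>1 \<le> exp (((norm p)\<^sup>2 -
        \<kappa>\<^sup>2 * y\<^sup>2) / 4)\<close>. The acceptance probability is unknown, so moving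
        and staying are bounded by the same quantity.\<close>
      case False
      have "(\<kappa> * y)\<^sup>2 \<le> (norm p)\<^sup>2" using False pos yY Y by (intro power_mono) auto
      then have kp: "\<kappa>\<^sup>2 * y\<^sup>2 \<le> (norm p)\<^sup>2" by (simp add: power_mult_distrib)
      have "C * (norm (gU q) + norm p) \<le> C * (G * y + norm p)" using gq C by (intro mult_left_mono) auto
      also have "\<dots> \<le> (C * G * y - \<kappa>\<^sup>2 * y\<^sup>2 / 4) + (C * norm p + (norm p)\<^sup>2 / 4)" using kp by (simp add: algebra_simps)
      finally have up: "C * (norm (gU q) + norm p) \<le> (C * G * y - \<kappa>\<^sup>2 * y\<^sup>2 / 4) + (C * norm p + (norm p)\<^sup>2 / 4)" .
      have eq: "exp (norm q) * B * E p = exp (norm q + ((C * G * y - \<kappa>\<^sup>2 * y\<^sup>2 / 4) + (C * norm p + (norm p)\<^sup>2 / 4)))"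
        unfolding B_def E_def by (simp only: exp_add mult.assoc)
      have "0 \<le> C * (norm (gU q) + norm p)" using C by simp
      then have "exp (norm (prop_pos q p)) * acc q p + exp (norm q) * (1 - acc q p) \<le> exp (norm q) * B * E p"
        unfolding eq by (intro convex_combination_le) (use move'[of q p] up in auto)
      moreover have "0 \<le> exp (norm q) * exp (- c' * y)" by simp
      ultimately show ?thesis by linarith
    qed
    have "exp (- c' * y) \<le> 1 / 4"
    proof -
      have "ln 4 / c' \<le> y" using Y yY by linarith
      then have "ln 4 \<le> y * c'" using pos(2) by (simp only: pos_divide_le_eq)
      then have "exp (- c' * y) \<le> exp (- ln 4)" by (simp add: mult.commute)
      then show ?thesis by (simp add: exp_minus)
    qed
    moreover have "B * K0 \<le> 1 / 4"
    proof -
      have "4 * (C * G + 1) / \<kappa>\<^sup>2 \<le> y" using Y yY by linarith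
      moreover have "0 < \<kappa>\<^sup>2" using pos by simp
      ultimately have "4 * (C * G + 1) \<le> y * \<kappa>\<^sup>2" by (simp only: pos_divide_le_eq)
      then have "4 * (C * G + 1) * y \<le> y * \<kappa>\<^sup>2 * y" using Y yY by (intro mult_right_mono) auto
      then have "C * G * y - \<kappa>\<^sup>2 * y\<^sup>2 / 4 \<le> - y" by (simp add: power2_eq_square algebra_simps)
      then have "B \<le> exp (- y)" by (simp add: B_def)
      then have "B * K0 \<le> exp (- y) * K0" using K0(2) by (rule mult_right_mono)
      also have "4 * K0 \<le> exp y" using Y(4) yY exp_ge_add_one_self[of y] by linarith
      then have "exp (- y) * (4 * K0) \<le> exp (- y) * exp y" by (rule mult_left_mono) simp
      then have "exp (- y) * K0 \<le> 1 / 4" by (simp add: exp_minus)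
      finally show ?thesis .
    qed
    ultimately have sm: "exp (norm q) * exp (- c' * y) + exp (norm q) * B * K0 \<le> 1 / 2 * exp (norm q)"
      using mult_left_mono[of "exp (- c' * y) + B * K0" "1 / 2" "exp (norm q)"] by (simp add: algebra_simps)
    have "kern_int q (\<lambda>x. ennreal (exp (norm x))) \<le> (\<integral>\<^sup>+p. ennreal ((exp (norm q) * exp (- c' * y) + exp (norm q) * B * E p) * std_gauss p) \<partial>lborel)"
      by (rule kern_int_le[OF _ pw]) simp
    also have "\<dots> = ennreal (exp (norm q) * exp (- c' * y) + exp (norm q) * B * K0)"
      by (rule int) (auto simp: B_def)
    also have "\<dots> \<le> ennreal (1 / 2 * exp (norm q))" by (rule ennreal_leI[OF sm])
    finally show ?thesis .
  qed
  \<comment> \<open>On the bounded region the linear displacement bound gives a uniform constant,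
    whatever the acceptance probability.\<close>
  define G' where "G' = norm (gU 0) + A1 * Q3"
  define K where "K = exp (Q3 + C * G') * K0"
  have small: "kern_int q (\<lambda>x. ennreal (exp (norm x))) \<le> ennreal K" if q: "norm q \<le> Q3" for q
  proof -
    have "norm (gU q) \<le> norm (gU 0) + A1 * norm q"
      using gU_lipschitz[of q 0] norm_triangle_sub[of "gU q" "gU 0"] by simp
    also have "\<dots> \<le> G'" unfolding G'_def using q A1 by (simp add: mult_left_mono)
    finally have gq: "C * norm (gU q) \<le> C * G'" using C by (rule mult_left_mono)
    have "0 \<le> C * norm (gU q)" using C by simp
    then have CG: "0 \<le> C * G'" using gq by linarith
    have pw: "exp (norm (prop_pos q p)) * acc q p + exp (norm q) * (1 - acc q p) \<le> 0 + exp (Q3 + C * G') * E p" for p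
    proof -
      have "exp (Q3 + C * G') * E p = exp (Q3 + C * G' + (C * norm p + (norm p)\<^sup>2 / 4))"
        unfolding E_def by (simp only: exp_add)
      moreover have "norm (prop_pos q p) \<le> Q3 + C * G' + (C * norm p + (norm p)\<^sup>2 / 4)"
        using move'[of q p, unfolded distrib_left] q gq zero_le_power2[of "norm p"] by linarith
      moreover have "norm q \<le> Q3 + C * G' + (C * norm p + (norm p)\<^sup>2 / 4)"
        using q CG mult_nonneg_nonneg[OF C norm_ge_zero[of p]] zero_le_power2[of "norm p"] by linarith
      ultimately show ?thesis by (simp add: convex_combination_le)
    qed
    have "kern_int q (\<lambda>x. ennreal (exp (norm x))) \<le> (\<integral>\<^sup>+p. ennreal ((0 + exp (Q3 + C * G') * E p) * std_gauss p) \<partial>lborel)"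
      by (rule kern_int_le[OF _ pw]) simp
    also have "\<dots> = ennreal K" by (subst int) (auto simp: K_def)
    finally show ?thesis .
  qed
  have K: "0 \<le> K" using K0 by (simp add: K_def)
  have "kern_int q (\<lambda>x. ennreal (exp (norm x))) \<le> ennreal (1 / 2 * exp (norm q) + K)" for q
  proof (cases "Q3 \<le> norm q")
    case True
    show ?thesis by (rule order_trans[OF large[OF True] ennreal_leI]) (use K in simp)
  next
    case False
    then have "norm q \<le> Q3" by simp
    show ?thesis by (rule order_trans[OF small[OF \<open>norm q \<le> Q3\<close>] ennreal_leI]) simp
  qed
  then show ?thesis using K by blast
qed

end

section \<open>Volume comparison for perturbations of a homothety\<close>

text \<open>The map is \<open>a\<close> times the identity plus a map of Lipschitz constant
  \<open>a / 2\<close>: below \<open>a\<close>, so that points can be solved for by contraction, and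
  no differentiability is involved.\<close>

definition near_scaling_on :: "'a::euclidean_space set \<Rightarrow> real \<Rightarrow> ('a \<Rightarrow> 'a) \<Rightarrow> bool" where
  "near_scaling_on B a f \<longleftrightarrow> (\<forall>p\<in>B. \<forall>p'\<in>B. norm (f p - f p' - a *\<^sub>R (p - p')) \<le> a / 2 * norm (p - p'))"

lemma near_scaling_on_subset: "near_scaling_on B a f \<Longrightarrow> B' \<subseteq> B \<Longrightarrow> near_scaling_on B' a f"
  by (auto simp: near_scaling_on_def)

text \<open>Simplified Newton iteration with derivative frozen at \<open>a\<close>: it contracts by
  \<open>1 / 2\<close>, and its first step from \<open>p0\<close> has length at most
  \<open>\<rho> / 2\<close>, so it preserves the ball.\<close>

lemma near_scaling_covers:
  assumes f: "near_scaling_on (cball p0 \<rho>) a f" and a: "0 < a" and \<rho>: "0 \<le> \<rho>"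
    and y: "norm (y - f p0) \<le> a * \<rho> / 2"
  shows "\<exists>p\<in>cball p0 \<rho>. f p = y"
proof -
  define N where "N p = p + (1 / a) *\<^sub>R (y - f p)" for p
  have contr: "norm (N p - N p') \<le> 1 / 2 * norm (p - p')" if "p \<in> cball p0 \<rho>" "p' \<in> cball p0 \<rho>" for p p'
  proof -
    have "N p - N p' = - (1 / a) *\<^sub>R (f p - f p' - a *\<^sub>R (p - p'))"
      using a by (simp add: N_def algebra_simps)
    then have "norm (N p - N p') = (1 / a) * norm (f p - f p' - a *\<^sub>R (p - p'))"
      using a by simp
    also have "\<dots> \<le> (1 / a) * (a / 2 * norm (p - p'))"
      using f that a by (intro mult_left_mono) (auto simp: near_scaling_on_def)
    finally show ?thesis using a by simp
  qed
  have p0: "p0 \<in> cball p0 \<rho>" using \<rho> by simp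
  have "\<exists>!p\<in>cball p0 \<rho>. N p = p"
  proof (rule Banach_fix[where c="1/2", OF compact_imp_complete[OF compact_cball]])
    show "N ` cball p0 \<rho> \<subseteq> cball p0 \<rho>"
    proof (rule image_subsetI)
      fix p assume p: "p \<in> cball p0 \<rho>"
      have "norm (N p - p0) \<le> norm (N p - N p0) + norm (N p0 - p0)"
        using norm_triangle_ineq[of "N p - N p0" "N p0 - p0"] by simp
      also have "norm (N p0 - p0) = (1 / a) * norm (y - f p0)" using a by (simp add: N_def)
      also have "\<dots> \<le> (1 / a) * (a * \<rho> / 2)" using a y by (intro mult_left_mono) auto
      also have "(1 / a) * (a * \<rho> / 2) = \<rho> / 2" using a by simp
      also have "norm (N p - N p0) \<le> 1 / 2 * \<rho>"
        using contr[OF p p0] p by (simp add: dist_norm norm_minus_commute)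
      finally show "N p \<in> cball p0 \<rho>" by (simp add: dist_norm norm_minus_commute)
    qed
  qed (use p0 contr in \<open>auto simp: dist_norm\<close>)
  then obtain p where "p \<in> cball p0 \<rho>" "N p = p" by blast
  then show ?thesis using a by (auto simp: N_def)
qed

text \<open>Disjoint balls inside \<open>S\<close> exhaust it up to a null set, so a comparison on
  balls can be summed.\<close>

lemma open_Vitali_le:
  fixes M :: "'a::euclidean_space measure"
  assumes sM: "sets M = sets borel" and O: "open S"
    and ball: "\<And>y r. 0 < r \<Longrightarrow> ball y r \<subseteq> S \<Longrightarrow> emeasure lborel (ball y r) \<le> c * emeasure M (ball y r)"
  shows "emeasure lborel S \<le> c * emeasure M S"
proof -
  note [simp] = sM
  define K where "K = {i :: 'a \<times> real. 0 < snd i \<and> ball (fst i) (snd i) \<subseteq> S}"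
  have "\<exists>i. i \<in> K \<and> x \<in> ball (fst i) (snd i) \<and> snd i < d" if x: "x \<in> S" and d: "0 < d" for x d
  proof -
    obtain e where e: "0 < e" "ball x e \<subseteq> S" using O x by (auto simp: open_contains_ball)
    define r where "r = min e (d / 2)"
    have "(x, r) \<in> K" using e d by (auto simp: K_def r_def)
    moreover have "x \<in> ball x r" "r < d" using e d by (auto simp: r_def)
    ultimately show ?thesis by (intro exI[of _ "(x, r)"]) simp
  qed
  then obtain C where C: "countable C" "C \<subseteq> K"
     "pairwise (\<lambda>i j. disjnt (ball (fst i) (snd i)) (ball (fst j) (snd j))) C"
     "negligible (S - (\<Union>i\<in>C. ball (fst i) (snd i)))"
    by (rule Vitali_covering_theorem_balls[of S K fst snd]) blast
  define B where "B i = ball (fst i) (snd i)" for i :: "'a \<times> real"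
  have Bsets: "B i \<in> sets borel" for i by (simp add: B_def)
  have disj: "disjoint_family_on B C"
    using C(3) by (auto simp: disjoint_family_on_def pairwise_def disjnt_def B_def)
  have UB: "(\<Union>i\<in>C. B i) \<in> sets borel" using C(1) Bsets by (intro sets.countable_UN') auto
  have Sb: "S \<in> sets borel" using O by simp
  have "S - (\<Union>i\<in>C. B i) \<in> null_sets lborel"
    using C(4) null_sets_completion_iff[of "S - (\<Union>i\<in>C. B i)" lborel] UB Sb
    by (simp add: B_def negligible_iff_null_sets)
  then have 0: "emeasure lborel (S - (\<Union>i\<in>C. B i)) = 0" by (rule null_setsD1)
  have "emeasure lborel S \<le> emeasure lborel ((S - (\<Union>i\<in>C. B i)) \<union> (\<Union>i\<in>C. B i))"
    by (intro emeasure_mono) (use Sb UB in auto)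
  also have "\<dots> \<le> emeasure lborel (S - (\<Union>i\<in>C. B i)) + emeasure lborel (\<Union>i\<in>C. B i)"
    by (intro emeasure_subadditive) (use Sb UB in auto)
  also have "\<dots> = emeasure lborel (\<Union>i\<in>C. B i)" by (simp add: 0)
  also have "\<dots> = (\<integral>\<^sup>+i. emeasure lborel (B i) \<partial>count_space C)"
    by (rule emeasure_UN_countable) (use C(1) disj Bsets in auto)
  also have "\<dots> \<le> (\<integral>\<^sup>+i. c * emeasure M (B i) \<partial>count_space C)"
    by (intro nn_integral_mono) (use C(2) in \<open>auto simp: B_def K_def intro!: ball\<close>)
  also have "\<dots> = c * (\<integral>\<^sup>+i. emeasure M (B i) \<partial>count_space C)" by (simp add: nn_integral_cmult)
  also have "(\<integral>\<^sup>+i. emeasure M (B i) \<partial>count_space C) = emeasure M (\<Union>i\<in>C. B i)"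
    by (rule emeasure_UN_countable[symmetric]) (use C(1) disj Bsets in auto)
  also have "\<dots> \<le> emeasure M S"
    by (intro emeasure_mono) (use C(2) Sb in \<open>auto simp: B_def K_def\<close>)
  finally show ?thesis by (simp add: mult_left_mono)
qed

text \<open>Only the crude comparison of volumes is needed, so a Vitali covering by balls replaces the
  change of variables formula.\<close>
lemma near_scaling_pullback:
  fixes f :: "'a::euclidean_space \<Rightarrow> 'a"
  assumes f: "near_scaling_on (cball p0 \<rho>) a f" and fm [measurable]: "f \<in> borel_measurable borel" and a: "0 < a"
    and y0: "norm (y0 - f p0) + 2 \<le> a * \<rho> / 2" and A [measurable]: "A \<in> sets borel"
  shows "emeasure lborel (A \<inter> ball y0 1) \<le> ennreal ((2 * a) ^ DIM('a)) * emeasure lborel (f -` A \<inter> cball p0 \<rho>)"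
proof -
  define M where "M = distr (density lborel (indicator (cball p0 \<rho>))) borel f"
  have sM [simp]: "sets M = sets borel" by (simp add: M_def)
  have M: "emeasure M B = emeasure lborel (f -` B \<inter> cball p0 \<rho>)" if [measurable]: "B \<in> sets borel" for B
  proof -
    have [measurable]: "f -` B \<in> sets borel" using measurable_sets_borel[OF fm that] .
    have "emeasure M B = emeasure (density lborel (indicator (cball p0 \<rho>))) (f -` B)"
      unfolding M_def by (subst emeasure_distr) auto
    also have "\<dots> = (\<integral>\<^sup>+x. indicator (cball p0 \<rho>) x * indicator (f -` B) x \<partial>lborel)"
      by (rule emeasure_density) (auto intro!: borel_measurable_indicator)
    also have "\<dots> = (\<integral>\<^sup>+x. indicator (f -` B \<inter> cball p0 \<rho>) x \<partial>lborel)"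
      by (intro nn_integral_cong) (auto simp: indicator_def)
    also have "\<dots> = emeasure lborel (f -` B \<inter> cball p0 \<rho>)" by (rule nn_integral_indicator) simp
    finally show ?thesis .
  qed
  have fin: "emeasure M (space M) \<noteq> \<infinity>"
    using sets_eq_imp_space_eq[OF sM] emeasure_lborel_cball_finite[of p0 \<rho>] by (auto simp: M)
  have ball: "emeasure lborel (ball y r) \<le> ennreal ((2 * a) ^ DIM('a)) * emeasure M (ball y r)"
    if r: "0 < r" and sub: "ball y r \<subseteq> ball y0 1" for y r
  proof -
    have yr: "dist y y0 + r \<le> 1" using sub r by (simp add: ball_subset_ball_iff)
    \<comment> \<open>The preimage is sought in a slightly smaller ball, so that a ball of radius
      \<open>r / (2 * a)\<close> about it still fits into \<open>cball p0 \<rho>\<close>. This costs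
      \<open>1 / 4\<close> of the margin 2 in \<open>y0\<close>.\<close>
    define \<rho>' where "\<rho>' = \<rho> - 1 / (2 * a)"
    have a\<rho>: "a * \<rho>' / 2 = a * \<rho> / 2 - 1 / 4" using a by (simp add: \<rho>'_def field_simps)
    have "norm (y - f p0) \<le> norm (y - y0) + norm (y0 - f p0)"
      using norm_triangle_ineq[of "y - y0" "y0 - f p0"] by simp
    then have le: "norm (y - f p0) \<le> a * \<rho>' / 2"
      unfolding a\<rho> using y0 yr r by (simp add: dist_norm)
    have "0 \<le> a * \<rho>' / 2" using le norm_ge_zero[of "y - f p0"] by linarith
    then have \<rho>': "0 \<le> \<rho>'" using a by (simp add: zero_le_mult_iff)
    have sub': "cball p0 \<rho>' \<subseteq> cball p0 \<rho>" using a by (intro cball_subset_cball_iff[THEN iffD2]) (simp add: \<rho>'_def)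
    obtain p where p: "p \<in> cball p0 \<rho>'" "f p = y"
      using near_scaling_covers[OF near_scaling_on_subset[OF f sub'] a \<rho>' le] by blast
    \<comment> \<open>\<open>f\<close> expands distances by at most \<open>3 / 2 * a\<close>, so the
      image of this ball lies within \<open>3 / 4 * r\<close> of \<open>y\<close>. The ratio of the
      two radii produces the factor \<open>(2 * a) ^ DIM('a)\<close>.\<close>
    have "ball p (r / (2 * a)) \<subseteq> f -` ball y r \<inter> cball p0 \<rho>"
    proof
      fix p' assume p': "p' \<in> ball p (r / (2 * a))"
      have d: "norm (p' - p) < r / (2 * a)" using p' by (simp add: dist_norm norm_minus_commute)
      have "r \<le> 1" using yr zero_le_dist[of y y0] by linarith
      then have "r / (2 * a) \<le> 1 / (2 * a)" using a by (intro divide_right_mono) auto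
      then have "norm (p' - p) \<le> 1 / (2 * a)" using d by linarith
      moreover have "norm (p - p0) \<le> \<rho>'" using p by (simp add: dist_norm norm_minus_commute)
      moreover have "norm (p' - p0) \<le> norm (p' - p) + norm (p - p0)"
        using norm_triangle_ineq[of "p' - p" "p - p0"] by simp
      ultimately have "norm (p' - p0) \<le> \<rho>" unfolding \<rho>'_def by linarith
      then have p'B: "p' \<in> cball p0 \<rho>" by (simp add: dist_norm norm_minus_commute)
      have "norm (f p' - f p - a *\<^sub>R (p' - p)) \<le> a / 2 * norm (p' - p)"
        using f p'B p(1) sub' by (auto simp: near_scaling_on_def)
      moreover have "norm (f p' - f p) \<le> norm (f p' - f p - a *\<^sub>R (p' - p)) + norm (a *\<^sub>R (p' - p))"
        using norm_triangle_ineq[of "f p' - f p - a *\<^sub>R (p' - p)" "a *\<^sub>R (p' - p)"] by simp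
      ultimately have "norm (f p' - f p) \<le> 3 / 2 * (a * norm (p' - p))" using a by simp
      also have "\<dots> < 2 * (r / 2)"
      proof -
        have "a * norm (p' - p) < r / 2" using d a by (simp add: field_simps)
        then show ?thesis using r by linarith
      qed
      finally show "p' \<in> f -` ball y r \<inter> cball p0 \<rho>" using p'B p(2) by (simp add: dist_norm norm_minus_commute)
    qed
    then have "emeasure lborel (ball p (r / (2 * a))) \<le> emeasure M (ball y r)"
      unfolding M[OF borel_open[OF open_ball]] using measurable_sets_borel[OF fm, of "ball y r"] by (intro emeasure_mono) auto
    then have "ennreal ((2 * a) ^ DIM('a)) * emeasure lborel (ball p (r / (2 * a))) \<le> ennreal ((2 * a) ^ DIM('a)) * emeasure M (ball y r)"
      by (rule mult_left_mono) simp
    moreover have "ennreal ((2 * a) ^ DIM('a)) * emeasure lborel (ball p (r / (2 * a))) = emeasure lborel (ball y r)"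
      using r a by (simp add: emeasure_ball ennreal_mult[symmetric] power_divide)
    ultimately show ?thesis by simp
  qed
  define A' where "A' = A \<inter> ball y0 1"
  have A' [measurable]: "A' \<in> sets borel" by (simp add: A'_def)
  have "emeasure lborel A' \<le> ennreal ((2 * a) ^ DIM('a)) * emeasure M S" if S: "A' \<subseteq> S" "open S" for S
  proof -
    have "emeasure lborel A' \<le> emeasure lborel (S \<inter> ball y0 1)"
      using S by (intro emeasure_mono) (auto simp: A'_def)
    also have "\<dots> \<le> ennreal ((2 * a) ^ DIM('a)) * emeasure M (S \<inter> ball y0 1)"
      by (rule open_Vitali_le[OF sM]) (use S ball in auto)
    also have "\<dots> \<le> ennreal ((2 * a) ^ DIM('a)) * emeasure M S"
      using S by (intro mult_left_mono emeasure_mono) auto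
    finally show ?thesis .
  qed
  then have le: "emeasure lborel A' / ennreal ((2 * a) ^ DIM('a)) \<le> emeasure M S" if "A' \<subseteq> S" "open S" for S
    using that a by (simp add: divide_le_posI_ennreal)
  \<comment> \<open>Outer regularity of the finite measure \<open>M\<close> extends the comparison
    from open to Borel sets.\<close>
  have "emeasure lborel A' / ennreal ((2 * a) ^ DIM('a)) \<le> emeasure M A'"
    unfolding outer_regular[OF sM fin A'] by (rule INF_greatest) (use le in auto)
  then have "ennreal ((2 * a) ^ DIM('a)) * (emeasure lborel A' / ennreal ((2 * a) ^ DIM('a))) \<le> ennreal ((2 * a) ^ DIM('a)) * emeasure M A'"
    by (rule mult_left_mono) simp
  moreover have "c * (x / c) = x" if "c \<noteq> 0" "c \<noteq> top" for c x :: ennreal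
    using mult_divide_eq_ennreal[OF that, of x] by (simp add: ennreal_times_divide mult.commute)
  ultimately have "emeasure lborel A' \<le> ennreal ((2 * a) ^ DIM('a)) * emeasure M A'"
    using a by simp
  also have "\<dots> \<le> ennreal ((2 * a) ^ DIM('a)) * emeasure M A"
    by (intro mult_left_mono emeasure_mono) (auto simp: A'_def)
  finally show ?thesis by (simp add: A'_def M)
qed

section \<open>Minorization on balls\<close>

fun lip_const :: "nat \<Rightarrow> real" where
  "lip_const 0 = 0"
| "lip_const (Suc k) = 3 * lip_const k + 2 * real k + 1"

lemma lip_const_nonneg: "0 \<le> lip_const k"
  by (induction k) auto

text \<open>Two trajectories from the same position separate like free flights, up to a relative
  error \<open>\<eta>\<close>. The Lipschitz estimate is asked only for \<open>k \<ge> 1\<close>,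
  because the positions agree at time 0; hence \<open>q\<close> itself may lie where the Hessian is
  large.\<close>

lemma traj_difference:
  fixes g :: "'a::euclidean_space \<Rightarrow> 'a"
  assumes h: "0 < h" and \<eta>: "0 \<le> \<eta>" "\<eta> \<le> 1" and \<epsilon>: "0 \<le> \<epsilon>" "h\<^sup>2 * \<epsilon> \<le> \<eta>"
    and lip: "\<And>k. 1 \<le> k \<Longrightarrow> k \<le> n \<Longrightarrow>
      norm (g (traj_pos h g q p k) - g (traj_pos h g q p' k)) \<le> \<epsilon> * norm (traj_pos h g q p k - traj_pos h g q p' k)"
    and k: "k \<le> n"
  shows "norm (traj_pos h g q p k - traj_pos h g q p' k - (real k * h) *\<^sub>R (p - p')) \<le> h * (lip_const k * \<eta> * norm (p - p')) \<and>
    norm (traj_mom h g q p k - traj_mom h g q p' k - (p - p')) \<le> lip_const k * \<eta> * norm (p - p')"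
  using k
proof (induction k)
  case 0
  then show ?case by simp
next
  case (Suc k)
  define c where "c = lip_const k"
  have c: "0 \<le> c" unfolding c_def by (rule lip_const_nonneg)
  define d where "d = p - p'"
  define \<delta> where "\<delta> = norm d"
  define X Y P where "X = traj_pos h g q p k - traj_pos h g q p' k"
    and "Y = traj_pos h g q p (Suc k) - traj_pos h g q p' (Suc k)"
    and "P = traj_mom h g q p k - traj_mom h g q p' k"
  define a b where "a = g (traj_pos h g q p k) - g (traj_pos h g q p' k)"
    and "b = g (traj_pos h g q p (Suc k)) - g (traj_pos h g q p' (Suc k))"
  have IH: "norm (X - (real k * h) *\<^sub>R d) \<le> h * (c * \<eta> * \<delta>)" "norm (P - d) \<le> c * \<eta> * \<delta>"
    using Suc by (auto simp: X_def P_def d_def c_def \<delta>_def)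
  have \<eta>\<delta>: "0 \<le> \<eta> * \<delta>" "\<eta> * \<delta> \<le> \<delta>" using \<eta> by (auto simp: \<delta>_def mult_left_le_one_le)
  have size: "norm Z \<le> h * ((real j + B) * \<delta>)" if "norm (Z - (real j * h) *\<^sub>R d) \<le> h * (B * \<eta> * \<delta>)" "0 \<le> B" for Z j B
  proof -
    have "norm Z \<le> norm (Z - (real j * h) *\<^sub>R d) + norm ((real j * h) *\<^sub>R d)"
      using norm_triangle_ineq[of "Z - (real j * h) *\<^sub>R d" "(real j * h) *\<^sub>R d"] by simp
    also have "norm ((real j * h) *\<^sub>R d) = h * (real j * \<delta>)" using h by (simp add: \<delta>_def)
    also have "norm (Z - (real j * h) *\<^sub>R d) \<le> h * (B * \<delta>)"
      using that \<eta>\<delta> h mult_left_mono[OF \<eta>\<delta>(2), of B] by (smt (verit) mult.assoc mult_left_mono)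
    finally show ?thesis by (simp add: algebra_simps)
  qed
  have force: "norm (h *\<^sub>R v) \<le> (B * \<eta> * \<delta>)" if "norm v \<le> \<epsilon> * norm Z" "norm Z \<le> h * (B * \<delta>)" "0 \<le> B" for v Z B
  proof -
    have "norm (h *\<^sub>R v) \<le> h * (\<epsilon> * (h * (B * \<delta>)))"
      using h that \<epsilon> by (simp, intro order_trans[OF that(1)] mult_left_mono) auto
    also have "\<dots> = (h\<^sup>2 * \<epsilon>) * (B * \<delta>)" by (simp add: power2_eq_square)
    also have "\<dots> \<le> \<eta> * (B * \<delta>)" using that \<epsilon> by (intro mult_right_mono) (auto simp: \<delta>_def)
    finally show ?thesis by (simp add: mult_ac)
  qed
  have X: "norm X \<le> h * ((real k + c) * \<delta>)" by (rule size[OF IH(1) c])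
  have a: "norm (h *\<^sub>R a) \<le> (real k + c) * \<eta> * \<delta>"
  \<comment> \<open>At the common starting point the two kicks coincide, so
    \<open>a = 0\<close>.\<close>
  proof (cases "k = 0")
    case True
    then show ?thesis using c \<eta>\<delta> by (simp add: a_def mult.assoc)
  next
    case False
    have "norm a \<le> \<epsilon> * norm X" unfolding a_def X_def by (rule lip) (use False Suc.prems in auto)
    then show ?thesis by (rule force[OF _ X]) (use c in simp)
  qed
  have Ysplit: "Y - (real (Suc k) * h) *\<^sub>R d = (X - (real k * h) *\<^sub>R d) + h *\<^sub>R (P - d) - (h / 2) *\<^sub>R (h *\<^sub>R a)"
    by (simp add: Y_def traj_pos_Suc X_def P_def a_def algebra_simps power2_eq_square)
  have tri: "norm (u + v - w) \<le> norm u + norm v + norm w" for u v w :: 'a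
    using norm_triangle_ineq4[of "u + v" w] norm_triangle_ineq[of u v] by linarith
  have "norm (Y - (real (Suc k) * h) *\<^sub>R d) \<le> h * (c * \<eta> * \<delta>) + h * (c * \<eta> * \<delta>) + (h / 2) * ((real k + c) * \<eta> * \<delta>)"
    unfolding Ysplit
  proof (rule order_trans[OF tri], intro add_mono)
    show "norm (h *\<^sub>R (P - d)) \<le> h * (c * \<eta> * \<delta>)" using h IH(2) by simp
    show "norm ((h / 2) *\<^sub>R h *\<^sub>R a) \<le> h / 2 * ((real k + c) * \<eta> * \<delta>)"
      unfolding norm_scaleR[of "h / 2"] using h by (intro mult_mono a) auto
  qed (rule IH)
  also have "\<dots> = h * ((5 / 2 * c + real k / 2) * (\<eta> * \<delta>))" by (simp add: algebra_simps)
  also have "\<dots> \<le> h * ((3 * c + real k) * (\<eta> * \<delta>))" using c h \<eta>\<delta> by (intro mult_left_mono mult_right_mono) auto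
  finally have Y1: "norm (Y - (real (Suc k) * h) *\<^sub>R d) \<le> h * ((3 * c + real k) * \<eta> * \<delta>)" by (simp add: mult.assoc)
  have Y: "norm Y \<le> h * ((real (Suc k) + (3 * c + real k)) * \<delta>)" by (rule size[OF Y1]) (use c in simp)
  have b: "norm (h *\<^sub>R b) \<le> (real (Suc k) + (3 * c + real k)) * \<eta> * \<delta>"
  proof (rule force[OF _ Y])
    show "norm b \<le> \<epsilon> * norm Y" unfolding b_def Y_def by (rule lip) (use Suc.prems in auto)
  qed (use c in simp)
  have Psplit: "traj_mom h g q p (Suc k) - traj_mom h g q p' (Suc k) - d = (P - d) + - ((1/2) *\<^sub>R (h *\<^sub>R a)) - (1/2) *\<^sub>R (h *\<^sub>R b)"
    by (simp add: traj_mom_Suc P_def a_def b_def algebra_simps)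
  have "norm (traj_mom h g q p (Suc k) - traj_mom h g q p' (Suc k) - d)
      \<le> c * \<eta> * \<delta> + (1/2) * ((real k + c) * \<eta> * \<delta>) + (1/2) * ((real (Suc k) + (3 * c + real k)) * \<eta> * \<delta>)"
    unfolding Psplit
  proof (rule order_trans[OF tri], intro add_mono)
    show "norm (- ((1/2) *\<^sub>R h *\<^sub>R a)) \<le> (1/2) * ((real k + c) * \<eta> * \<delta>)"
      unfolding norm_minus_cancel norm_scaleR[of "1/2"] by (intro mult_mono a) auto
    show "norm ((1/2) *\<^sub>R h *\<^sub>R b) \<le> (1/2) * ((real (Suc k) + (3 * c + real k)) * \<eta> * \<delta>)"
      unfolding norm_scaleR[of "1/2"] by (intro mult_mono b) auto
  qed (rule IH)
  also have "\<dots> = (3 * c + 3 / 2 * real k + 1 / 2) * (\<eta> * \<delta>)" by (simp add: algebra_simps)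
  also have "\<dots> \<le> (3 * c + 2 * real k + 1) * (\<eta> * \<delta>)" using \<eta>\<delta> by (intro mult_right_mono) auto
  finally have P1: "norm (traj_mom h g q p (Suc k) - traj_mom h g q p' (Suc k) - d) \<le> lip_const (Suc k) * \<eta> * \<delta>"
    by (simp add: c_def mult.assoc)
  have "h * ((3 * c + real k) * (\<eta> * \<delta>)) \<le> h * ((3 * c + 2 * real k + 1) * (\<eta> * \<delta>))"
    using h \<eta>\<delta> by (intro mult_left_mono mult_right_mono) auto
  then have Y2: "norm (Y - (real (Suc k) * h) *\<^sub>R d) \<le> h * (lip_const (Suc k) * \<eta> * \<delta>)"
    using Y1 by (simp add: c_def mult.assoc)
  show ?case using P1 Y2 by (simp add: Y_def d_def \<delta>_def)
qed

lemma traj_free_flight: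
  fixes g :: "'a::euclidean_space \<Rightarrow> 'a"
  assumes h: "0 < h" and B: "\<And>j. j \<le> n \<Longrightarrow> norm (g (traj_pos h g q p j)) \<le> \<beta>" and k: "k \<le> n"
  shows "norm (traj_pos h g q p k - q - (real k * h) *\<^sub>R p) \<le> (real k)\<^sup>2 * h\<^sup>2 * \<beta> \<and>
    norm (traj_mom h g q p k - p) \<le> real k * h * \<beta>"
  using k
proof (induction k)
  case 0
  then show ?case by simp
next
  case (Suc k)
  have b0: "0 \<le> \<beta>" using B[of 0] norm_ge_zero[of "g q"] by auto (smt (verit) norm_ge_zero)
  define x y P where "x = traj_pos h g q p k" and "y = traj_pos h g q p (Suc k)" and "P = traj_mom h g q p k"
  have IH: "norm (x - q - (real k * h) *\<^sub>R p) \<le> (real k)\<^sup>2 * h\<^sup>2 * \<beta>" "norm (P - p) \<le> real k * h * \<beta>"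
    using Suc by (auto simp: x_def P_def)
  have gb: "norm (g x) \<le> \<beta>" "norm (g y) \<le> \<beta>" using B[of k] B[of "Suc k"] Suc.prems by (auto simp: x_def y_def)
  have tri: "norm (u + v - w) \<le> norm u + norm v + norm w" for u v w :: 'a
    using norm_triangle_ineq4[of "u + v" w] norm_triangle_ineq[of u v] by linarith
  have "y - q - (real (Suc k) * h) *\<^sub>R p = (x - q - (real k * h) *\<^sub>R p) + h *\<^sub>R (P - p) - (h\<^sup>2 / 2) *\<^sub>R g x"
    by (simp add: y_def traj_pos_Suc x_def P_def algebra_simps)
  then have "norm (y - q - (real (Suc k) * h) *\<^sub>R p) \<le> norm (x - q - (real k * h) *\<^sub>R p) + norm (h *\<^sub>R (P - p)) + norm ((h\<^sup>2 / 2) *\<^sub>R g x)"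
    by (simp only: tri)
  also have "\<dots> \<le> (real k)\<^sup>2 * h\<^sup>2 * \<beta> + h * (real k * h * \<beta>) + (h\<^sup>2 / 2) * \<beta>"
  proof (intro add_mono IH)
    show "norm (h *\<^sub>R (P - p)) \<le> h * (real k * h * \<beta>)" using h IH(2) by simp
    show "norm ((h\<^sup>2 / 2) *\<^sub>R g x) \<le> h\<^sup>2 / 2 * \<beta>" unfolding norm_scaleR by (intro mult_mono gb) auto
  qed
  also have "\<dots> = ((real k)\<^sup>2 + real k + 1 / 2) * (h\<^sup>2 * \<beta>)" by (simp add: algebra_simps power2_eq_square)
  also have "\<dots> \<le> (real (Suc k))\<^sup>2 * (h\<^sup>2 * \<beta>)"
    using b0 by (intro mult_right_mono) (auto simp: power2_eq_square algebra_simps)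
  finally have 1: "norm (y - q - (real (Suc k) * h) *\<^sub>R p) \<le> (real (Suc k))\<^sup>2 * h\<^sup>2 * \<beta>" by (simp only: mult.assoc)
  have "norm (traj_mom h g q p (Suc k) - p) = norm ((P - p) - (h / 2) *\<^sub>R (g x + g y))"
    by (simp add: traj_mom_Suc x_def y_def P_def algebra_simps)
  also have "\<dots> \<le> norm (P - p) + norm ((h / 2) *\<^sub>R (g x + g y))" by (rule norm_triangle_ineq4)
  also have "\<dots> \<le> real k * h * \<beta> + (h / 2) * (\<beta> + \<beta>)"
  proof (intro add_mono IH)
    show "norm ((h / 2) *\<^sub>R (g x + g y)) \<le> h / 2 * (\<beta> + \<beta>)" unfolding norm_scaleR
      using h by (intro mult_mono order_trans[OF norm_triangle_ineq add_mono[OF gb]]) auto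
  qed
  also have "\<dots> = real (Suc k) * h * \<beta>" by (simp add: algebra_simps)
  finally have 2: "norm (traj_mom h g q p (Suc k) - p) \<le> real (Suc k) * h * \<beta>" .
  show ?case using 1 2 by (simp add: y_def)
qed

text \<open>Chosen so that the accumulated error is at most half of the free-flight factor
  \<open>n\<close>, as \<open>near_scaling_on\<close> requires.\<close>

definition lip_tol :: "nat \<Rightarrow> real" where "lip_tol n = min 1 (real n / (2 * (lip_const n + 1)))"

lemma lip_tol:
  assumes "1 \<le> n"
  shows "0 < lip_tol n" "lip_tol n \<le> 1" "lip_const n * lip_tol n \<le> real n / 2"
proof -
  have c: "0 < lip_const n + 1" using lip_const_nonneg[of n] by simp
  show "0 < lip_tol n" "lip_tol n \<le> 1" using assms c by (auto simp: lip_tol_def)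
  have "lip_tol n \<le> real n / (2 * (lip_const n + 1))" by (simp add: lip_tol_def)
  moreover have "0 < 2 * (lip_const n + 1)" using c by simp
  ultimately have "lip_tol n * (2 * (lip_const n + 1)) \<le> real n" by (simp only: pos_le_divide_eq)
  then show "lip_const n * lip_tol n \<le> real n / 2" using \<open>0 < lip_tol n\<close> by (simp add: algebra_simps)
qed

context hmc_potential
begin

lemma prop_pos_near_scaling:
  assumes \<epsilon>: "0 \<le> \<epsilon>" "h\<^sup>2 * \<epsilon> \<le> lip_tol T"
    and lip: "\<And>k p p'. 1 \<le> k \<Longrightarrow> k \<le> T \<Longrightarrow> p \<in> B \<Longrightarrow> p' \<in> B \<Longrightarrow>
      norm (gU (traj_pos h gU q p k) - gU (traj_pos h gU q p' k)) \<le> \<epsilon> * norm (traj_pos h gU q p k - traj_pos h gU q p' k)"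
  shows "near_scaling_on B (real T * h) (prop_pos q)"
  unfolding near_scaling_on_def
proof (intro ballI)
  fix p p' assume pB: "p \<in> B" "p' \<in> B"
  have "norm (prop_pos q p - prop_pos q p' - (real T * h) *\<^sub>R (p - p')) \<le> h * (lip_const T * lip_tol T * norm (p - p'))"
    using traj_difference[OF h less_imp_le[OF lip_tol(1)[OF T]] lip_tol(2)[OF T] \<epsilon>, of T gU q p p' T] lip pB by (simp add: prop_pos_eq_traj)
  also have "\<dots> \<le> h * (real T / 2 * norm (p - p'))"
    using h lip_tol(3)[OF T] by (intro mult_left_mono mult_right_mono) auto
  finally show "norm (prop_pos q p - prop_pos q p' - (real T * h) *\<^sub>R (p - p')) \<le> real T * h / 2 * norm (p - p')"
    by (simp add: mult_ac)
qed

text \<open>The same \<open>p0\<close>, \<open>\<rho>\<close> and \<open>y0\<close> must serve all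
  \<open>q\<close> in the ball, since the minorizing measure may not depend on \<open>q\<close>. The
  margin 2 covers the unit ball about \<open>y0\<close> and the shrinking of the momentum
  ball.\<close>

definition uniformly_near_scaling :: "real \<Rightarrow> bool" where
  "uniformly_near_scaling r \<longleftrightarrow> (\<exists>p0 \<rho> y0. \<forall>q. norm q \<le> r \<longrightarrow>
     near_scaling_on (cball p0 \<rho>) (real T * h) (prop_pos q) \<and> norm (y0 - prop_pos q p0) + 2 \<le> real T * h * \<rho> / 2)"

lemma gU_affine_bound: "norm (gU q) \<le> norm (gU 0) + A1 * norm q"
  using gU_lipschitz[of q 0] norm_triangle_sub[of "gU q" "gU 0"] by simp

text \<open>The global Lipschitz constant gives the estimate on every momentum ball, so the ball is
  centred at 0 and its radius is taken so large that 0 is a reachable target from all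
  \<open>q\<close>.\<close>

lemma uniformly_near_scaling_small_step:
  assumes "h\<^sup>2 * A1 \<le> lip_tol T"
  shows "uniformly_near_scaling r"
proof -
  obtain C where C: "0 \<le> C" and move: "\<And>q p. norm (prop_pos q p - q) \<le> C * (norm (gU q) + norm p)"
    by (rule prop_pos_linear_bound) blast
  define a where "a = real T * h"
  have a: "0 < a" using T h by (simp add: a_def)
  define b where "b = r + C * (norm (gU 0) + A1 * r)"
  define \<rho> where "\<rho> = 2 * (b + 2) / a"
  have "near_scaling_on (cball 0 \<rho>) a (prop_pos q) \<and> norm (0 - prop_pos q 0) + 2 \<le> a * \<rho> / 2" if q: "norm q \<le> r" for q
  proof
    show "near_scaling_on (cball 0 \<rho>) a (prop_pos q)"
      unfolding a_def by (rule prop_pos_near_scaling[OF A1 assms]) (rule gU_lipschitz)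
    have "norm (gU q) \<le> norm (gU 0) + A1 * r"
      using gU_affine_bound[of q] mult_left_mono[OF q A1] by linarith
    then have "C * (norm (gU q) + norm (0::'a)) \<le> C * (norm (gU 0) + A1 * r)" using C by (intro mult_left_mono) auto
    moreover have "norm (prop_pos q 0) \<le> norm q + norm (prop_pos q 0 - q)"
      using norm_triangle_sub[of "prop_pos q 0" q] by simp
    ultimately have "norm (prop_pos q 0) \<le> b" using move[of q 0] q unfolding b_def by linarith
    then show "norm (0 - prop_pos q 0) + 2 \<le> a * \<rho> / 2" using a by (simp add: \<rho>_def)
  qed
  then show ?thesis unfolding uniformly_near_scaling_def a_def by blast
qed

text \<open>For \<open>m < 2\<close> and a large momentum \<open>p0\<close> every point of the trajectory after the first is far from the
  origin, where the Hessian is small, so the proposal is close to free flight whatever the step size.\<close>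
lemma uniformly_near_scaling_subquadratic:
  assumes m2: "m < 2" and r: "0 \<le> r"
  shows "uniformly_near_scaling r"
proof -
  have "\<forall>k. \<exists>c\<ge>0. \<forall>q p. norm (traj_pos h gU q p k - q) \<le> c * (norm (gU q) + norm p)"
  proof
    fix k
    obtain c where "0 \<le> c" "\<forall>q p. norm (traj_pos h gU q p k - q) \<le> c * (norm (gU q) + norm p) \<and> norm (traj_mom h gU q p k) \<le> c * (norm (gU q) + norm p)"
      using traj_linear_bound[OF h A1 gU_lipschitz, of k] by blast
    then show "\<exists>c\<ge>0. \<forall>q p. norm (traj_pos h gU q p k - q) \<le> c * (norm (gU q) + norm p)"
      by (intro exI[of _ c]) simp
  qed
  then obtain c where c: "\<forall>k. 0 \<le> c k \<and> (\<forall>q p. norm (traj_pos h gU q p k - q) \<le> c k * (norm (gU q) + norm p))"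
    by (rule choice[THEN exE])
  define C where "C = (\<Sum>k\<le>T. c k)"
  have C: "0 \<le> C" unfolding C_def using c by (intro sum_nonneg) simp
  have move: "norm (traj_pos h gU q p k - q) \<le> C * (norm (gU q) + norm p)" if "k \<le> T" for k q p
  proof -
    have "c k \<le> C" unfolding C_def using c that by (intro member_le_sum) auto
    then have "c k * (norm (gU q) + norm p) \<le> C * (norm (gU q) + norm p)" by (intro mult_right_mono) auto
    then show ?thesis using c by (meson order_trans)
  qed
  define g0 where "g0 = norm (gU 0)"
  have g0: "0 \<le> g0" by (simp add: g0_def)
  \<comment> \<open>Positions up to time \<open>T\<close> have \<open>norm x + 1 \<le> b * N\<close>
    when \<open>norm p \<le> 2 * N\<close>; the gradients there are then at most
    \<open>b' * N powr (m - 1)\<close>.\<close>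
  define b where "b = r + C * (g0 + A1 * r + 2) + 1"
  have b: "1 \<le> b" using r C A1 g0 by (simp add: b_def)
  define b' where "b' = g0 + A1 / (m - 1) * b powr (m - 1)"
  have b': "0 \<le> b'" using g0 A1 m by (simp add: b'_def)
  define t where "t = real T"
  have t: "1 \<le> t" using T by (simp add: t_def)
  \<comment> \<open>The place where \<open>m < 2\<close> enters: \<open>N\<close> is chosen after
    \<open>h\<close>, so the step size is unrestricted.\<close>
  have lim0: "((\<lambda>N. N powr (m - 2)) \<longlongrightarrow> 0) at_top"
    by (rule tendsto_neg_powr[OF _ filterlim_ident]) (use m2 in simp)
  have lim1: "((\<lambda>N. t\<^sup>2 * h\<^sup>2 * b' * N powr (m - 2)) \<longlongrightarrow> 0) at_top"
    by (rule tendsto_mult_right_zero[OF lim0])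
  have lim2: "((\<lambda>N. h\<^sup>2 * A1 * (h / 4) powr (m - 2) * N powr (m - 2)) \<longlongrightarrow> 0) at_top"
    by (rule tendsto_mult_right_zero[OF lim0])
  have "eventually (\<lambda>N. t\<^sup>2 * h\<^sup>2 * b' * N powr (m - 2) < h / 8) at_top"
    by (rule order_tendstoD(2)[OF lim1]) (use h in simp)
  moreover have "eventually (\<lambda>N. h\<^sup>2 * A1 * (h / 4) powr (m - 2) * N powr (m - 2) < lip_tol T) at_top"
    by (rule order_tendstoD(2)[OF lim2 lip_tol(1)[OF T]])
  moreover have "eventually (\<lambda>N::real. max 1 (8 * (r + 2) / h) \<le> N) at_top" by (rule eventually_ge_at_top)
  ultimately have "eventually (\<lambda>N. t\<^sup>2 * h\<^sup>2 * b' * N powr (m - 2) < h / 8 \<and> h\<^sup>2 * A1 * (h / 4) powr (m - 2) * N powr (m - 2) < lip_tol T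
      \<and> max 1 (8 * (r + 2) / h) \<le> N) at_top" by eventually_elim simp
  then obtain N0 where N0: "t\<^sup>2 * h\<^sup>2 * b' * N0 powr (m - 2) < h / 8 \<and> h\<^sup>2 * A1 * (h / 4) powr (m - 2) * N0 powr (m - 2) < lip_tol T
      \<and> max 1 (8 * (r + 2) / h) \<le> N0"
    using eventually_happens'[OF trivial_limit_at_top_linorder] by blast
  then obtain N where N: "t\<^sup>2 * h\<^sup>2 * b' * N powr (m - 2) < h / 8" "h\<^sup>2 * A1 * (h / 4) powr (m - 2) * N powr (m - 2) < lip_tol T"
      "1 \<le> N" "8 * (r + 2) / h \<le> N"
    by (intro that[of N0]) auto
  have "8 * (r + 2) \<le> N * h" using N(4) h by (simp only: pos_divide_le_eq)
  moreover have "t\<^sup>2 * h\<^sup>2 * b' * N powr (m - 1) \<le> h * N / 8"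
  proof -
    have "N powr (m - 1) = N powr ((m - 2) + 1)" by simp
    then have "N powr (m - 1) = N powr (m - 2) * N" unfolding powr_add using N(3) by simp
    then show ?thesis using mult_right_mono[OF less_imp_le[OF N(1)], of N] N(3) by (simp add: mult_ac)
  qed
  ultimately have drift: "r + 2 + t\<^sup>2 * h\<^sup>2 * (b' * N powr (m - 1)) \<le> h * N / 4" by (simp add: mult_ac)
  define \<epsilon> where "\<epsilon> = A1 * (h * N / 4) powr (m - 2)"
  have \<epsilon>: "0 \<le> \<epsilon>" "h\<^sup>2 * \<epsilon> \<le> lip_tol T"
  proof -
    show "0 \<le> \<epsilon>" using A1 by (simp add: \<epsilon>_def)
    have "(h * N / 4) powr (m - 2) = (h / 4) powr (m - 2) * N powr (m - 2)"
      using h N(3) powr_mult[of "h / 4" N "m - 2"] by (simp add: mult_ac)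
    then show "h\<^sup>2 * \<epsilon> \<le> lip_tol T" using N(2) by (simp add: \<epsilon>_def mult_ac)
  qed
  obtain e :: 'a where e: "e \<in> Basis" using nonempty_Basis by blast
  define p0 where "p0 = N *\<^sub>R e"
  have p0: "norm p0 = N" using e N(3) by (simp add: p0_def)
  have flight: "norm (traj_pos h gU q p k - (real k * h) *\<^sub>R p) \<le> r + t\<^sup>2 * h\<^sup>2 * (b' * N powr (m - 1))"
    if q: "norm q \<le> r" and p: "p \<in> cball p0 (N / 2)" and k: "k \<le> T" for q p k
  proof -
    have np: "norm p \<le> 2 * N"
      using p p0 norm_triangle_sub[of p p0] N(3) by (simp add: dist_norm norm_minus_commute)
    have grad: "norm (gU (traj_pos h gU q p j)) \<le> b' * N powr (m - 1)" if j: "j \<le> T" for j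
    proof -
      have "norm (gU q) \<le> g0 + A1 * r"
        using gU_affine_bound[of q] mult_left_mono[OF q A1] unfolding g0_def by linarith
      moreover have "(g0 + A1 * r) * 1 \<le> (g0 + A1 * r) * N"
        using N(3) g0 A1 r by (intro mult_left_mono) auto
      ultimately have "norm (gU q) + norm p \<le> (g0 + A1 * r) * N + 2 * N" using np by simp
      also have "\<dots> = (g0 + A1 * r + 2) * N" by (simp add: algebra_simps)
      finally have "C * (norm (gU q) + norm p) \<le> C * ((g0 + A1 * r + 2) * N)" using C by (rule mult_left_mono)
      then have "norm (traj_pos h gU q p j) \<le> r + C * ((g0 + A1 * r + 2) * N)"
        using move[OF j, of q p] norm_triangle_sub[of "traj_pos h gU q p j" q] q by linarith
      moreover have "(r + 1) * 1 \<le> (r + 1) * N" using N(3) r by (intro mult_left_mono) auto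
      ultimately have "norm (traj_pos h gU q p j) + 1 \<le> b * N" by (simp add: b_def algebra_simps)
      then have "(norm (traj_pos h gU q p j) + 1) powr (m - 1) \<le> (b * N) powr (m - 1)"
        using m by (intro powr_mono2) auto
      also have "\<dots> = b powr (m - 1) * N powr (m - 1)" by (simp add: powr_mult)
      finally have "A1 / (m - 1) * (norm (traj_pos h gU q p j) + 1) powr (m - 1) \<le> A1 / (m - 1) * (b powr (m - 1) * N powr (m - 1))"
        using A1 m by (intro mult_left_mono) auto
      moreover have "g0 * 1 \<le> g0 * N powr (m - 1)"
        using N(3) m g0 by (intro mult_left_mono ge_one_powr_ge_zero) auto
      ultimately have "norm (gU (traj_pos h gU q p j)) \<le> g0 * N powr (m - 1) + A1 / (m - 1) * (b powr (m - 1) * N powr (m - 1))"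
        using gU_growth[of "traj_pos h gU q p j"] unfolding g0_def by linarith
      then show ?thesis by (simp add: b'_def algebra_simps)
    qed
    have "norm (traj_pos h gU q p k - q - (real k * h) *\<^sub>R p) \<le> (real k)\<^sup>2 * h\<^sup>2 * (b' * N powr (m - 1))"
      using traj_free_flight[where g=gU and h=h and n=T and q=q and p=p and k=k, OF h grad k] by blast
    also have "\<dots> \<le> t\<^sup>2 * h\<^sup>2 * (b' * N powr (m - 1))"
      using k b' by (intro mult_right_mono power_mono) (auto simp: t_def)
    finally have "norm (traj_pos h gU q p k - q - (real k * h) *\<^sub>R p) \<le> t\<^sup>2 * h\<^sup>2 * (b' * N powr (m - 1))" .
    moreover have "norm (traj_pos h gU q p k - (real k * h) *\<^sub>R p) \<le> norm (traj_pos h gU q p k - q - (real k * h) *\<^sub>R p) + norm q"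
      using norm_triangle_ineq[of "traj_pos h gU q p k - q - (real k * h) *\<^sub>R p" q] by (simp add: algebra_simps)
    ultimately show ?thesis using q by linarith
  qed
  have "near_scaling_on (cball p0 (N / 2)) (real T * h) (prop_pos q) \<and>
      norm ((real T * h) *\<^sub>R p0 - prop_pos q p0) + 2 \<le> real T * h * (N / 2) / 2" if q: "norm q \<le> r" for q
  proof
    show "near_scaling_on (cball p0 (N / 2)) (real T * h) (prop_pos q)"
    proof (rule prop_pos_near_scaling[OF \<epsilon>])
      fix k p p' assume k: "1 \<le> k" "k \<le> T" and pp: "p \<in> cball p0 (N / 2)" "p' \<in> cball p0 (N / 2)"
      \<comment> \<open>The radius is made of \<open>k * h * N / 2\<close> from the spread of
        momenta and \<open>h * N / 4\<close> from the deviation from free flight. Points of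
        \<open>S\<close> keep distance at least \<open>h * N / 4\<close> from the origin, the
        distance used in \<open>\<epsilon>\<close>.\<close>
      define S where "S = cball ((real k * h) *\<^sub>R p0) (3 / 4 * (real k * h * N))"
      have khN: "h * N \<le> real k * h * N" using k h N(3) by simp
      have inS: "traj_pos h gU q p k \<in> S" if p: "p \<in> cball p0 (N / 2)" for p
      proof -
        have "norm (traj_pos h gU q p k - (real k * h) *\<^sub>R p) \<le> h * N / 4"
          using flight[OF q p k(2)] drift by linarith
        moreover have "norm ((real k * h) *\<^sub>R (p - p0)) \<le> real k * h * (N / 2)"
        proof -
          have "norm ((real k * h) *\<^sub>R (p - p0)) = (real k * h) * norm (p - p0)" using h by simp
          also have "\<dots> \<le> (real k * h) * (N / 2)"
            using p h by (intro mult_left_mono) (auto simp: dist_norm norm_minus_commute)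
          finally show ?thesis .
        qed
        moreover have "norm (traj_pos h gU q p k - (real k * h) *\<^sub>R p0) \<le> norm (traj_pos h gU q p k - (real k * h) *\<^sub>R p) + norm ((real k * h) *\<^sub>R (p - p0))"
          using norm_triangle_ineq[of "traj_pos h gU q p k - (real k * h) *\<^sub>R p" "(real k * h) *\<^sub>R (p - p0)"]
          by (simp add: algebra_simps)
        ultimately have "norm (traj_pos h gU q p k - (real k * h) *\<^sub>R p0) \<le> 3 / 4 * (real k * h * N)" using khN by simp
        then show ?thesis by (simp add: S_def dist_norm norm_minus_commute)
      qed
      show "norm (gU (traj_pos h gU q p k) - gU (traj_pos h gU q p' k)) \<le> \<epsilon> * norm (traj_pos h gU q p k - traj_pos h gU q p' k)"
      proof (rule gU_lipschitz_on_convex[where S=S])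
        show "convex S" by (simp add: S_def)
        fix z assume z: "z \<in> S"
        have "norm ((real k * h) *\<^sub>R p0) \<le> norm z + norm ((real k * h) *\<^sub>R p0 - z)"
          using norm_triangle_sub[of "(real k * h) *\<^sub>R p0" z] by simp
        moreover have "norm ((real k * h) *\<^sub>R p0) = real k * h * N" using h p0 by simp
        moreover have "norm ((real k * h) *\<^sub>R p0 - z) \<le> 3 / 4 * (real k * h * N)" using z by (simp add: S_def dist_norm)
        ultimately have "h * N / 4 \<le> norm z + 1" using khN by linarith
        then have "(norm z + 1) powr (m - 2) \<le> (h * N / 4) powr (m - 2)"
          using powr_mono2'[of "m - 2" "h * N / 4" "norm z + 1"] h N(3) m2 by simp
        then show "norm (HU z) \<le> \<epsilon>" unfolding \<epsilon>_def using HU_bound[of z] mult_left_mono[OF _ A1] by (meson order_trans)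
      qed (use inS pp in auto)
    qed
    have "norm (prop_pos q p0 - (real T * h) *\<^sub>R p0) \<le> r + t\<^sup>2 * h\<^sup>2 * (b' * N powr (m - 1))"
      using flight[OF q _ order_refl, of p0] N(3) by (simp add: prop_pos_eq_traj)
    then have "norm ((real T * h) *\<^sub>R p0 - prop_pos q p0) + 2 \<le> h * N / 4"
      using drift by (simp add: norm_minus_commute)
    also have "\<dots> \<le> real T * h * (N / 2) / 2" using T h N(3) by simp
    finally show "norm ((real T * h) *\<^sub>R p0 - prop_pos q p0) + 2 \<le> real T * h * (N / 2) / 2" .
  qed
  then show ?thesis unfolding uniformly_near_scaling_def by blast
qed

text \<open>Acceptance times Gaussian density is continuous and positive, hence bounded below by
  some \<open>c\<close> on the compact set of relevant positions and momenta. The volume comparison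
  carries this over to the constant density \<open>c / d\<close> on a fixed unit ball of
  proposals.\<close>

lemma hmc_minorization:
  assumes r: "0 \<le> r" and u: "uniformly_near_scaling r"
  shows "\<exists>\<mu>. finite_measure \<mu> \<and> sets \<mu> = sets borel \<and> emeasure \<mu> UNIV \<noteq> 0 \<and>
    (\<forall>q. norm q \<le> r \<longrightarrow> (\<forall>A\<in>sets borel. emeasure \<mu> A \<le> emeasure (kern q) A))"
proof -
  obtain p0 \<rho> y0 where ns: "\<And>q. norm q \<le> r \<Longrightarrow> near_scaling_on (cball p0 \<rho>) (real T * h) (prop_pos q)"
    and y0: "\<And>q. norm q \<le> r \<Longrightarrow> norm (y0 - prop_pos q p0) + 2 \<le> real T * h * \<rho> / 2"
    using u unfolding uniformly_near_scaling_def by blast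
  define a where "a = real T * h"
  have a: "0 < a" using T h by (simp add: a_def)
  have "2 \<le> a * \<rho> / 2" using y0[of 0] r norm_ge_zero[of "y0 - prop_pos 0 p0"] unfolding a_def by (simp del: norm_ge_zero)
  then have \<rho>: "0 \<le> \<rho>" using a by (smt (verit) divide_nonpos_pos mult_nonneg_nonpos)
  define W where "W z = acc (fst z) (snd z) * std_gauss (snd z)" for z
  have Wc: "continuous_on (cball 0 r \<times> cball p0 \<rho>) W"
    unfolding W_def by (intro continuous_on_mult continuous_on_subset[OF continuous_on_acc]
      continuous_on_compose2[OF continuous_on_std_gauss continuous_on_snd]) (auto intro: continuous_on_id)
  obtain z where z: "z \<in> cball 0 r \<times> cball p0 \<rho>" "\<And>x. x \<in> cball 0 r \<times> cball p0 \<rho> \<Longrightarrow> W z \<le> W x"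
    using continuous_attains_inf[OF compact_Times[OF compact_cball compact_cball] _ Wc] r \<rho> by auto
  define c where "c = W z"
  have c: "0 < c" unfolding c_def W_def by (intro mult_pos_pos acc_bounds std_gauss_pos)
  define d where "d = (2 * a) ^ DIM('a)"
  have d: "0 < d" using a by (simp add: d_def)
  define \<mu> where "\<mu> = density lborel (\<lambda>x. ennreal (c / d) * indicator (ball y0 1) x)"
  have \<mu>: "emeasure \<mu> A = ennreal (c / d) * emeasure lborel (A \<inter> ball y0 1)" if [measurable]: "A \<in> sets borel" for A
  proof -
    have "emeasure \<mu> A = (\<integral>\<^sup>+x. (ennreal (c / d) * indicator (ball y0 1) x) * indicator A x \<partial>lborel)"
      unfolding \<mu>_def by (rule emeasure_density) (auto intro!: borel_measurable_times_ennreal borel_measurable_indicator)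
    also have "\<dots> = (\<integral>\<^sup>+x. ennreal (c / d) * indicator (A \<inter> ball y0 1) x \<partial>lborel)"
      by (intro nn_integral_cong) (auto simp: indicator_def)
    also have "\<dots> = ennreal (c / d) * emeasure lborel (A \<inter> ball y0 1)" by (rule nn_integral_cmult_indicator) simp
    finally show ?thesis .
  qed
  have lower: "emeasure \<mu> A \<le> emeasure (kern q) A" if q: "norm q \<le> r" and A [measurable]: "A \<in> sets borel" for q A
  proof -
    have pA: "prop_pos q -` A \<in> sets borel" by (rule measurable_sets_borel[OF prop_pos_measurable A])
    have "emeasure \<mu> A \<le> ennreal (c / d) * (ennreal d * emeasure lborel (prop_pos q -` A \<inter> cball p0 \<rho>))"
      unfolding \<mu>[OF A] d_def a_def
      by (intro mult_left_mono near_scaling_pullback[OF ns[OF q] prop_pos_measurable _ y0[OF q] A]) (use a in \<open>auto simp: a_def\<close>)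
    also have "\<dots> = ennreal c * emeasure lborel (prop_pos q -` A \<inter> cball p0 \<rho>)"
      using c d by (simp add: mult.assoc[symmetric] ennreal_mult[symmetric])
    also have "\<dots> = (\<integral>\<^sup>+p. ennreal c * indicator (prop_pos q -` A \<inter> cball p0 \<rho>) p \<partial>lborel)"
      by (rule nn_integral_cmult_indicator[symmetric]) (use pA in auto)
    also have "\<dots> \<le> kern_int q (indicator A)"
      unfolding kern_int_def
    proof (rule nn_integral_mono)
      fix p
      have "c \<le> acc q p * std_gauss p" if "p \<in> cball p0 \<rho>"
        using z(2)[of "(q, p)"] that q by (simp add: c_def W_def)
      then have "ennreal c * indicator (prop_pos q -` A \<inter> cball p0 \<rho>) p \<le> indicator A (prop_pos q p) * ennreal (acc q p * std_gauss p)"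
        by (auto simp: indicator_def intro: ennreal_leI)
      then show "ennreal c * indicator (prop_pos q -` A \<inter> cball p0 \<rho>) p
        \<le> indicator A (prop_pos q p) * ennreal (acc q p * std_gauss p) + indicator A q * ennreal ((1 - acc q p) * std_gauss p)"
        by (rule order_trans) simp
    qed
    finally show ?thesis by (simp add: emeasure_kern)
  qed
  have "emeasure \<mu> UNIV \<noteq> 0"
  proof -
    have "emeasure lborel (ball y0 1) = ennreal (unit_ball_vol (real DIM('a)))"
      by (subst emeasure_ball) auto
    moreover have "unit_ball_vol (real DIM('a)) \<noteq> 0" by (rule not_sym, rule less_imp_neq) simp
    ultimately show ?thesis using c d by (simp add: \<mu>)
  qed
  moreover have "finite_measure \<mu>"
  proof
    have "space \<mu> = UNIV" by (simp add: \<mu>_def)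
    moreover have "emeasure \<mu> UNIV \<noteq> \<infinity>"
      using emeasure_lborel_ball_finite[of y0 1] by (auto simp: \<mu> ennreal_mult_eq_top_iff)
    ultimately show "emeasure \<mu> (space \<mu>) \<noteq> \<infinity>" by simp
  qed
  ultimately show ?thesis using lower by (intro exI[of _ \<mu>]) (auto simp: \<mu>_def)
qed

end

section \<open>Geometric ergodicity\<close>

context hmc_potential
begin

text \<open>The two regimes of \<open>m\<close> meet here; they differ only in how
  \<open>far\<close> and \<open>scaling\<close> are supplied.\<close>

lemma geometrically_ergodic_hmc:
  assumes s0: "0 < s0" "0 < c"
    and good: "\<And>q p. Q0 \<le> norm q \<Longrightarrow> h\<^sup>2 * norm q powr (m - 2) \<le> s0 \<Longrightarrow> norm p \<le> s0 * h * norm q powr (m - 1) \<Longrightarrow>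
       hamiltonian U (leapfrog_T h T gU (q, p)) \<le> hamiltonian U (q, p) \<and>
       norm (fst (leapfrog_T h T gU (q, p))) \<le> norm q - c * h\<^sup>2 * norm q powr (m - 1)"
    and far: "\<And>x. Q2 \<le> x \<Longrightarrow> h\<^sup>2 * x powr (m - 2) \<le> s0"
    and scaling: "\<And>r. 0 \<le> r \<Longrightarrow> uniformly_near_scaling r"
  shows "geometrically_ergodic kern (target U)"
proof -
  obtain K where K: "0 \<le> K" "\<And>q. kern_int q (\<lambda>x. ennreal (exp (norm x))) \<le> ennreal (1 / 2 * exp (norm q) + K)"
    using hmc_drift[OF s0 good far] by blast
  interpret harris_chain kern "target U" "\<lambda>x. exp (norm x)" "1 / 2" K
  proof
    show "kern \<in> borel \<rightarrow>\<^sub>M prob_algebra borel" by (rule kern_measurable)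
    show "target U \<in> space (prob_algebra borel)" by (rule target_space)
    show "target U \<bind> kern = target U" by (rule target_invariant)
    show "(\<integral>\<^sup>+y. ennreal (exp (norm y)) \<partial>kern x) \<le> ennreal (1 / 2 * exp (norm x) + K)" for x
      by (subst nn_integral_kern) (use K(2) in auto)
    fix r :: real
    obtain \<mu> where \<mu>: "finite_measure \<mu>" "sets \<mu> = sets borel" "emeasure \<mu> UNIV \<noteq> 0"
      "\<forall>q. norm q \<le> \<bar>ln r\<bar> \<longrightarrow> (\<forall>A\<in>sets borel. emeasure \<mu> A \<le> emeasure (kern q) A)"
      using hmc_minorization[OF abs_ge_zero scaling[OF abs_ge_zero], of "ln r"] by blast
    \<comment> \<open>Level sets of \<open>V\<close> are balls. For \<open>r < 1\<close> they are
      empty, and the absolute value merely keeps the radius nonnegative.\<close>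
    have "norm x \<le> \<bar>ln r\<bar>" if "exp (norm x) \<le> r" for x :: 'a
    proof -
      have "0 < r" using that exp_gt_zero[of "norm x"] by linarith
      then have "norm x \<le> ln r" using that by (simp add: ln_ge_iff)
      then show ?thesis by simp
    qed
    then show "\<exists>\<mu>. finite_measure \<mu> \<and> sets \<mu> = sets borel \<and> emeasure \<mu> UNIV \<noteq> 0 \<and>
        (\<forall>x. exp (norm x) \<le> r \<longrightarrow> (\<forall>A\<in>sets borel. emeasure \<mu> A \<le> emeasure (kern x) A))"
      using \<mu> by (intro exI[of _ \<mu>]) simp
  qed (use K in auto)
  show ?thesis by (rule harris)
qed

end

theorem theorem9:
  fixes U :: "'a::euclidean_space \<Rightarrow> real"
    and gU :: "'a \<Rightarrow> 'a"
    and HU :: "'a \<Rightarrow> ('a \<Rightarrow>\<^sub>L 'a)"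
    and D3U :: "'a \<Rightarrow> ('a \<Rightarrow>\<^sub>L ('a \<Rightarrow>\<^sub>L 'a))"
    and m :: real
  assumes m: "1 < m" "m \<le> 2"
    and dU: "\<And>q. (U has_derivative (\<lambda>v. gU q \<bullet> v)) (at q)"
    and d2U: "\<And>q. (gU has_derivative blinfun_apply (HU q)) (at q)"
    and d3U: "\<And>q. (HU has_derivative blinfun_apply (D3U q)) (at q)"
    and cont3: "continuous_on UNIV D3U"
    and integ: "integrable lborel (\<lambda>q. exp (- U q))"
    and A: "\<exists>A1\<ge>0. \<forall>q. norm (HU q) \<le> A1 * (norm q + 1) powr (m - 2)
                       \<and> norm (D3U q) \<le> A1 * (norm q + 1) powr (m - 3)"
    and B: "\<exists>A2>0. \<exists>R\<ge>0. \<forall>q. norm q \<ge> R \<longrightarrow>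
                       gU q \<bullet> (HU q) (gU q) \<ge> A2 * norm q powr (3 * m - 4)"
    and C: "\<exists>A3>0. \<exists>A4::real. \<forall>q. gU q \<bullet> q \<ge> A3 * norm q powr m - A4"
  shows "(m < 2 \<longrightarrow> (\<forall>T::nat. \<forall>h::real. 1 \<le> T \<longrightarrow> 0 < h \<longrightarrow>
            geometrically_ergodic (hmc_kernel U gU h T) (target U)))
       \<and> (m = 2 \<longrightarrow> (\<forall>T::nat. 1 \<le> T \<longrightarrow> (\<exists>hH>0. \<forall>h. 0 < h \<and> h \<le> hH \<longrightarrow>
            geometrically_ergodic (hmc_kernel U gU h T) (target U))))"
proof -
  obtain A1 where A1: "0 \<le> A1" "\<And>q. norm (HU q) \<le> A1 * (norm q + 1) powr (m - 2)"
    "\<And>q. norm (D3U q) \<le> A1 * (norm q + 1) powr (m - 3)" using A by blast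
  obtain A2 R where A2: "0 < A2" "\<And>q. R \<le> norm q \<Longrightarrow> A2 * norm q powr (3 * m - 4) \<le> gU q \<bullet> (HU q) (gU q)"
    using B by blast
  obtain A3 A4 where A3: "0 < A3" "\<And>q. A3 * norm q powr m - A4 \<le> gU q \<bullet> q" using C by blast
  interpret potential U gU HU D3U m A1 A2 R A3 A4
    by unfold_locales (fact m dU d2U d3U A1 A2 A3)+
  have hmc: "hmc_potential U gU HU D3U m A1 A2 R A3 A4 h T" if "0 < h" "1 \<le> T" for h T
    using that integ by unfold_locales
  show ?thesis
  proof (intro conjI impI allI)
    fix T :: nat and h :: real
    assume m2: "m < 2" and T: "1 \<le> T" and h: "0 < h"
    interpret hmc_potential U gU HU D3U m A1 A2 R A3 A4 h T by (rule hmc[OF h T])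
    obtain s0 Q0 c where s: "0 < s0" "1 \<le> Q0" "0 < c" and
      good: "\<And>h q p. 0 < h \<Longrightarrow> Q0 \<le> norm q \<Longrightarrow> h\<^sup>2 * norm q powr (m - 2) \<le> s0 \<Longrightarrow>
       norm p \<le> s0 * h * norm q powr (m - 1) \<Longrightarrow>
       hamiltonian U (leapfrog_T h T gU (q, p)) \<le> hamiltonian U (q, p) \<and>
       norm (fst (leapfrog_T h T gU (q, p))) \<le> norm q - c * h\<^sup>2 * norm q powr (m - 1)"
      by (rule inward_accepted_proposal[OF T]) blast
    have "((\<lambda>x. h\<^sup>2 * x powr (m - 2)) \<longlongrightarrow> 0) at_top"
      by (intro tendsto_mult_right_zero tendsto_neg_powr[OF _ filterlim_ident]) (use m2 in simp)
    then have "eventually (\<lambda>x. h\<^sup>2 * x powr (m - 2) < s0) at_top" by (rule order_tendstoD(2)) (rule s)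
    then obtain Q2 where "\<And>x. Q2 \<le> x \<Longrightarrow> h\<^sup>2 * x powr (m - 2) < s0" by (auto simp: eventually_at_top_linorder)
    then have far: "h\<^sup>2 * x powr (m - 2) \<le> s0" if "Q2 \<le> x" for x using that by (simp add: less_imp_le)
    show "geometrically_ergodic (hmc_kernel U gU h T) (target U)"
      by (rule geometrically_ergodic_hmc[OF s(1,3) good[OF h] far uniformly_near_scaling_subquadratic[OF m2]])
  next
    fix T :: nat assume m2: "m = 2" and T: "1 \<le> T"
    obtain s0 Q0 c where s: "0 < s0" "1 \<le> Q0" "0 < c" and
      good: "\<And>h q p. 0 < h \<Longrightarrow> Q0 \<le> norm q \<Longrightarrow> h\<^sup>2 * norm q powr (m - 2) \<le> s0 \<Longrightarrow>
       norm p \<le> s0 * h * norm q powr (m - 1) \<Longrightarrow>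
       hamiltonian U (leapfrog_T h T gU (q, p)) \<le> hamiltonian U (q, p) \<and>
       norm (fst (leapfrog_T h T gU (q, p))) \<le> norm q - c * h\<^sup>2 * norm q powr (m - 1)"
      by (rule inward_accepted_proposal[OF T]) blast
    \<comment> \<open>The bound 1 gives \<open>h\<^sup>2 \<le> h\<close>, so conditions on h^2
      become conditions on \<open>h\<close>: one for the drift, one for the minorization. The
      \<open>+ 1\<close> guards against \<open>A1 = 0\<close>.\<close>
    define hH where "hH = min 1 (min s0 (lip_tol T / (A1 + 1)))"
    have hH: "0 < hH" using s lip_tol(1)[OF T] A1(1) by (auto simp: hH_def)
    have "geometrically_ergodic (hmc_kernel U gU h T) (target U)" if h0: "0 < h" "h \<le> hH" for h
    proof -
      interpret hmc_potential U gU HU D3U m A1 A2 R A3 A4 h T by (rule hmc[OF h0(1) T])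
      have hle: "h \<le> 1" "h \<le> s0" "h \<le> lip_tol T / (A1 + 1)" using h0(2) by (auto simp: hH_def)
      have h2: "h\<^sup>2 \<le> h" using hle(1) h by (simp add: power2_eq_square mult_left_le)
      \<comment> \<open>With \<open>m = 2\<close> the power has exponent 0, so its value is 1, or 0
        at \<open>x = 0\<close>; smallness must come from \<open>h\<close>.\<close>
      have far: "h\<^sup>2 * x powr (m - 2) \<le> s0" if "0 \<le> x" for x
        using h2 hle s m2 by (auto simp: powr_zero_eq_one)
      have "0 < A1 + 1" using A1(1) by simp
      then have "h * (A1 + 1) \<le> lip_tol T" using hle(3) by (simp only: pos_le_divide_eq)
      moreover have "h\<^sup>2 * A1 \<le> h * (A1 + 1)" using h2 A1(1) h by (intro mult_mono) auto
      ultimately have small: "h\<^sup>2 * A1 \<le> lip_tol T" by linarith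
      show ?thesis
        by (rule geometrically_ergodic_hmc[OF s(1,3) good[OF h] far uniformly_near_scaling_small_step[OF small]])
    qed
    then show "\<exists>hH>0. \<forall>h. 0 < h \<and> h \<le> hH \<longrightarrow> geometrically_ergodic (hmc_kernel U gU h T) (target U)"
      using hH by blast
  qed
qed

end
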